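(* Consider the sequence of $GI/GI/1+GI$ queues described in the context, and assume that conditions (A1)–(A5) stated there hold, with $p\in(2,\infty)$ the exponent in (A1) and $H$ the function in (A3). Assume further that there are $m\in(0,p-1)$ and $C\in(0,\infty)$, independent of $n$, such that $\sqrt n\,F^n(x/\sqrt n)\le C(1+x^m)$ for all $x\ge 0$ and all $n$. For $n$ large enough that the stationary distribution of $(\tau^n,V^n)$ exists, let $V^n(\infty)$ have the stationary marginal distribution of $V^n$, and let $$P_a^n=\mathbb E[F^n(V^n(\infty))]$$ be the stationary abandonment probability. Then, as $n\to\infty$, $$\sqrt n\,P_a^n\to\mathbb E[H(V(\infty))],$$ where $V(\infty)$ is a random variable with density $$f(x)=M\exp\left(\frac{2}{\sigma^2}\left(\frac{\theta}{\lambda}x-\int_0^x H(s)\,ds\right)\right),\quad x\ge0,$$ with $\sigma^2=\lambda^{-1}(\operatorname{var}(u_2)+\operatorname{var}(v_2))$ and $M\in(0,\infty)$ such that $\int_0^\infty f(x)\,dx=1$.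
   Context: Model. $\mathbb N=\{1,2,\dots\}$, $\mathbb N_0=\mathbb N\cup\{0\}$, $\mathbb R_+=[0,\infty)$. For each $n\in\mathbb N$ consider a single-server first-in-first-out queue with customer abandonment. On a common probability space there are i.i.d. sequences of nonnegative random variables with unit mean, $\{u_i\}_{i\ge 2}$ and $\{v_i\}_{i\ge 1}$, and for each $n$ an i.i.d. sequence of nonnegative patience times $\{d_i^n\}_{i\ge1}$ with right-continuous distribution function $F^n$; for each $n$ the three sequences $\{u_i\},\{v_i\},\{d^n_i\}$ are mutually independent. Let $\lambda^n,\mu^n>0$. In the $n$-th system the interarrival times are $u_j^n=u_j/\lambda^n$ ($j\ge2$) and the service times are $v_j^n=v_j/\mu^n$ ($j\ge1$). Given an initial state $(\tau_0,v_0)\in\mathbb S=\mathbb R_+\times\mathbb R_+$ (remaining time to the first arrival, and initial offered waiting time), the arrival times are $t_1^n=\tau_0$ and $t_i^n=\tau_0+\sum_{j=2}^i u_j^n$ for $i\ge2$; $t_0^n\le 0$ denotes the time of the last arrival at or before time $0$. Let $A^n(t)=\max\{i\in\mathbb N_0: t_i^n\le t\}$. The $i$-th customer abandons without service if its processing does not begin by time $t_i^n+d_i^n$. The offered waiting time process $V^n$ is the nonnegative process satisfying $$V^n(t)=v_0+\sum_{j=1}^{A^n(t)} v_j^n\,\mathbf 1_{[V^n(t_j^n-)<d_j^n]}-\int_0^t \mathbf 1_{[V^n(s)>0]}\,ds\ \ge 0,\qquad t\ge0$$ (if $t_1^n=0$, $V^n(t_1^n-)$ is read as $v_0$). The remaining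 arrival time is $\tau^n(t)=t_{j+1}^n-t$ for $t\in[t_j^n,t_{j+1}^n)$, $j\in\mathbb N_0$. The process $\mathbb X^n=\{(\tau^n(t),V^n(t)):t\ge0\}$ is a strong Markov process with state space $\mathbb S$. Under (A1)–(A5) below, for all sufficiently large $n$ the process $\mathbb X^n$ has a unique stationary probability distribution; the stationary marginal distribution of $V^n$ is its second-coordinate marginal. Assumptions. (A1) For some $p\in(2,\infty)$, $\mathbb E[u_2^p+v_2^p]<\infty$. (A2) $\lambda^n=n\lambda$ with $\lambda\in(0,\infty)$, $\lim_{n\to\infty}\mu^n/n=\lambda$, and $\lim_{n\to\infty}\sqrt n\,(\lambda-\mu^n/n)=\theta\in\mathbb R$. (A3) $F^n(0)=0$ for all $n$, and there is a nonnegative continuously differentiable function $H$ on $\mathbb R_+$ such that for each $K>0$, $\lim_{n\to\infty}\sup_{x\in[0,K]}\left|\sqrt n F^n(x/\sqrt n)-H(x)\right|=0$. (A4) $\lim_{x\to\infty}H(x)>\theta/\lambda$. (A5) The interarrival times are unbounded: $\mathbb P(u_2\ge u)>0$ for every $u>0$. *)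

theory Defs
  imports "HOL-Probability.Probability"
begin

text \<open>
  The driving sequences of the \<open>n\<close>-th system. The sequences are i.i.d. and independent of each
  other, which is the joint independence of the single family made up of all
  \<open>u i\<close> (\<open>i \<ge> 2\<close>), \<open>v i\<close> (\<open>i \<ge> 1\<close>) and \<open>d i\<close> (\<open>i \<ge> 1\<close>).
\<close>

definition queue_primitives ::
  "'a measure \<Rightarrow> (nat \<Rightarrow> 'a \<Rightarrow> real) \<Rightarrow> (nat \<Rightarrow> 'a \<Rightarrow> real) \<Rightarrow> (nat \<Rightarrow> 'a \<Rightarrow> real) \<Rightarrow> bool" where
  "queue_primitives M u v d \<longleftrightarrow>
     prob_space M \<and>
     prob_space.indep_vars M (\<lambda>_. borel) (case_sum u (case_sum v d)) ({2..} <+> ({1..} <+> {1..})) \<and>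
     (\<forall>i\<ge>2. distr M borel (u i) = distr M borel (u 2)) \<and>
     (\<forall>i\<ge>1. distr M borel (v i) = distr M borel (v 1)) \<and>
     (\<forall>i\<ge>1. distr M borel (d i) = distr M borel (d 1)) \<and>
     (\<forall>i\<ge>2. AE \<omega> in M. 0 \<le> u i \<omega>) \<and>
     (\<forall>i\<ge>1. AE \<omega> in M. 0 \<le> v i \<omega>) \<and>
     (\<forall>i\<ge>1. AE \<omega> in M. 0 \<le> d i \<omega>) \<and>
     (\<forall>i\<ge>2. integrable M (u i) \<and> (\<integral>\<omega>. u i \<omega> \<partial>M) = 1) \<and>
     (\<forall>i\<ge>1. integrable M (v i) \<and> (\<integral>\<omega>. v i \<omega> \<partial>M) = 1)"

text \<open>
  The following path functionals take one realization of the (already scaled) interarrival times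
  \<open>U\<close>, service times \<open>S\<close> and patience times \<open>D\<close>, and an initial state \<open>(\<tau>0, v0)\<close>.
  The arrival times are meant for indices \<open>i \<ge> 1\<close> only. The time \<open>t\<^sub>0 \<le> 0\<close> of the last
  arrival before the origin enters the model only through the fact that \<open>t\<^sub>0 \<le> t\<close> for all
  \<open>t \<ge> 0\<close>, that is, through the index \<open>0\<close> always being admitted in the maximum below.
\<close>

definition arrival_time :: "(nat \<Rightarrow> real) \<Rightarrow> real \<Rightarrow> nat \<Rightarrow> real" where
  "arrival_time U \<tau>0 i = \<tau>0 + (\<Sum>j=2..i. U j)"

definition arrival_count :: "(nat \<Rightarrow> real) \<Rightarrow> real \<Rightarrow> real \<Rightarrow> nat" where
  "arrival_count U \<tau>0 t = Max ({0} \<union> {i. 1 \<le> i \<and> arrival_time U \<tau>0 i \<le> t})"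

definition remaining_arrival_time :: "(nat \<Rightarrow> real) \<Rightarrow> real \<Rightarrow> real \<Rightarrow> real" where
  "remaining_arrival_time U \<tau>0 t = arrival_time U \<tau>0 (Suc (arrival_count U \<tau>0 t)) - t"

text \<open>The value \<open>W(s-)\<close>, read as \<open>v0\<close> at the time origin.\<close>

definition left_value :: "real \<Rightarrow> (real \<Rightarrow> real) \<Rightarrow> real \<Rightarrow> real" where
  "left_value v0 W s = (if s = 0 then v0 else Lim (at_left s) W)"

definition offered_waiting_path ::
  "(nat \<Rightarrow> real) \<Rightarrow> (nat \<Rightarrow> real) \<Rightarrow> (nat \<Rightarrow> real) \<Rightarrow> real \<Rightarrow> real \<Rightarrow> (real \<Rightarrow> real) \<Rightarrow> bool" where
  "offered_waiting_path U S D \<tau>0 v0 W \<longleftrightarrow>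
     (\<forall>t\<ge>0. W t = v0
        + (\<Sum>j=1..arrival_count U \<tau>0 t.
             S j * of_bool (left_value v0 W (arrival_time U \<tau>0 j) < D j))
        - (LINT s:{0..t}|lborel. of_bool (W s > 0))
      \<and> W t \<ge> 0)"

definition offered_waiting_process ::
  "'a measure \<Rightarrow> (nat \<Rightarrow> 'a \<Rightarrow> real) \<Rightarrow> (nat \<Rightarrow> 'a \<Rightarrow> real) \<Rightarrow> (nat \<Rightarrow> 'a \<Rightarrow> real) \<Rightarrow>
   real \<times> real \<Rightarrow> (real \<Rightarrow> 'a \<Rightarrow> real) \<Rightarrow> bool" where
  "offered_waiting_process M U S D x W \<longleftrightarrow>
     (\<forall>t\<ge>0. W t \<in> borel_measurable M) \<and>
     (AE \<omega> in M. offered_waiting_path (\<lambda>j. U j \<omega>) (\<lambda>j. S j \<omega>) (\<lambda>j. D j \<omega>)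
                   (fst x) (snd x) (\<lambda>t. W t \<omega>))"

definition queue_states :: "(real \<times> real) set" where
  "queue_states = {0..} \<times> {0..}"

text \<open>The state \<open>(\<tau>(t), V(t))\<close> when the system is started in \<open>x\<close>.\<close>

definition queue_process ::
  "(nat \<Rightarrow> 'a \<Rightarrow> real) \<Rightarrow> (real \<times> real \<Rightarrow> real \<Rightarrow> 'a \<Rightarrow> real) \<Rightarrow>
   real \<times> real \<Rightarrow> real \<Rightarrow> 'a \<Rightarrow> real \<times> real" where
  "queue_process U V x t \<omega> = (remaining_arrival_time (\<lambda>j. U j \<omega>) (fst x) t, V x t \<omega>)"

text \<open>
  Invariant probability measures of the Markov process whose transition function is
  \<open>P\<^sub>t(x, B) = P(X\<^sub>x(t) \<in> B)\<close>, where \<open>X\<^sub>x\<close> is the process started in \<open>x\<close>. Distributions on the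
  state space are Borel measures on the plane that are carried by \<^const>\<open>queue_states\<close>.
\<close>

definition stationary_distribution ::
  "'a measure \<Rightarrow> (real \<times> real \<Rightarrow> real \<Rightarrow> 'a \<Rightarrow> real \<times> real) \<Rightarrow> (real \<times> real) measure \<Rightarrow> bool" where
  "stationary_distribution M X \<pi> \<longleftrightarrow>
     prob_space \<pi> \<and> sets \<pi> = sets borel \<and> (AE x in \<pi>. x \<in> queue_states) \<and>
     (\<forall>t\<ge>0. \<forall>B\<in>sets borel.
        emeasure \<pi> B = (\<integral>\<^sup>+x. emeasure M {\<omega> \<in> space M. X x t \<omega> \<in> B} \<partial>\<pi>))"

definition abandonment_probability :: "(real \<Rightarrow> real) \<Rightarrow> (real \<times> real) measure \<Rightarrow> real" where
  "abandonment_probability F \<pi> = (\<integral>x. F x \<partial>(distr \<pi> borel snd))"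

definition limit_density ::
  "real \<Rightarrow> real \<Rightarrow> real \<Rightarrow> real \<Rightarrow> (real \<Rightarrow> real) \<Rightarrow> real \<Rightarrow> real" where
  "limit_density c \<sigma>2 \<theta> lam H x =
     (if x \<ge> 0 then c * exp (2 / \<sigma>2 * (\<theta> / lam * x - integral {0..x} H)) else 0)"

end

theory Submission
  imports Defs "HOL-Real_Asymp.Real_Asymp"
begin

text \<open>
  The route avoids process-level diffusion limits. It is a stationary argument in the spirit of Stein's
  method: the expectation of \<open>H\<close> is read off from a single well-chosen test function.

  First, the path equation for the offered waiting time is solved explicitly between arrivals
  (\<open>workload_between_arrivals\<close>, \<open>offered_waiting_path_determined\<close>), so a stationary distribution \<open>\<pi>\<close> of the
  Markov process is invariant for an explicit functional of independent inputs (\<open>stationary_queueI\<close>).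
  Counting the arrivals in \<open>(0, 1]\<close> under \<open>\<pi>\<close> gives the law of what an arriving customer meets. It is
  invariant for the one-customer recursion of Lindley type (\<open>arrival_law_invariant\<close>), and \<open>\<pi>\<close> is recovered
  from it by integrating over one interarrival time (\<open>inversion\<close>).

  Second, scale by \<open>sqrt n\<close>. A customer who meets the scaled workload \<open>w\<close> changes it by a net input with mean
  about \<open>(\<theta> / lam - H w) / (n * lam)\<close> and second moment about \<open>\<sigma>2 / (n * lam)\<close>, and the workload is reflected
  at zero. Stability makes a power of the workload a Lyapunov function, which bounds the moment of order
  \<open>p - 1\<close> uniformly in \<open>n\<close> (\<open>workload_moment\<close>). Customers who arrive at the same time meet different
  workloads but the same left limit; this gap is of the order of single service times
  (\<open>batch_moment\<close>).

  Third, let \<open>g\<close> solve \<open>\<sigma>2 / 2 * g' + (\<theta> / lam - H) * g = H - h\<close> with \<open>g 0 = 0\<close>, where \<open>h\<close> is the mean of \<open>H\<close>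
  under the limit density (\<open>stein_solution\<close>). Both \<open>g\<close> and its derivative are bounded. Expanding an antiderivative
  of \<open>g\<close> along one step of the invariant recursion shows that the mean of \<open>H\<close> under the arrival law
  tends to \<open>h\<close> (\<open>arrival_average_limit\<close>).

  Finally, the scaled abandonment probability is a time average. The inversion formula turns it into a mean over one
  interarrival time started from the arrival law, during which the workload hardly moves on the scale
  \<open>sqrt n\<close> (\<open>time_average_limit\<close>).
\<close>

section \<open>Workload paths and their epochs\<close>

lemma idle_integral_eq_measure:
  fixes W :: "real \<Rightarrow> real"
  shows "(LINT s:{0..t}|lborel. of_bool (W s > 0)) =
    (if {s\<in>{0..t}. W s > 0} \<in> sets borel then measure lborel {s\<in>{0..t}. W s > 0} else 0)"
proof -
  let ?A = "{s\<in>{0..t}. W s > 0}"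
  have eq: "(\<lambda>s. indicator {0..t} s *\<^sub>R of_bool (W s > 0)) = (indicator ?A :: real \<Rightarrow> real)"
    by (auto simp: indicator_def)
  have *: "(LINT s:{0..t}|lborel. of_bool (W s > 0)) = (\<integral>s. (indicator ?A s::real) \<partial>lborel)"
    unfolding set_lebesgue_integral_def eq ..
  show ?thesis
  proof (cases "?A \<in> sets borel")
    case True
    then show ?thesis unfolding * by simp
  next
    case False
    have "\<not> integrable lborel (indicator ?A :: real \<Rightarrow> real)"
    proof
      assume "integrable lborel (indicator ?A :: real \<Rightarrow> real)"
      then have "(indicator ?A :: real \<Rightarrow> real) \<in> borel_measurable lborel" by auto
      then have "?A \<in> sets lborel" by (simp add: borel_measurable_indicator_iff)
      then show False using False by simp
    qed
    then have "(\<integral>s. (indicator ?A s::real) \<partial>lborel) = 0" by (rule not_integrable_integral_eq)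
    then show ?thesis unfolding * using False by (simp only: if_False)
  qed
qed

text \<open>
  Between two arrivals the path equation says that the workload has been reduced by the busy time.
  If a solution exists at all, it is nonincreasing there, so it is positive on an initial piece and
  zero afterwards, and equals the drained initial value. The delicate point is that measurability of
  the busy set is not given, and the Lebesgue integral of a non-measurable indicator is zero. At the
  first time where measurability could fail, the workload would be constant from then on; its
  positivity set would be a measurable set plus an interval, which is a contradiction.
\<close>

lemma workload_between_arrivals:
  fixes W :: "real \<Rightarrow> real"
  defines "A \<equiv> \<lambda>t. {s\<in>{0..t}. W s > 0}"
  defines "I \<equiv> \<lambda>t. LINT s:{0..t}|lborel. of_bool (W s > 0)"
  assumes ab: "0 \<le> a" "a \<le> b" and c: "0 \<le> c" and Aa: "A a \<in> sets borel"
    and W: "\<And>t. a \<le> t \<Longrightarrow> t < b \<Longrightarrow> W t = c - (I t - I a) \<and> W t \<ge> 0"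
  shows "\<And>t. a \<le> t \<Longrightarrow> t < b \<Longrightarrow> W t = max 0 (c - (t - a))"
    and "A b \<in> sets borel"
    and "c - (I b - I a) = max 0 (c - (b - a))"
proof -
  have I: "I t = (if A t \<in> sets borel then measure lborel (A t) else 0)" for t
    unfolding A_def I_def by (rule idle_integral_eq_measure)
  have fin: "B \<in> fmeasurable lborel" if "B \<subseteq> {0..t}" "B \<in> sets borel" for B and t :: real
  proof -
    have "bounded B" using that bounded_subset bounded_closed_interval by blast
    then show ?thesis using emeasure_bounded_finite that by (auto simp: fmeasurable_def)
  qed
  have A_sub: "A t \<subseteq> {0..t}" for t by (auto simp: A_def)
  have below: "A q \<in> sets borel" if "q \<le> a" for q
  proof -
    have "A q = A a \<inter> {..q}" using that by (auto simp: A_def)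
    then show ?thesis using Aa by simp
  qed
  have meas: "A t \<in> sets borel" if t: "a \<le> t" "t < b" for t
  proof (rule ccontr)
    assume nm: "A t \<notin> sets borel"
    \<comment> \<open>Measurability is inherited by earlier times, so the failing times form an upper set.\<close>
    define T where "T = {s\<in>{a..t}. A s \<notin> sets borel}"
    have up: "r \<in> T" if "s \<in> T" "s \<le> r" "r \<le> t" for s r
    proof -
      have "A s = A r \<inter> {..s}" using that by (auto simp: A_def)
      then show ?thesis using that by (auto simp: T_def)
    qed
    have tT: "t \<in> T" using nm t by (auto simp: T_def)
    have bdd: "bdd_below T" by (auto simp: T_def bdd_below_def)
    define s0 where "s0 = Inf T"
    have "s0 \<le> t" unfolding s0_def by (rule cInf_lower[OF tT bdd])
    moreover have "a \<le> s0" unfolding s0_def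
      by (rule cInf_greatest) (use tT in \<open>auto simp: T_def\<close>)
    ultimately have s0t: "s0 \<le> t" "a \<le> s0" .
    have above: "r \<in> T" if r: "s0 < r" "r \<le> t" for r
    proof -
      have "\<exists>s\<in>T. s < r" using r(1) cInf_less_iff[OF _ bdd, of r] tT unfolding s0_def by blast
      then obtain s where "s \<in> T" "s < r" by blast
      then show ?thesis using up r by auto
    qed
    have const: "W r = c + I a" if "r \<in> T" for r
    proof -
      have r: "a \<le> r" "r < b" "A r \<notin> sets borel" using that t by (auto simp: T_def)
      have "I r = 0" using r(3) I[of r] by (simp only: if_False)
      then show ?thesis using W[OF r(1,2)] by simp
    qed
    \<comment> \<open>Where the busy set is not measurable its integral is zero by convention, so the equation forces the
      workload to be the same constant at all those times.\<close>
    have tail: "A t \<inter> {s0<..} = (if c + I a > 0 then {s0<..t} else {})"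
      using above const ab s0t by (auto simp: A_def)
    have split: "A t = (\<Union>q\<in>\<rat>\<inter>{..<s0}. A q) \<union> (A t \<inter> {s0}) \<union> (A t \<inter> {s0<..})"
    proof (intro set_eqI iffI)
      fix y assume y: "y \<in> A t"
      show "y \<in> (\<Union>q\<in>\<rat>\<inter>{..<s0}. A q) \<union> (A t \<inter> {s0}) \<union> (A t \<inter> {s0<..})"
      proof (cases "y < s0")
        case True
        then obtain q where "q \<in> \<rat>" "y < q" "q < s0" using Rats_dense_in_real by blast
        then show ?thesis using y by (auto simp: A_def intro!: bexI[of _ q])
      qed (use y in auto)
    next
      fix y assume "y \<in> (\<Union>q\<in>\<rat>\<inter>{..<s0}. A q) \<union> (A t \<inter> {s0}) \<union> (A t \<inter> {s0<..})"
      then show "y \<in> A t" using s0t by (auto simp: A_def)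
    qed
    have Aq: "A q \<in> sets borel" if "q < s0" for q
    proof (cases "q \<le> a")
      case False
      have "q \<notin> T" using that cInf_lower[OF _ bdd, of q] by (auto simp: s0_def)
      then show ?thesis using that s0t False by (auto simp: T_def)
    qed (rule below)
    have "(\<Union>q\<in>\<rat>\<inter>{..<s0}. A q) \<in> sets borel"
      by (intro sets.countable_UN' countable_Int1 countable_rat) (auto intro: Aq)
    moreover have "A t \<inter> {s0} \<in> sets borel"
      by (cases "s0 \<in> A t") auto
    moreover have "A t \<inter> {s0<..} \<in> sets borel" unfolding tail by auto
    ultimately have "A t \<in> sets borel" by (subst split) (intro sets.Un)
    then show False using nm by simp
  qed
  have Im: "I t = measure lborel (A t)" if "a \<le> t" "t < b" for t
    using meas[OF that] I by simp
  have Ia: "I a = measure lborel (A a)" using Aa I by simp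
  have anti: "W t \<le> W s" if "a \<le> s" "s \<le> t" "t < b" for s t
  proof -
    have "measure lborel (A s) \<le> measure lborel (A t)"
    proof (rule measure_mono_fmeasurable)
      show "A s \<subseteq> A t" using that by (auto simp: A_def)
      show "A s \<in> sets lborel" using meas[of s] that by simp
      show "A t \<in> fmeasurable lborel" using meas[of t] that by (intro fin[OF A_sub]) auto
    qed
    then show ?thesis using Im[of s] Im[of t] W[of s] W[of t] that by auto
  qed
  have union: "measure lborel (A a \<union> {a<..<x}) = I a + (x - a)" 
      "measure lborel (A a \<union> {a<..x}) = I a + (x - a)" if "a \<le> x" for x
  proof -
    have dis: "A a \<inter> {a<..<x} = {}" "A a \<inter> {a<..x} = {}" by (auto simp: A_def)
    have f: "A a \<in> fmeasurable lborel" "{a<..<x} \<in> fmeasurable lborel" "{a<..x} \<in> fmeasurable lborel"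
      using ab by (auto intro!: fin[OF A_sub Aa] fin[where t = x])
    show "measure lborel (A a \<union> {a<..<x}) = I a + (x - a)"
      using f dis that Ia by (subst measure_Un_AE) (auto intro!: AE_I2)
    show "measure lborel (A a \<union> {a<..x}) = I a + (x - a)"
      using f dis that Ia by (subst measure_Un_AE) (auto intro!: AE_I2)
  qed
  show expl: "W t = max 0 (c - (t - a))" if t: "a \<le> t" "t < b" for t
  proof -
    have "measure lborel (A t) \<le> measure lborel (A a \<union> {a<..t})"
    proof (rule measure_mono_fmeasurable)
      show "A t \<subseteq> A a \<union> {a<..t}" by (auto simp: A_def)
      show "A t \<in> sets lborel" using meas[OF t] by simp
      show "A a \<union> {a<..t} \<in> fmeasurable lborel"
        using Aa t ab by (intro fin[where t = t]) (auto simp: A_def)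
    qed
    then have ge: "W t \<ge> c - (t - a)" "W t \<ge> 0"
      using W[OF t] union(2)[OF t(1)] Im[OF t] by auto
    have "W t = c - (t - a)" if pos: "W t > 0"
    proof -
      have "A t = A a \<union> {a<..t}"
      proof (intro set_eqI iffI)
        fix y assume "y \<in> A a \<union> {a<..t}"
        then show "y \<in> A t" using anti[of y t] t pos ab by (auto simp: A_def intro: less_le_trans)
      qed (auto simp: A_def)
      then show ?thesis using W[OF t] union(2)[OF t(1)] Im[OF t] by simp
    qed
    then show ?thesis using ge by (cases "W t > 0") auto
  qed
  define x where "x = min b (a + c)"
  have ax: "a \<le> x" using ab c by (auto simp: x_def)
  have Ab: "A b = A a \<union> {a<..<x} \<union> (A b \<inter> {b})"
  proof (intro set_eqI iffI)
    fix y assume "y \<in> A b"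
    then show "y \<in> A a \<union> {a<..<x} \<union> (A b \<inter> {b})"
      using expl[of y] by (cases "y \<le> a"; cases "y = b") (auto simp: A_def x_def)
  next
    fix y assume "y \<in> A a \<union> {a<..<x} \<union> (A b \<inter> {b})"
    then show "y \<in> A b" using expl[of y] ab by (auto simp: A_def x_def)
  qed
  have pt: "A b \<inter> {b} \<in> sets borel" by (cases "b \<in> A b") auto
  show Abm: "A b \<in> sets borel" using Aa pt by (subst Ab) (intro sets.Un, auto)
  have "AE y in lborel. y \<noteq> b" by (rule AE_lborel_singleton)
  then have "measure lborel (A b) = measure lborel (A a \<union> {a<..<x})"
  proof (intro measure_eq_AE)
    have eq: "y \<in> A b \<longleftrightarrow> y \<in> A a \<union> {a<..<x}" if "y \<noteq> b" for y
      using that by (subst Ab) blast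
    show "AE y in lborel. y \<in> A b \<longleftrightarrow> y \<in> A a \<union> {a<..<x}" if "AE y in lborel. y \<noteq> b"
      using that by eventually_elim (rule eq)
  qed (use Abm Aa in auto)
  then have "I b = I a + (x - a)" using Abm I[of b] union(1)[OF ax] by simp
  then show "c - (I b - I a) = max 0 (c - (b - a))" by (auto simp: x_def)
qed


text \<open>
  An epoch state \<open>(\<tau>, W, L)\<close> describes the instant just after an arrival: the time \<open>\<tau>\<close> to the next
  arrival, the workload \<open>W\<close>, and the value \<open>L\<close> of the workload just before that instant. What the
  next customer meets is a pair (workload, left limit). They agree unless \<open>\<tau> = 0\<close>: customers that
  arrive at the same time all compare their patience with the same left limit, although the workload
  grows with every admission. Interarrival times with an atom at zero make such batches possible.
\<close>

definition seen_state :: "real \<times> real \<times> real \<Rightarrow> real \<times> real" where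
  "seen_state z = (max 0 (fst (snd z) - fst z),
     if fst z > 0 then max 0 (fst (snd z) - fst z) else snd (snd z))"

definition admit :: "real \<times> real \<Rightarrow> real \<times> real \<times> real \<Rightarrow> real \<times> real \<times> real" where
  "admit c e = (fst e, fst c + fst (snd e) * of_bool (snd c < snd (snd e)), snd c)"

primrec epoch ::
  "real \<times> real \<Rightarrow> (nat \<Rightarrow> real \<times> real \<times> real) \<Rightarrow> nat \<Rightarrow> real \<times> (real \<times> real \<times> real)" where
  "epoch x e 0 = (0, (fst x, snd x, snd x))"
| "epoch x e (Suc k) = (fst (epoch x e k) + fst (snd (epoch x e k)), admit (seen_state (snd (epoch x e k))) (e k))"

text \<open>
  The queue state at time \<open>s\<close>, in an epoch that has started at time \<open>fst z\<close>.
\<close>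

definition flow :: "real \<times> (real \<times> real \<times> real) \<Rightarrow> real \<Rightarrow> real \<times> real" where
  "flow z s = (fst (snd z) - (s - fst z), max 0 (fst (snd (snd z)) - (s - fst z)))"

definition customers_at :: "real \<times> real \<Rightarrow> (nat \<Rightarrow> real \<times> real \<times> real) \<Rightarrow> real \<Rightarrow> nat" where
  "customers_at x e s = (LEAST k. s < fst (epoch x e (Suc k)))"

definition state_at :: "real \<times> real \<Rightarrow> (nat \<Rightarrow> real \<times> real \<times> real) \<Rightarrow> real \<Rightarrow> real \<times> real" where
  "state_at x e s = flow (epoch x e (customers_at x e s)) s"

text \<open>
  The last clause, divergence of the arrival times, makes the number of customers in every bounded
  time interval finite.
\<close>

definition regular_input :: "real \<times> real \<Rightarrow> (nat \<Rightarrow> real \<times> real \<times> real) \<Rightarrow> bool" where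
  "regular_input x e \<longleftrightarrow> 0 \<le> fst x \<and> 0 \<le> snd x \<and> (\<forall>k. 0 \<le> fst (e k) \<and> 0 \<le> fst (snd (e k))) \<and>
     (\<forall>t. \<exists>k. t < fst (epoch x e k))"

lemma epoch_nonneg:
  assumes "regular_input x e"
  shows "0 \<le> fst (snd (epoch x e k))" "0 \<le> fst (snd (snd (epoch x e k)))"
proof (induction k)
  case 0
  show "0 \<le> fst (snd (epoch x e 0))" "0 \<le> fst (snd (snd (epoch x e 0)))"
    using assms by (simp_all add: regular_input_def)
next
  case (Suc k)
  have "0 \<le> fst (e k)" "0 \<le> fst (snd (e k))" using assms by (simp_all add: regular_input_def)
  then show "0 \<le> fst (snd (epoch x e (Suc k)))" "0 \<le> fst (snd (snd (epoch x e (Suc k))))"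
    by (simp_all add: admit_def seen_state_def)
qed

lemma epoch_start_mono:
  assumes "regular_input x e" "i \<le> j"
  shows "fst (epoch x e i) \<le> fst (epoch x e j)"
  using assms(2)
proof (induction j rule: dec_induct)
  case (step n)
  then show ?case using epoch_nonneg(1)[OF assms(1), of n] by simp
qed simp

lemma customers_at_bounds:
  assumes reg: "regular_input x e" and s: "0 \<le> s"
  shows "fst (epoch x e (customers_at x e s)) \<le> s"
    and "s < fst (epoch x e (Suc (customers_at x e s)))"
proof -
  obtain k where k: "s < fst (epoch x e k)" using reg by (auto simp: regular_input_def)
  then have "k \<noteq> 0" using s by (cases k) auto
  then have ex: "s < fst (epoch x e (Suc (k - 1)))" using k by simp
  show "s < fst (epoch x e (Suc (customers_at x e s)))"
    unfolding customers_at_def by (rule LeastI[where P = "\<lambda>k. s < fst (epoch x e (Suc k))", OF ex])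
  show "fst (epoch x e (customers_at x e s)) \<le> s"
  proof (cases "customers_at x e s")
    case (Suc m)
    then have "m < customers_at x e s" by simp
    then have "\<not> s < fst (epoch x e (Suc m))"
      unfolding customers_at_def by (rule not_less_Least)
    then show ?thesis using Suc by simp
  qed (use s in auto)
qed

lemma customers_at_eqI:
  assumes reg: "regular_input x e" and k: "fst (epoch x e k) \<le> s" "s < fst (epoch x e (Suc k))"
  shows "customers_at x e s = k"
proof -
  have s: "0 \<le> s" using epoch_start_mono[OF reg, of 0 k] k by simp
  note b = customers_at_bounds[OF reg s]
  have "\<not> Suc (customers_at x e s) \<le> k" using epoch_start_mono[OF reg, of "Suc (customers_at x e s)" k] b k by fastforce
  moreover have "\<not> Suc k \<le> customers_at x e s" using epoch_start_mono[OF reg, of "Suc k" "customers_at x e s"] b k by fastforce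
  ultimately show ?thesis by simp
qed

text \<open>
  The defining equation has at most one solution, and it is the one generated by the epochs:
  by induction over the arrivals, each new epoch starts from the left limit that the previous one
  produces. Hence the arbitrary version of the offered waiting time process that is given can be
  replaced by an explicit measurable function of the initial state and the inputs.
\<close>

lemma offered_waiting_path_determined:
  fixes U S D :: "nat \<Rightarrow> real" and W :: "real \<Rightarrow> real" and x :: "real \<times> real"
  defines "e \<equiv> \<lambda>k. (U (k + 2), S (k + 1), D (k + 1))"
  assumes W: "offered_waiting_path U S D (fst x) (snd x) W"
    and reg: "regular_input x e" and s: "0 \<le> s"
  shows "(remaining_arrival_time U (fst x) s, W s) = state_at x e s"
proof -
  define \<sigma> where "\<sigma> k = fst (epoch x e k)" for k
  define z where "z k = snd (epoch x e k)" for k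
  define I where "I t = (LINT s:{0..t}|lborel. of_bool (W s > 0) :: real)" for t
  define A where "A t = {s\<in>{0..t}. W s > 0}" for t
  define J where "J j = S j * of_bool (left_value (snd x) W (arrival_time U (fst x) j) < D j)" for j
  have z_Suc: "fst (z (Suc k)) = U (k + 2)" for k by (simp add: z_def admit_def e_def)
  have \<sigma>_Suc: "\<sigma> (Suc k) = \<sigma> k + fst (z k)" for k by (simp add: \<sigma>_def z_def)
  have arr: "arrival_time U (fst x) (Suc k) = \<sigma> (Suc k)" for k
  proof (induction k)
    case 0
    then show ?case by (simp add: arrival_time_def \<sigma>_def)
  next
    case (Suc k)
    have "arrival_time U (fst x) (Suc (Suc k)) = arrival_time U (fst x) (Suc k) + U (k + 2)"
      by (simp add: arrival_time_def)
    then show ?case using Suc \<sigma>_Suc[of "Suc k"] z_Suc by simp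
  qed
  have mono: "\<sigma> i \<le> \<sigma> j" if "i \<le> j" for i j using epoch_start_mono[OF reg that] by (simp add: \<sigma>_def)
  have \<sigma>0: "\<sigma> 0 = 0" by (simp add: \<sigma>_def)
  have count: "arrival_count U (fst x) t = k" if t: "\<sigma> k \<le> t" "t < \<sigma> (Suc k)" for t k
  proof -
    have iff: "\<sigma> i \<le> t \<longleftrightarrow> i \<le> k" for i
      using mono[of i k] mono[of "Suc k" i] t by (cases "i \<le> k") auto
    have "{0} \<union> {i. 1 \<le> i \<and> arrival_time U (fst x) i \<le> t} = {..k}"
    proof (intro set_eqI)
      fix i show "i \<in> {0} \<union> {i. 1 \<le> i \<and> arrival_time U (fst x) i \<le> t} \<longleftrightarrow> i \<in> {..k}"
        using iff[of i] arr[of "i - 1"] by (cases i) auto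
    qed
    then show ?thesis unfolding arrival_count_def by (simp add: Max_eq_iff)
  qed
  have Weq: "W t = snd x + (\<Sum>j=1..arrival_count U (fst x) t. J j) - I t \<and> W t \<ge> 0" if "t \<ge> 0" for t
    using W[unfolded offered_waiting_path_def, rule_format, OF that] unfolding J_def I_def .
  note segment = workload_between_arrivals[where W = W, folded I_def A_def]
  have inv: "A (\<sigma> k) \<in> sets borel \<and> snd x + (\<Sum>j=1..k. J j) - I (\<sigma> k) = fst (snd (z k)) \<and>
      left_value (snd x) W (\<sigma> k) = snd (snd (z k)) \<and>
      (\<forall>t. \<sigma> k \<le> t \<longrightarrow> t < \<sigma> (Suc k) \<longrightarrow> W t = max 0 (fst (snd (z k)) - (t - \<sigma> k)))" for k
  proof (induction k)
    case 0
    have sub: "A 0 \<subseteq> {0}" by (auto simp: A_def)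
    then have fin: "finite (A 0)" using finite_subset by blast
    then have A0: "A 0 \<in> sets borel" by (simp add: finite_imp_closed borel_closed)
    have "measure lborel (A 0) = 0" using fin by (simp add: measure_eq_0_null_sets finite_imp_null_set_lborel)
    then have I0: "I 0 = 0" unfolding I_def idle_integral_eq_measure A_def[symmetric] by simp
    have base: "fst (snd (z 0)) = snd x" "snd (snd (z 0)) = snd x" by (simp_all add: z_def)
    have "W t = max 0 (fst (snd (z 0)) - (t - \<sigma> 0))" if t: "\<sigma> 0 \<le> t" "t < \<sigma> (Suc 0)" for t
    proof (rule segment(1)[where a = "\<sigma> 0" and b = "\<sigma> (Suc 0)"])
      show "0 \<le> fst (snd (z 0))" using epoch_nonneg(2)[OF reg, of 0] by (simp add: z_def)
      show "A (\<sigma> 0) \<in> sets borel" using A0 \<sigma>0 by (simp only:)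
      fix r assume r: "\<sigma> 0 \<le> r" "r < \<sigma> (Suc 0)"
      show "W r = fst (snd (z 0)) - (I r - I (\<sigma> 0)) \<and> 0 \<le> W r"
        using Weq[of r] count[OF r] I0 base r \<sigma>0 by simp
    qed (use t mono[of 0 1] \<sigma>0 in auto)
    then have c4: "\<forall>t. \<sigma> 0 \<le> t \<longrightarrow> t < \<sigma> (Suc 0) \<longrightarrow> W t = max 0 (fst (snd (z 0)) - (t - \<sigma> 0))"
      by blast
    have c1: "A (\<sigma> 0) \<in> sets borel" using A0 \<sigma>0 by (simp only:)
    have c2: "snd x + (\<Sum>j=1..0. J j) - I (\<sigma> 0) = fst (snd (z 0))" using I0 \<sigma>0 base by simp
    have c3: "left_value (snd x) W (\<sigma> 0) = snd (snd (z 0))" using \<sigma>0 base by (simp add: left_value_def)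
    show ?case using c1 c2 c3 c4 by blast
  next
    case (Suc k)
    then have IH: "A (\<sigma> k) \<in> sets borel" "snd x + (\<Sum>j=1..k. J j) - I (\<sigma> k) = fst (snd (z k))"
      "left_value (snd x) W (\<sigma> k) = snd (snd (z k))"
      "\<And>t. \<sigma> k \<le> t \<Longrightarrow> t < \<sigma> (Suc k) \<Longrightarrow> W t = max 0 (fst (snd (z k)) - (t - \<sigma> k))" by auto
    have nn: "0 \<le> \<sigma> i" for i using mono[of 0 i] \<sigma>0 by simp
    have W1: "W r = fst (snd (z k)) - (I r - I (\<sigma> k)) \<and> 0 \<le> W r"
      if r: "\<sigma> k \<le> r" "r < \<sigma> (Suc k)" for r
      using Weq[of r] count[OF r] IH(2) r nn[of k] by simp
    have c0: "0 \<le> fst (snd (z i))" for i using epoch_nonneg(2)[OF reg, of i] by (simp add: z_def)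
    have step: "A (\<sigma> (Suc k)) \<in> sets borel"
      "fst (snd (z k)) - (I (\<sigma> (Suc k)) - I (\<sigma> k)) = max 0 (fst (snd (z k)) - (\<sigma> (Suc k) - \<sigma> k))"
    proof -
      have le: "\<sigma> k \<le> \<sigma> (Suc k)" by (rule mono) simp
      show "A (\<sigma> (Suc k)) \<in> sets borel"
        by (rule segment(2)[where a = "\<sigma> k" and c = "fst (snd (z k))"]) (fact nn le c0 IH(1) | rule W1 | assumption)+
      show "fst (snd (z k)) - (I (\<sigma> (Suc k)) - I (\<sigma> k)) = max 0 (fst (snd (z k)) - (\<sigma> (Suc k) - \<sigma> k))"
        by (rule segment(3)[where a = "\<sigma> k" and c = "fst (snd (z k))"]) (fact nn le c0 IH(1) | rule W1 | assumption)+
    qed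
    have left: "left_value (snd x) W (\<sigma> (Suc k)) = snd (seen_state (z k))"
    proof (cases "fst (z k) > 0")
      case True
      then have lt: "\<sigma> k < \<sigma> (Suc k)" using \<sigma>_Suc by simp
      have "((\<lambda>t. max 0 (fst (snd (z k)) - (t - \<sigma> k))) \<longlongrightarrow> max 0 (fst (snd (z k)) - (\<sigma> (Suc k) - \<sigma> k))) (at_left (\<sigma> (Suc k)))"
        by (intro tendsto_intros)
      moreover have "eventually (\<lambda>t. max 0 (fst (snd (z k)) - (t - \<sigma> k)) = W t) (at_left (\<sigma> (Suc k)))"
        using eventually_at_left_real[OF lt] by eventually_elim (use IH(4) in auto)
      ultimately have "(W \<longlongrightarrow> max 0 (fst (snd (z k)) - (\<sigma> (Suc k) - \<sigma> k))) (at_left (\<sigma> (Suc k)))"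
        by (rule Lim_transform_eventually)
      then have "Lim (at_left (\<sigma> (Suc k))) W = max 0 (fst (snd (z k)) - (\<sigma> (Suc k) - \<sigma> k))"
        by (intro tendsto_Lim) auto
      then show ?thesis using lt nn[of k] True \<sigma>_Suc[of k] by (simp add: left_value_def seen_state_def)
    next
      case False
      then have "fst (z k) = 0" using epoch_nonneg(1)[OF reg, of k] by (simp add: z_def)
      then show ?thesis using IH(3) \<sigma>_Suc[of k] by (simp add: seen_state_def)
    qed
    have zS: "snd (snd (z (Suc k))) = snd (seen_state (z k))"
      "fst (snd (z (Suc k))) = fst (seen_state (z k)) + S (Suc k) * of_bool (snd (seen_state (z k)) < D (Suc k))"
      by (simp_all add: z_def admit_def e_def)
    have "snd x + (\<Sum>j=1..Suc k. J j) - I (\<sigma> (Suc k)) = fst (snd (z (Suc k)))"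
      using step(2) IH(2) zS left arr[of k] \<sigma>_Suc[of k] by (simp add: J_def seen_state_def)
    note y = this
    have W2: "W r = fst (snd (z (Suc k))) - (I r - I (\<sigma> (Suc k))) \<and> 0 \<le> W r"
      if r: "\<sigma> (Suc k) \<le> r" "r < \<sigma> (Suc (Suc k))" for r
      using Weq[of r] count[OF r] y r nn[of "Suc k"] by simp
    have "W t = max 0 (fst (snd (z (Suc k))) - (t - \<sigma> (Suc k)))" if t: "\<sigma> (Suc k) \<le> t" "t < \<sigma> (Suc (Suc k))" for t
    proof (rule segment(1)[where a = "\<sigma> (Suc k)" and b = "\<sigma> (Suc (Suc k))"])
      show "\<sigma> (Suc k) \<le> \<sigma> (Suc (Suc k))" by (rule mono) simp
    qed (fact nn c0 step(1) t | rule W2 | assumption)+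
    then have c4: "\<forall>t. \<sigma> (Suc k) \<le> t \<longrightarrow> t < \<sigma> (Suc (Suc k)) \<longrightarrow> W t = max 0 (fst (snd (z (Suc k))) - (t - \<sigma> (Suc k)))"
      by blast
    have c3: "left_value (snd x) W (\<sigma> (Suc k)) = snd (snd (z (Suc k)))" using left zS(1) by (simp only:)
    show ?case using step(1) y c3 c4 by blast
  qed
  define k where "k = customers_at x e s"
  have k: "\<sigma> k \<le> s" "s < \<sigma> (Suc k)" using customers_at_bounds[OF reg s] by (simp_all add: k_def \<sigma>_def)
  have "W s = max 0 (fst (snd (z k)) - (s - \<sigma> k))" using inv k by auto
  moreover have "remaining_arrival_time U (fst x) s = fst (z k) - (s - \<sigma> k)"
    unfolding remaining_arrival_time_def count[OF k] arr \<sigma>_Suc by simp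
  ultimately show ?thesis
    by (simp add: state_at_def flow_def k_def[symmetric] z_def[symmetric] \<sigma>_def[symmetric])
qed

section \<open>Independent inputs\<close>

lemma borel_measurable_fst [measurable]:
  "fst \<in> borel_measurable (borel :: ('a::second_countable_topology \<times> 'b::second_countable_topology) measure)"
  by (simp add: borel_prod[symmetric])

lemma borel_measurable_snd [measurable]:
  "snd \<in> borel_measurable (borel :: ('a::second_countable_topology \<times> 'b::second_countable_topology) measure)"
  by (simp add: borel_prod[symmetric])

lemma measurable_seen_state [measurable]: "seen_state \<in> borel_measurable borel"
  unfolding seen_state_def[abs_def] by measurable

lemma measurable_admit [measurable (raw)]:
  assumes [measurable]: "f \<in> borel_measurable N" "g \<in> borel_measurable N"
  shows "(\<lambda>p. admit (f p) (g p)) \<in> borel_measurable N"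
  unfolding admit_def by measurable

lemma measurable_flow [measurable (raw)]:
  assumes [measurable]: "f \<in> borel_measurable N" "g \<in> borel_measurable N"
  shows "(\<lambda>p. flow (f p) (g p)) \<in> borel_measurable N"
  unfolding flow_def by measurable

lemma measurable_epoch:
  assumes [measurable]: "f \<in> borel_measurable N" and "\<And>i. i < k \<Longrightarrow> g i \<in> borel_measurable N"
  shows "(\<lambda>p. epoch (f p) (\<lambda>i. g i p) k) \<in> borel_measurable N"
  using assms(2)
proof (induction k)
  case (Suc k)
  then have [measurable]: "(\<lambda>p. epoch (f p) (\<lambda>i. g i p) k) \<in> borel_measurable N" "g k \<in> borel_measurable N"
    by auto
  show ?case by simp
qed simp

lemma measurable_epoch' [measurable (raw)]:
  assumes "f \<in> borel_measurable N" "\<And>i. g i \<in> borel_measurable N"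
  shows "(\<lambda>p. epoch (f p) (\<lambda>i. g i p) k) \<in> borel_measurable N"
  using assms by (rule measurable_epoch)

lemma measurable_customers_at [measurable (raw)]:
  assumes [measurable]: "f \<in> borel_measurable N" "\<And>i. g i \<in> borel_measurable N" "h \<in> borel_measurable N"
  shows "(\<lambda>p. customers_at (f p) (\<lambda>i. g i p) (h p)) \<in> measurable N (count_space UNIV)"
  unfolding customers_at_def by measurable

lemma measurable_state_at [measurable (raw)]:
  assumes [measurable]: "f \<in> borel_measurable N" "\<And>i. g i \<in> borel_measurable N" "h \<in> borel_measurable N"
  shows "(\<lambda>p. state_at (f p) (\<lambda>i. g i p) (h p)) \<in> borel_measurable N"
  unfolding state_at_def
  by (rule measurable_compose_countable[where f = "\<lambda>k p. flow (epoch (f p) (\<lambda>i. g i p) k) (h p)"]) measurable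

lemma epoch_cong: "(\<And>i. i < k \<Longrightarrow> e i = e' i) \<Longrightarrow> epoch x e k = epoch x e' k"
  by (induction k) simp_all

text \<open>
  One input \<open>E k\<close> collects the interarrival time that follows the arrival of a customer, his service
  time and his patience.
\<close>

locale iid_customers = prob_space M for M :: "'a measure" +
  fixes E :: "nat \<Rightarrow> 'a \<Rightarrow> real \<times> real \<times> real" and r :: real
  assumes indep: "indep_vars (\<lambda>_. borel) E UNIV"
    and identical: "\<And>k. distr M borel (E k) = distr M borel (E 0)"
    and nonneg: "\<And>k. AE \<omega> in M. 0 \<le> fst (E k \<omega>) \<and> 0 \<le> fst (snd (E k \<omega>))"
    and rate_pos: "0 < r"
    and mean_interarrival: "(\<integral>\<^sup>+\<omega>. ennreal (fst (E 0 \<omega>)) \<partial>M) = ennreal (1 / r)"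
begin

lemma E_measurable [measurable]: "E k \<in> borel_measurable M"
  using indep by (auto simp: indep_vars_def)

text \<open>
  The state of an epoch is a function of earlier inputs, so the input that closes the epoch is
  independent of it and may be replaced by a fresh copy.
\<close>

lemma nn_integral_epoch_input:
  assumes [measurable]: "(\<lambda>(z, c). \<phi> z c) \<in> borel_measurable (borel \<Otimes>\<^sub>M borel)"
  shows "(\<integral>\<^sup>+\<omega>. \<phi> (epoch x (\<lambda>i. E i \<omega>) k) (E k \<omega>) \<partial>M) =
    (\<integral>\<^sup>+\<omega>. (\<integral>\<^sup>+\<omega>'. \<phi> (epoch x (\<lambda>i. E i \<omega>) k) (E 0 \<omega>') \<partial>M) \<partial>M)"
proof -
  let ?X = "\<lambda>\<omega>. epoch x (\<lambda>i. E i \<omega>) k"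
  have 1: "indep_var borel ((\<lambda>h. epoch x h k) \<circ> (\<lambda>\<omega>. restrict (\<lambda>i. E i \<omega>) {..<k}))
      borel ((\<lambda>h. (0::real, h k)) \<circ> (\<lambda>\<omega>. restrict (\<lambda>i. E i \<omega>) {k}))"
  proof (rule indep_var_compose)
    show "indep_var (PiM {..<k} (\<lambda>_. borel)) (\<lambda>\<omega>. restrict (\<lambda>i. E i \<omega>) {..<k})
       (PiM {k} (\<lambda>_. borel)) (\<lambda>\<omega>. restrict (\<lambda>i. E i \<omega>) {k})"
      by (rule indep_var_restrict[OF indep]) auto
    show "(\<lambda>h. epoch x h k) \<in> borel_measurable (PiM {..<k} (\<lambda>_. borel))"
      by (rule measurable_epoch[where g = "\<lambda>i h. h i"]) auto
    have "(\<lambda>h :: nat \<Rightarrow> real \<times> real \<times> real. h k) \<in> borel_measurable (PiM {k} (\<lambda>_. borel))"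
      by (rule measurable_component_singleton) simp
    then show "(\<lambda>h :: nat \<Rightarrow> real \<times> real \<times> real. (0::real, h k)) \<in> borel_measurable (PiM {k} (\<lambda>_. borel))"
      by simp
  qed
  have eq: "((\<lambda>h. epoch x h k) \<circ> (\<lambda>\<omega>. restrict (\<lambda>i. E i \<omega>) {..<k})) = ?X"
    by (auto simp: fun_eq_iff intro!: epoch_cong)
  have eq2: "((\<lambda>h. (0::real, h k)) \<circ> (\<lambda>\<omega>. restrict (\<lambda>i. E i \<omega>) {k})) = (\<lambda>\<omega>. (0::real, E k \<omega>))" by auto
  \<comment> \<open>The constant first component gives the input the value type of the epoch, as an independent pair
    of random variables needs one common value type.\<close>
  have ind: "indep_var borel ?X borel (\<lambda>\<omega>. (0::real, E k \<omega>))" using 1 unfolding eq eq2 .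
  then have d: "distr M borel ?X \<Otimes>\<^sub>M distr M borel (\<lambda>\<omega>. (0::real, E k \<omega>)) = distr M (borel \<Otimes>\<^sub>M borel) (\<lambda>\<omega>. (?X \<omega>, (0::real, E k \<omega>)))"
    unfolding indep_var_distribution_eq by blast
  interpret Y: prob_space "distr M borel (\<lambda>\<omega>. (0::real, E k \<omega>))" by (rule prob_space_distr) simp
  have m: "(\<lambda>p. \<phi> (f p) (g p)) \<in> borel_measurable N"
    if "f \<in> borel_measurable N" "g \<in> borel_measurable N" for f g and N :: "'z measure"
    using measurable_compose[OF measurable_Pair[OF that] assms] by simp
  have m': "\<phi> z \<in> borel_measurable borel" for z using m[of "\<lambda>_. z" borel "\<lambda>c. c"] by simp
  have mz: "(\<lambda>z. \<integral>\<^sup>+\<omega>'. \<phi> z (E 0 \<omega>') \<partial>M) \<in> borel_measurable borel"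
    by (rule borel_measurable_nn_integral) (use measurable_compose[OF _ assms, of "\<lambda>p. (fst p, E 0 (snd p))" "borel \<Otimes>\<^sub>M M"] in \<open>simp add: case_prod_beta'\<close>)
  have "(\<integral>\<^sup>+\<omega>. \<phi> (?X \<omega>) (E k \<omega>) \<partial>M) =
      (\<integral>\<^sup>+p. \<phi> (fst p) (snd (snd p)) \<partial>distr M (borel \<Otimes>\<^sub>M borel) (\<lambda>\<omega>. (?X \<omega>, (0::real, E k \<omega>))))"
    by (subst nn_integral_distr) (auto intro!: m)
  also have "\<dots> = (\<integral>\<^sup>+z. (\<integral>\<^sup>+c. \<phi> z (snd c) \<partial>distr M borel (\<lambda>\<omega>. (0::real, E k \<omega>))) \<partial>distr M borel ?X)"
    unfolding d[symmetric] by (subst Y.nn_integral_fst[symmetric]) (auto intro!: m)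
  also have "\<dots> = (\<integral>\<^sup>+z. (\<integral>\<^sup>+c. \<phi> z c \<partial>distr M borel (E k)) \<partial>distr M borel ?X)"
    by (intro nn_integral_cong) (simp add: nn_integral_distr m m')
  also have "\<dots> = (\<integral>\<^sup>+z. (\<integral>\<^sup>+c. \<phi> z c \<partial>distr M borel (E 0)) \<partial>distr M borel ?X)"
    unfolding identical[of k] ..
  also have "\<dots> = (\<integral>\<^sup>+z. (\<integral>\<^sup>+\<omega>'. \<phi> z (E 0 \<omega>') \<partial>M) \<partial>distr M borel ?X)"
    by (intro nn_integral_cong) (simp add: nn_integral_distr m')
  also have "\<dots> = (\<integral>\<^sup>+\<omega>. (\<integral>\<^sup>+\<omega>'. \<phi> (?X \<omega>) (E 0 \<omega>') \<partial>M) \<partial>M)"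
    by (subst nn_integral_distr) (simp_all add: mz)
  finally show ?thesis .
qed

lemma AE_nonneg: "AE \<omega> in M. \<forall>k. 0 \<le> fst (E k \<omega>) \<and> 0 \<le> fst (snd (E k \<omega>))"
  using nonneg by (simp add: AE_all_countable)

text \<open>
  Truncation at 1 bounds the overshoot of the arrival times beyond a fixed horizon, which yields the
  renewal estimate below by Wald's argument.
\<close>

definition mean_trunc :: ennreal where
  "mean_trunc = (\<integral>\<^sup>+\<omega>. ennreal (min 1 (fst (E 0 \<omega>))) \<partial>M)"

lemma mean_trunc_pos: "mean_trunc \<noteq> 0" "mean_trunc < \<infinity>"
proof -
  show "mean_trunc \<noteq> 0"
  proof
    assume "mean_trunc = 0"
    then have "AE \<omega> in M. ennreal (min 1 (fst (E 0 \<omega>))) = 0"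
      unfolding mean_trunc_def by (subst (asm) nn_integral_0_iff_AE) auto
    then have "AE \<omega> in M. ennreal (fst (E 0 \<omega>)) = 0" by eventually_elim (auto simp: ennreal_eq_0_iff)
    then have "(\<integral>\<^sup>+\<omega>. ennreal (fst (E 0 \<omega>)) \<partial>M) = 0" by (subst nn_integral_0_iff_AE) auto
    then show False using rate_pos unfolding mean_interarrival by (simp add: ennreal_eq_0_iff)
  qed
  have "mean_trunc \<le> (\<integral>\<^sup>+\<omega>. 1 \<partial>M)" unfolding mean_trunc_def
    by (intro nn_integral_mono) (auto simp flip: ennreal_1 intro: ennreal_leI)
  then show "mean_trunc < \<infinity>" by (simp add: emeasure_space_1 order_le_less_trans)
qed

lemma arrivals_bound_finite: "ennreal t / mean_trunc < \<infinity>"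
  using mean_trunc_pos by (auto simp: ennreal_divide_eq_top_iff less_top[symmetric])

text \<open>
  The truncated interarrival times that start before \<open>t\<close> add up to at most \<open>t + 1\<close>; each of them is
  independent of the event that it starts before \<open>t\<close>.
\<close>

lemma arrivals_bound:
  assumes x: "x \<in> queue_states" and t: "0 \<le> t"
  shows "(\<Sum>k. emeasure M {\<omega>\<in>space M. fst (epoch x (\<lambda>i. E i \<omega>) (Suc k)) \<le> t}) \<le> ennreal (t + 1) / mean_trunc"
proof -
  define A where "A k = {\<omega>\<in>space M. fst (epoch x (\<lambda>i. E i \<omega>) (Suc k)) \<le> t}" for k
  have [measurable]: "A k \<in> sets M" for k unfolding A_def by measurable
  have path: "(\<Sum>k<K. indicator (A k) \<omega> * min 1 (fst (E k \<omega>))) \<le>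
      min (t + 1) (fst (epoch x (\<lambda>i. E i \<omega>) (Suc K)))"
    if nn: "\<forall>k. 0 \<le> fst (E k \<omega>) \<and> 0 \<le> fst (snd (E k \<omega>))" and w: "\<omega> \<in> space M" for K \<omega>
  proof (induction K)
    case 0
    then show ?case using x t by (auto simp: queue_states_def)
  next
    case (Suc K)
    have "fst (epoch x (\<lambda>i. E i \<omega>) (Suc (Suc K))) = fst (epoch x (\<lambda>i. E i \<omega>) (Suc K)) + fst (E K \<omega>)"
      by (simp add: admit_def)
    moreover have "0 \<le> fst (E K \<omega>)" using nn by simp
    ultimately show ?case using Suc w by (auto simp: A_def indicator_def min_def simp del: epoch.simps split: if_splits)
  qed
  have fin: "(\<Sum>k<K. emeasure M (A k)) * mean_trunc \<le> ennreal (t + 1)" for K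
  proof -
    have "emeasure M (A k) * mean_trunc = (\<integral>\<^sup>+\<omega>. indicator (A k) \<omega> * ennreal (min 1 (fst (E k \<omega>))) \<partial>M)" for k
    proof -
      define \<phi> :: "(real \<times> real \<times> real \<times> real) \<Rightarrow> (real \<times> real \<times> real) \<Rightarrow> ennreal" where
        "\<phi> z c = indicator {z. fst z + fst (snd z) \<le> t} z * ennreal (min 1 (fst c))" for z c
      have [measurable]: "(\<lambda>(z, c). \<phi> z c) \<in> borel_measurable (borel \<Otimes>\<^sub>M borel)"
        unfolding \<phi>_def by measurable
      have "(\<integral>\<^sup>+\<omega>. indicator (A k) \<omega> * ennreal (min 1 (fst (E k \<omega>))) \<partial>M) =
        (\<integral>\<^sup>+\<omega>. \<phi> (epoch x (\<lambda>i. E i \<omega>) k) (E k \<omega>) \<partial>M)"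
        by (intro nn_integral_cong) (simp add: \<phi>_def A_def indicator_def)
      also have "\<dots> = (\<integral>\<^sup>+\<omega>. (\<integral>\<^sup>+\<omega>'. \<phi> (epoch x (\<lambda>i. E i \<omega>) k) (E 0 \<omega>') \<partial>M) \<partial>M)"
        by (rule nn_integral_epoch_input) simp
      also have "\<dots> = (\<integral>\<^sup>+\<omega>. indicator (A k) \<omega> * mean_trunc \<partial>M)"
        unfolding \<phi>_def mean_trunc_def
        by (intro nn_integral_cong, subst nn_integral_cmult) (auto simp: A_def indicator_def)
      also have "\<dots> = emeasure M (A k) * mean_trunc"
        by (subst nn_integral_multc) auto
      finally show ?thesis by simp
    qed
    then have "(\<Sum>k<K. emeasure M (A k)) * mean_trunc =
        (\<integral>\<^sup>+\<omega>. (\<Sum>k<K. indicator (A k) \<omega> * ennreal (min 1 (fst (E k \<omega>)))) \<partial>M)"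
      by (subst nn_integral_sum) (auto simp: sum_distrib_right)
    also have "\<dots> \<le> (\<integral>\<^sup>+\<omega>. ennreal (t + 1) \<partial>M)"
    proof (rule nn_integral_mono_AE)
      show "AE \<omega> in M. (\<Sum>k<K. indicator (A k) \<omega> * ennreal (min 1 (fst (E k \<omega>)))) \<le> ennreal (t + 1)"
        using AE_nonneg AE_space
      proof eventually_elim
        case (elim \<omega>)
        have "(\<Sum>k<K. indicator (A k) \<omega> * ennreal (min 1 (fst (E k \<omega>)))) =
            ennreal (\<Sum>k<K. indicator (A k) \<omega> * min 1 (fst (E k \<omega>)))"
          using elim by (subst sum_ennreal[symmetric]) (auto intro!: sum.cong simp: indicator_def)
        also have "\<dots> \<le> ennreal (t + 1)" using path[of \<omega> K] elim by (intro ennreal_leI) auto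
        finally show ?case .
      qed
    qed
    finally show ?thesis by (simp add: emeasure_space_1)
  qed
  have "(\<Sum>k<K. emeasure M (A k)) \<le> ennreal (t + 1) / mean_trunc" for K
  proof -
    have "(\<Sum>k<K. emeasure M (A k)) = (\<Sum>k<K. emeasure M (A k)) * mean_trunc / mean_trunc"
      using mean_trunc_pos by (subst ennreal_mult_divide_eq) auto
    also have "\<dots> \<le> ennreal (t + 1) / mean_trunc" by (intro divide_right_mono_ennreal fin)
    finally show ?thesis .
  qed
  then show ?thesis unfolding A_def[symmetric] by (intro suminf_le_const) auto
qed

lemma AE_regular_input:
  assumes x: "x \<in> queue_states"
  shows "AE \<omega> in M. regular_input x (\<lambda>i. E i \<omega>)"
proof -
  have "AE \<omega> in M. \<exists>k. real n < fst (epoch x (\<lambda>i. E i \<omega>) k)" for n :: nat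
  proof -
    define A where "A k = {\<omega>\<in>space M. fst (epoch x (\<lambda>i. E i \<omega>) (Suc k)) \<le> n}" for k
    have [measurable]: "A k \<in> sets M" for k unfolding A_def by measurable
    have "(\<Sum>k. emeasure M (A k)) \<le> ennreal (real n + 1) / mean_trunc"
      unfolding A_def using arrivals_bound[OF x, of n] by simp
    also have "\<dots> < \<infinity>" by (rule arrivals_bound_finite)
    finally have "(\<integral>\<^sup>+\<omega>. (\<Sum>k. indicator (A k) \<omega>) \<partial>M) \<noteq> \<infinity>"
      by (subst nn_integral_suminf) auto
    then have "AE \<omega> in M. (\<Sum>k. indicator (A k) \<omega> :: ennreal) \<noteq> \<infinity>"
      by (intro nn_integral_PInf_AE) auto
    then show ?thesis using AE_space
    proof eventually_elim
      case (elim \<omega>)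
      show ?case
      proof (rule ccontr)
        assume "\<not> (\<exists>k. real n < fst (epoch x (\<lambda>i. E i \<omega>) k))"
        then have "\<omega> \<in> A k" for k using elim unfolding A_def by (auto simp: not_less simp del: epoch.simps)
        then have "of_nat n \<le> (\<Sum>k. indicator (A k) \<omega> :: ennreal)" for n
          using sum_le_suminf[of "\<lambda>k. indicator (A k) \<omega> :: ennreal" "{..<n}"] by simp
        moreover obtain n where "(\<Sum>k. indicator (A k) \<omega> :: ennreal) < of_nat n"
          using ennreal_Ex_less_of_nat elim by (auto simp: less_top)
        ultimately show False by (simp add: leD)
      qed
    qed
  qed
  then have "AE \<omega> in M. \<forall>n::nat. \<exists>k. real n < fst (epoch x (\<lambda>i. E i \<omega>) k)"
    by (simp add: AE_all_countable)
  then show ?thesis using AE_nonneg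
  proof eventually_elim
    case (elim \<omega>)
    have "\<exists>k. t < fst (epoch x (\<lambda>i. E i \<omega>) k)" for t
    proof -
      obtain n :: nat where "t < n" using reals_Archimedean2 by blast
      then show ?thesis using elim(1) by (meson less_trans)
    qed
    then show ?case using elim x by (auto simp: regular_input_def queue_states_def)
  qed
qed

end

section \<open>The law seen by arriving customers\<close>

lemma regular_input_iff:
  "regular_input x e \<longleftrightarrow> 0 \<le> fst x \<and> 0 \<le> snd x \<and> (\<forall>k. 0 \<le> fst (e k) \<and> 0 \<le> fst (snd (e k))) \<and>
     (\<forall>n::nat. \<exists>k. real n < fst (epoch x e k))"
proof -
  have "(\<forall>t. \<exists>k. t < fst (epoch x e k)) \<longleftrightarrow> (\<forall>n::nat. \<exists>k. real n < fst (epoch x e k))"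
  proof (intro iffI allI)
    fix t :: real
    assume *: "\<forall>n::nat. \<exists>k. real n < fst (epoch x e k)"
    obtain n :: nat where n: "t < n" using reals_Archimedean2 by blast
    obtain k where "real n < fst (epoch x e k)" using * by blast
    with n have "t < fst (epoch x e k)" by linarith
    then show "\<exists>k. t < fst (epoch x e k)" ..
  qed blast
  then show ?thesis unfolding regular_input_def by (simp only:)
qed

lemma measurable_regular_input [measurable (raw)]:
  assumes [measurable]: "f \<in> borel_measurable N" "\<And>i. g i \<in> borel_measurable N"
  shows "Measurable.pred N (\<lambda>p. regular_input (f p) (\<lambda>i. g i p))"
  unfolding regular_input_iff by measurable

text \<open>
  The cost, at running cost rate \<open>k\<close>, from the present state \<open>c\<close> to the next arrival.
\<close>

definition residual_cost :: "(real \<times> real \<Rightarrow> ennreal) \<Rightarrow> real \<times> real \<Rightarrow> ennreal" where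
  "residual_cost k c =
     (\<integral>\<^sup>+s. (if 0 \<le> s \<and> s < fst c then k (fst c - s, max 0 (snd c - s)) else 0) \<partial>lborel)"

lemma measurable_residual_cost [measurable (raw)]:
  assumes [measurable]: "k \<in> borel_measurable borel" "f \<in> borel_measurable N"
  shows "(\<lambda>p. residual_cost k (f p)) \<in> borel_measurable N"
  unfolding residual_cost_def by measurable

lemma residual_cost_flow:
  assumes [measurable]: "k \<in> borel_measurable borel" and a: "fst z \<le> a"
  shows "residual_cost k (flow z a) =
    (\<integral>\<^sup>+s. (if a \<le> s \<and> s < fst z + fst (snd z) then k (flow z s) else 0) \<partial>lborel)"
  unfolding residual_cost_def
proof (subst (2) nn_integral_real_affine[where t = a and c = 1])
  show "(\<lambda>s. if a \<le> s \<and> s < fst z + fst (snd z) then k (flow z s) else 0) \<in> borel_measurable borel"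
    by measurable
  have "(if 0 \<le> s \<and> s < fst (flow z a) then k (fst (flow z a) - s, max 0 (snd (flow z a) - s)) else 0) =
      (if a \<le> a + 1 * s \<and> a + 1 * s < fst z + fst (snd z) then k (flow z (a + 1 * s)) else 0)" for s
  proof (cases "0 \<le> s")
    case True
    have "(fst (flow z a) - s, max 0 (snd (flow z a) - s)) = flow z (a + 1 * s)"
      using True by (simp add: flow_def max_def)
    moreover have "s < fst (flow z a) \<longleftrightarrow> a + 1 * s < fst z + fst (snd z)" by (auto simp: flow_def)
    ultimately show ?thesis using True by (simp only:) simp
  qed simp
  then show "(\<integral>\<^sup>+s. (if 0 \<le> s \<and> s < fst (flow z a) then k (fst (flow z a) - s, max 0 (snd (flow z a) - s)) else 0) \<partial>lborel) =
      ennreal \<bar>1\<bar> * (\<integral>\<^sup>+s. (if a \<le> a + 1 * s \<and> a + 1 * s < fst z + fst (snd z) then k (flow z (a + 1 * s)) else 0) \<partial>lborel)"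
    by (simp only: abs_one ennreal_1 mult_1)
qed simp

lemma suminf_current_epoch:
  fixes g :: "nat \<Rightarrow> ennreal"
  assumes reg: "regular_input x e" and s: "0 \<le> s"
  shows "(\<Sum>j. if fst (epoch x e j) \<le> s \<and> s < fst (epoch x e (Suc j)) then g j else 0) =
    g (customers_at x e s)"
proof -
  have iff: "fst (epoch x e j) \<le> s \<and> s < fst (epoch x e (Suc j)) \<longleftrightarrow> j = customers_at x e s" for j
    using customers_at_eqI[OF reg, of j s] customers_at_bounds[OF reg s] by blast
  have "(\<Sum>j. if fst (epoch x e j) \<le> s \<and> s < fst (epoch x e (Suc j)) then g j else 0) =
      (\<Sum>j. if j = customers_at x e s then g j else 0)"
    unfolding iff ..
  also have "\<dots> = (\<Sum>j\<in>{customers_at x e s}. if j = customers_at x e s then g j else 0)"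
    by (rule suminf_finite) auto
  finally show ?thesis by simp
qed

lemma suminf_arrivals_until:
  fixes g :: "nat \<Rightarrow> ennreal"
  assumes reg: "regular_input x e" and s: "0 \<le> s"
  shows "(\<Sum>j. if fst (epoch x e (Suc j)) \<le> s then g j else 0) = (\<Sum>j<customers_at x e s. g j)"
proof -
  have iff: "fst (epoch x e (Suc j)) \<le> s \<longleftrightarrow> j < customers_at x e s" for j
    using customers_at_bounds[OF reg s] epoch_start_mono[OF reg, of "Suc j" "customers_at x e s"]
      epoch_start_mono[OF reg, of "Suc (customers_at x e s)" "Suc j"]
    by (cases "j < customers_at x e s") (auto simp del: epoch.simps dest: Suc_leI)
  have "(\<Sum>j. if fst (epoch x e (Suc j)) \<le> s then g j else 0) =
      (\<Sum>j<customers_at x e s. if fst (epoch x e (Suc j)) \<le> s then g j else 0)"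
    by (rule suminf_finite) (auto simp: iff simp del: epoch.simps)
  then show ?thesis by (simp add: iff del: epoch.simps)
qed

text \<open>
  The epochs that begin in \<open>[0, 1]\<close> cover \<open>[0, 1)\<close> and the remainder of the epoch running at time 1.
\<close>

lemma epoch_costs_until_one:
  assumes reg: "regular_input x e" and [measurable]: "k \<in> borel_measurable borel"
  shows "(\<Sum>j. if fst (epoch x e j) \<le> 1
        then residual_cost k (fst (snd (epoch x e j)), fst (snd (snd (epoch x e j)))) else 0) =
    (\<integral>\<^sup>+s. (if 0 \<le> s \<and> s < 1 then k (state_at x e s) else 0) \<partial>lborel) + residual_cost k (state_at x e 1)"
proof -
  define z where "z j = epoch x e j" for j
  define b where "b j = fst (epoch x e (Suc j))" for j
  have b: "b j = fst (z j) + fst (snd (z j))" for j by (simp add: b_def z_def)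
  have le: "fst (z j) \<le> b j" for j using epoch_nonneg(1)[OF reg, of j] by (simp add: b z_def)
  have z0: "0 \<le> fst (z j)" for j using epoch_start_mono[OF reg, of 0 j] by (simp add: z_def)
  have term_eq: "(if fst (z j) \<le> 1 then residual_cost k (fst (snd (z j)), fst (snd (snd (z j)))) else 0) =
     (\<integral>\<^sup>+s. (if fst (z j) \<le> s \<and> s < b j then (if 0 \<le> s \<and> s < 1 then k (flow (z j) s) else 0) else 0) \<partial>lborel) +
     (if fst (z j) \<le> 1 \<and> 1 < b j then residual_cost k (flow (z j) 1) else 0)" for j
  proof (cases "fst (z j) \<le> 1")
    case True
    have "(fst (snd (z j)), fst (snd (snd (z j)))) = flow (z j) (fst (z j))"
      using epoch_nonneg(2)[OF reg, of j] by (simp add: flow_def z_def)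
    then have "residual_cost k (fst (snd (z j)), fst (snd (snd (z j)))) =
        (\<integral>\<^sup>+s. (if fst (z j) \<le> s \<and> s < b j then k (flow (z j) s) else 0) \<partial>lborel)"
      using residual_cost_flow[of k "z j" "fst (z j)"] by (simp add: b)
    also have "\<dots> = (\<integral>\<^sup>+s. (if fst (z j) \<le> s \<and> s < b j then (if 0 \<le> s \<and> s < 1 then k (flow (z j) s) else 0) else 0) +
          (if 1 \<le> s \<and> s < b j then k (flow (z j) s) else 0) \<partial>lborel)"
      using True z0[of j] by (intro nn_integral_cong) auto
    also have "\<dots> = (\<integral>\<^sup>+s. (if fst (z j) \<le> s \<and> s < b j then (if 0 \<le> s \<and> s < 1 then k (flow (z j) s) else 0) else 0) \<partial>lborel) +
          (\<integral>\<^sup>+s. (if 1 \<le> s \<and> s < b j then k (flow (z j) s) else 0) \<partial>lborel)"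
      by (rule nn_integral_add) measurable
    also have "(\<integral>\<^sup>+s. (if 1 \<le> s \<and> s < b j then k (flow (z j) s) else 0) \<partial>lborel) =
        (if fst (z j) \<le> 1 \<and> 1 < b j then residual_cost k (flow (z j) 1) else 0)"
    proof (cases "1 < b j")
      case False
      then have "(\<lambda>s. if 1 \<le> s \<and> s < b j then k (flow (z j) s) else 0) = (\<lambda>s. 0)" by (auto simp: fun_eq_iff)
      then show ?thesis using False by simp
    qed (use residual_cost_flow[of k "z j" 1] True in \<open>simp add: b\<close>)
    finally show ?thesis using True by simp
  next
    case False
    then have "(\<lambda>s. if fst (z j) \<le> s \<and> s < b j then (if 0 \<le> s \<and> s < 1 then k (flow (z j) s) else 0) else 0) = (\<lambda>s. 0)"
      by (auto simp: fun_eq_iff)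
    then show ?thesis using False by simp
  qed
  have "(\<Sum>j. if fst (z j) \<le> 1 then residual_cost k (fst (snd (z j)), fst (snd (snd (z j)))) else 0) =
     (\<Sum>j. \<integral>\<^sup>+s. (if fst (z j) \<le> s \<and> s < b j then (if 0 \<le> s \<and> s < 1 then k (flow (z j) s) else 0) else 0) \<partial>lborel) +
     (\<Sum>j. if fst (z j) \<le> 1 \<and> 1 < b j then residual_cost k (flow (z j) 1) else 0)"
    unfolding term_eq by (rule suminf_add[symmetric]) auto
  also have "(\<Sum>j. if fst (z j) \<le> 1 \<and> 1 < b j then residual_cost k (flow (z j) 1) else 0) =
      residual_cost k (state_at x e 1)"
    unfolding z_def b_def state_at_def by (rule suminf_current_epoch[OF reg]) simp
  also have "(\<Sum>j. \<integral>\<^sup>+s. (if fst (z j) \<le> s \<and> s < b j then (if 0 \<le> s \<and> s < 1 then k (flow (z j) s) else 0) else 0) \<partial>lborel) =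
      (\<integral>\<^sup>+s. (\<Sum>j. if fst (z j) \<le> s \<and> s < b j then (if 0 \<le> s \<and> s < 1 then k (flow (z j) s) else 0) else 0) \<partial>lborel)"
    by (rule nn_integral_suminf[symmetric]) measurable
  also have "\<dots> = (\<integral>\<^sup>+s. (if 0 \<le> s \<and> s < 1 then k (state_at x e s) else 0) \<partial>lborel)"
  proof (intro nn_integral_cong)
    fix s :: real
    show "(\<Sum>j. if fst (z j) \<le> s \<and> s < b j then (if 0 \<le> s \<and> s < 1 then k (flow (z j) s) else 0) else 0) =
        (if 0 \<le> s \<and> s < 1 then k (state_at x e s) else 0)"
    proof (cases "0 \<le> s")
      case True
      then show ?thesis unfolding z_def b_def state_at_def by (rule suminf_current_epoch[OF reg])
    next
      case False
      then have "(\<lambda>j. if fst (z j) \<le> s \<and> s < b j then (if 0 \<le> s \<and> s < 1 then k (flow (z j) s) else 0) else 0) = (\<lambda>j. 0)"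
        by (auto simp: fun_eq_iff)
      then show ?thesis using False by simp
    qed
  qed
  finally show ?thesis unfolding z_def .
qed

definition next_seen :: "real \<times> real \<Rightarrow> real \<times> real \<times> real \<Rightarrow> real \<times> real" where
  "next_seen w c = seen_state (admit w c)"

lemma measurable_next_seen [measurable (raw)]:
  assumes [measurable]: "f \<in> borel_measurable N" "g \<in> borel_measurable N"
  shows "(\<lambda>p. next_seen (f p) (g p)) \<in> borel_measurable N"
  unfolding next_seen_def by measurable

lemma seen_state_bounds:
  assumes reg: "regular_input x e"
  shows "0 \<le> snd (seen_state (snd (epoch x e k))) \<and>
    snd (seen_state (snd (epoch x e k))) \<le> fst (seen_state (snd (epoch x e k)))"
proof -
  have inv: "0 \<le> snd (snd (snd (epoch x e k))) \<and> snd (snd (snd (epoch x e k))) \<le> fst (snd (snd (epoch x e k)))"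
  proof (induction k)
    case 0
    then show ?case using reg by (simp add: regular_input_def)
  next
    case (Suc k)
    have pos: "0 \<le> fst (snd (e k))" using reg by (simp add: regular_input_def)
    define z where "z = snd (epoch x e k)"
    have "0 \<le> fst z" using epoch_nonneg(1)[OF reg, of k] by (simp add: z_def)
    then have "0 \<le> snd (seen_state z)" "snd (seen_state z) \<le> fst (seen_state z)"
      using Suc unfolding z_def[symmetric] by (auto simp: seen_state_def)
    then show ?case using pos by (simp add: admit_def z_def[symmetric] add_increasing2)
  qed
  then show ?thesis using epoch_nonneg(1)[OF reg, of k] by (auto simp: seen_state_def)
qed

text \<open>
  The time to the next arrival is strictly positive at every fixed time, so the next customer
  always meets a state in which workload and left limit agree.
\<close>

lemma seen_state_current:
  assumes reg: "regular_input x e" and s: "0 \<le> s"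
  defines "c \<equiv> state_at x e s"
  shows "0 < fst c"
    and "seen_state (snd (epoch x e (customers_at x e s))) = (max 0 (snd c - fst c), max 0 (snd c - fst c))"
  using customers_at_bounds[OF reg s] by (auto simp: c_def state_at_def flow_def seen_state_def)

lemma telescope_arrivals:
  fixes g :: "nat \<Rightarrow> ennreal"
  shows "(\<Sum>j<n. g (Suc j)) + g 0 = (\<Sum>j<n. g j) + g n"
  by (induction n) (simp_all add: ac_simps)

lemma suminf_ennreal_head:
  fixes f :: "nat \<Rightarrow> ennreal"
  shows "(\<Sum>j. f j) = (\<Sum>j. f (Suc j)) + f 0"
  by (subst suminf_offset[where i = 1]) (auto simp: add.commute)

text \<open>
  Under \<open>\<pi> \<Otimes>\<^sub>M M\<close> the initial state is stationary and independent of all later inputs. The aim is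
  the law of what an arriving customer meets, that is, the Palm version of \<open>\<pi>\<close> at arrivals.
\<close>

locale stationary_queue = iid_customers +
  fixes \<pi> :: "(real \<times> real) measure"
  assumes prob_pi: "prob_space \<pi>" and sets_pi [measurable_cong]: "sets \<pi> = sets borel"
    and pi_states: "AE x in \<pi>. x \<in> queue_states"
    and invariant: "\<And>s. 0 \<le> s \<Longrightarrow>
      distr (\<pi> \<Otimes>\<^sub>M M) borel (\<lambda>p. state_at (fst p) (\<lambda>i. E i (snd p)) s) = \<pi>"
begin

sublocale pi: prob_space \<pi> by (rule prob_pi)
sublocale P: pair_prob_space \<pi> M ..

definition Z :: "nat \<Rightarrow> (real \<times> real) \<times> 'a \<Rightarrow> real \<times> real \<times> real \<times> real" where
  "Z j p = epoch (fst p) (\<lambda>i. E i (snd p)) j"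

lemma measurable_fst_pi [measurable]: "fst \<in> borel_measurable (\<pi> \<Otimes>\<^sub>M M)"
  using measurable_fst[of \<pi> M] by (simp cong: measurable_cong_sets add: sets_pi)

lemma measurable_Z [measurable]: "Z j \<in> borel_measurable (\<pi> \<Otimes>\<^sub>M M)"
  unfolding Z_def[abs_def] by measurable

lemma AE_regular: "AE p in \<pi> \<Otimes>\<^sub>M M. regular_input (fst p) (\<lambda>i. E i (snd p))"
proof (rule P.AE_pair_measure)
  show "AE x in \<pi>. AE y in M. regular_input (fst (x, y)) (\<lambda>i. E i (snd (x, y)))"
    using pi_states by eventually_elim (simp add: AE_regular_input)
qed measurable

lemma nn_integral_state_at:
  assumes [measurable]: "k \<in> borel_measurable borel" and "0 \<le> s"
  shows "(\<integral>\<^sup>+p. k (state_at (fst p) (\<lambda>i. E i (snd p)) s) \<partial>(\<pi> \<Otimes>\<^sub>M M)) = (\<integral>\<^sup>+x. k x \<partial>\<pi>)"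
  by (subst (2) invariant[OF assms(2), symmetric]) (simp add: nn_integral_distr)

lemma nn_integral_Z_input:
  assumes [measurable]: "(\<lambda>(z, c). \<phi> z c) \<in> borel_measurable (borel \<Otimes>\<^sub>M borel)"
  shows "(\<integral>\<^sup>+p. \<phi> (Z j p) (E j (snd p)) \<partial>(\<pi> \<Otimes>\<^sub>M M)) =
    (\<integral>\<^sup>+p. (\<integral>\<^sup>+\<omega>. \<phi> (Z j p) (E 0 \<omega>) \<partial>M) \<partial>(\<pi> \<Otimes>\<^sub>M M))"
proof -
  have m: "(\<lambda>p. \<phi> (f p) (g p)) \<in> borel_measurable N"
    if "f \<in> borel_measurable N" "g \<in> borel_measurable N" for f g and N :: "'z measure"
    using measurable_compose[OF measurable_Pair[OF that] assms] by simp
  have m2: "(\<lambda>z. \<integral>\<^sup>+\<omega>. \<phi> z (E 0 \<omega>) \<partial>M) \<in> borel_measurable borel"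
    by (rule borel_measurable_nn_integral) (simp add: case_prod_beta' m)
  show ?thesis
    by (subst (1 2) nn_integral_fst[symmetric])
      (auto intro!: m measurable_compose[OF _ m2] nn_integral_cong nn_integral_epoch_input assms simp: Z_def)
qed

lemma AE_pi_pos: "AE x in \<pi>. 0 < fst x"
proof -
  have "AE x in distr (\<pi> \<Otimes>\<^sub>M M) borel (\<lambda>p. state_at (fst p) (\<lambda>i. E i (snd p)) 1). 0 < fst x"
    by (subst AE_distr_iff) (use AE_regular in \<open>auto elim!: eventually_mono intro: seen_state_current(1)\<close>)
  then show ?thesis unfolding invariant[OF zero_le_one] .
qed

text \<open>
  The expected number of arrivals in \<open>(0, 1]\<close>, classified by what the customer meets and normalised by
  the arrival rate. Counting arrivals in a time interval avoids conditioning on an arrival at time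
  zero.
\<close>

definition arrival_law :: "(real \<times> real) measure" where
  "arrival_law = distr (density (count_space UNIV \<Otimes>\<^sub>M (\<pi> \<Otimes>\<^sub>M M))
      (\<lambda>(j, p). (if fst (Z (Suc j) p) \<le> 1 then 1 else 0) / ennreal r)) borel
      (\<lambda>(j, p). seen_state (snd (Z j p)))"

lemma sets_arrival_law [measurable_cong, simp]: "sets arrival_law = sets borel"
  by (simp add: arrival_law_def)

lemma nn_integral_arrival_law:
  assumes [measurable]: "\<psi> \<in> borel_measurable borel"
  shows "(\<integral>\<^sup>+w. \<psi> w \<partial>arrival_law) =
    (\<Sum>j. \<integral>\<^sup>+p. (if fst (Z (Suc j) p) \<le> 1 then \<psi> (seen_state (snd (Z j p))) else 0) \<partial>(\<pi> \<Otimes>\<^sub>M M)) / ennreal r"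
proof -
  have [measurable]: "(\<lambda>(j, p). seen_state (snd (Z j p))) \<in> borel_measurable (count_space UNIV \<Otimes>\<^sub>M (\<pi> \<Otimes>\<^sub>M M))"
    by (rule measurable_pair_measure_countable1) auto
  have [measurable]: "(\<lambda>(j, p). (if fst (Z (Suc j) p) \<le> 1 then 1 else 0) / ennreal r)
      \<in> borel_measurable (count_space UNIV \<Otimes>\<^sub>M (\<pi> \<Otimes>\<^sub>M M))"
    by (rule measurable_pair_measure_countable1) auto
  have "(\<integral>\<^sup>+w. \<psi> w \<partial>arrival_law) = (\<integral>\<^sup>+q. (case q of (j, p) \<Rightarrow> (if fst (Z (Suc j) p) \<le> 1 then 1 else 0) / ennreal r) *
      \<psi> (case q of (j, p) \<Rightarrow> seen_state (snd (Z j p))) \<partial>(count_space UNIV \<Otimes>\<^sub>M (\<pi> \<Otimes>\<^sub>M M)))"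
    unfolding arrival_law_def by (simp add: nn_integral_distr nn_integral_density)
  also have "\<dots> = (\<Sum>j. \<integral>\<^sup>+p. (if fst (Z (Suc j) p) \<le> 1 then 1 else 0) / ennreal r * \<psi> (seen_state (snd (Z j p))) \<partial>(\<pi> \<Otimes>\<^sub>M M))"
    by (subst P.nn_integral_fst[symmetric]) (auto simp: nn_integral_count_space_nat)
  also have "\<dots> = (\<Sum>j. (\<integral>\<^sup>+p. (if fst (Z (Suc j) p) \<le> 1 then \<psi> (seen_state (snd (Z j p))) else 0) \<partial>(\<pi> \<Otimes>\<^sub>M M)) / ennreal r)"
    by (intro suminf_cong, subst nn_integral_divide[symmetric]) 
      (auto intro!: nn_integral_cong simp: ennreal_divide_times)
  finally show ?thesis by simp
qed

lemma nn_integral_arrival_law_input: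
  assumes [measurable]: "(\<lambda>(z, c). \<phi> z c) \<in> borel_measurable (borel \<Otimes>\<^sub>M borel)"
  shows "(\<integral>\<^sup>+w. (\<integral>\<^sup>+\<omega>. \<phi> w (E 0 \<omega>) \<partial>M) \<partial>arrival_law) =
    (\<Sum>j. \<integral>\<^sup>+p. (if fst (Z (Suc j) p) \<le> 1 then \<phi> (seen_state (snd (Z j p))) (E j (snd p)) else 0) \<partial>(\<pi> \<Otimes>\<^sub>M M)) / ennreal r"
proof -
  have m: "(\<lambda>p. \<phi> (f p) (g p)) \<in> borel_measurable N"
    if "f \<in> borel_measurable N" "g \<in> borel_measurable N" for f g and N :: "'z measure"
    using measurable_compose[OF measurable_Pair[OF that] assms] by simp
  have m2: "(\<lambda>z. \<integral>\<^sup>+\<omega>. \<phi> z (E 0 \<omega>) \<partial>M) \<in> borel_measurable borel"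
    by (rule borel_measurable_nn_integral) (simp add: case_prod_beta' m)
  define \<phi>' :: "real \<times> real \<times> real \<times> real \<Rightarrow> real \<times> real \<times> real \<Rightarrow> ennreal" where
    "\<phi>' z c = (if fst z + fst (snd z) \<le> 1 then \<phi> (seen_state (snd z)) c else 0)" for z c
  have m3: "(\<lambda>(z, c). \<phi>' z c) \<in> borel_measurable (borel \<Otimes>\<^sub>M borel)"
    unfolding \<phi>'_def case_prod_beta' by (intro measurable_If m) measurable
  have next_start: "fst (Z (Suc j) p) = fst (Z j p) + fst (snd (Z j p))" for j p by (simp add: Z_def)
  show ?thesis
    unfolding nn_integral_arrival_law[OF m2]
  proof (rule arg_cong[where f = "\<lambda>a. a / ennreal r"], rule suminf_cong)
    fix j
    have "(\<integral>\<^sup>+p. (if fst (Z (Suc j) p) \<le> 1 then (\<integral>\<^sup>+\<omega>. \<phi> (seen_state (snd (Z j p))) (E 0 \<omega>) \<partial>M) else 0) \<partial>(\<pi> \<Otimes>\<^sub>M M)) =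
        (\<integral>\<^sup>+p. (\<integral>\<^sup>+\<omega>. \<phi>' (Z j p) (E 0 \<omega>) \<partial>M) \<partial>(\<pi> \<Otimes>\<^sub>M M))"
      by (intro nn_integral_cong) (simp add: \<phi>'_def next_start)
    also have "\<dots> = (\<integral>\<^sup>+p. \<phi>' (Z j p) (E j (snd p)) \<partial>(\<pi> \<Otimes>\<^sub>M M))"
      by (rule nn_integral_Z_input[OF m3, symmetric])
    finally show "(\<integral>\<^sup>+p. (if fst (Z (Suc j) p) \<le> 1 then (\<integral>\<^sup>+\<omega>. \<phi> (seen_state (snd (Z j p))) (E 0 \<omega>) \<partial>M) else 0) \<partial>(\<pi> \<Otimes>\<^sub>M M)) =
       (\<integral>\<^sup>+p. (if fst (Z (Suc j) p) \<le> 1 then \<phi> (seen_state (snd (Z j p))) (E j (snd p)) else 0) \<partial>(\<pi> \<Otimes>\<^sub>M M))"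
      by (simp add: \<phi>'_def next_start)
  qed
qed

lemma ennreal_add_right_cancel_finite:
  fixes a b c :: ennreal
  shows "c < \<infinity> \<Longrightarrow> a + c = b + c \<Longrightarrow> a = b"
  by (metis add.commute ennreal_add_left_cancel infinity_ennreal_def less_irrefl)

text \<open>
  Replacing every customer who arrives in \<open>(0, 1]\<close> by his successor drops the first customer after
  time 0 and adds the first customer after time 1. What these two meet has the same law, as the queue
  states at times 0 and 1 do. Boundedness of the test function allows the two terms to be cancelled.
\<close>

lemma arrival_law_invariant:
  assumes [measurable]: "\<psi> \<in> borel_measurable borel" and bounded: "\<And>w. \<psi> w \<le> 1"
  shows "(\<integral>\<^sup>+w. (\<integral>\<^sup>+\<omega>. \<psi> (next_seen w (E 0 \<omega>)) \<partial>M) \<partial>arrival_law) = (\<integral>\<^sup>+w. \<psi> w \<partial>arrival_law)"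
proof -
  define S where "S j p = seen_state (snd (Z j p))" for j p
  have [measurable]: "S j \<in> borel_measurable (\<pi> \<Otimes>\<^sub>M M)" for j unfolding S_def[abs_def] by measurable
  have S_Suc: "S (Suc j) p = next_seen (S j p) (E j (snd p))" for j p by (simp add: S_def Z_def next_seen_def)
  define \<psi>' where "\<psi>' c = \<psi> (max 0 (snd c - fst c), max 0 (snd c - fst c))" for c :: "real \<times> real"
  have [measurable]: "\<psi>' \<in> borel_measurable borel" unfolding \<psi>'_def by measurable
  have "(\<integral>\<^sup>+p. (\<Sum>j. if fst (Z (Suc j) p) \<le> 1 then \<psi> (S (Suc j) p) else 0) + \<psi> (S 0 p) \<partial>(\<pi> \<Otimes>\<^sub>M M)) =
      (\<integral>\<^sup>+p. (\<Sum>j. if fst (Z (Suc j) p) \<le> 1 then \<psi> (S j p) else 0) +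
        \<psi>' (state_at (fst p) (\<lambda>i. E i (snd p)) 1) \<partial>(\<pi> \<Otimes>\<^sub>M M))"
  proof (rule nn_integral_cong_AE, use AE_regular in eventually_elim)
    case (elim p)
    show ?case
      unfolding Z_def suminf_arrivals_until[OF elim zero_le_one] \<psi>'_def
        seen_state_current(2)[OF elim zero_le_one, symmetric] S_def
      by (rule telescope_arrivals)
  qed
  also have "\<dots> = (\<integral>\<^sup>+p. (\<Sum>j. if fst (Z (Suc j) p) \<le> 1 then \<psi> (S j p) else 0) \<partial>(\<pi> \<Otimes>\<^sub>M M)) + (\<integral>\<^sup>+x. \<psi>' x \<partial>\<pi>)"
    by (subst nn_integral_add) (auto simp: nn_integral_state_at)
  also have "(\<integral>\<^sup>+p. (\<Sum>j. if fst (Z (Suc j) p) \<le> 1 then \<psi> (S (Suc j) p) else 0) + \<psi> (S 0 p) \<partial>(\<pi> \<Otimes>\<^sub>M M)) =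
      (\<integral>\<^sup>+p. (\<Sum>j. if fst (Z (Suc j) p) \<le> 1 then \<psi> (S (Suc j) p) else 0) \<partial>(\<pi> \<Otimes>\<^sub>M M)) + (\<integral>\<^sup>+p. \<psi> (S 0 p) \<partial>(\<pi> \<Otimes>\<^sub>M M))"
    by (rule nn_integral_add) auto
  also have "(\<integral>\<^sup>+p. \<psi> (S 0 p) \<partial>(\<pi> \<Otimes>\<^sub>M M)) = (\<integral>\<^sup>+x. \<psi>' x \<partial>\<pi>)"
  proof -
    have "(\<integral>\<^sup>+p. \<psi> (S 0 p) \<partial>(\<pi> \<Otimes>\<^sub>M M)) = (\<integral>\<^sup>+x. (\<integral>\<^sup>+\<omega>. \<psi> (seen_state (fst x, snd x, snd x)) \<partial>M) \<partial>\<pi>)"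
      by (subst nn_integral_fst[symmetric]) (auto simp: S_def Z_def)
    also have "\<dots> = (\<integral>\<^sup>+x. \<psi>' x \<partial>\<pi>)"
      using AE_pi_pos by (intro nn_integral_cong_AE) (auto elim!: eventually_mono simp: emeasure_space_1 \<psi>'_def seen_state_def)
    finally show ?thesis .
  qed
  finally have eq: "(\<integral>\<^sup>+p. (\<Sum>j. if fst (Z (Suc j) p) \<le> 1 then \<psi> (S (Suc j) p) else 0) \<partial>(\<pi> \<Otimes>\<^sub>M M)) =
     (\<integral>\<^sup>+p. (\<Sum>j. if fst (Z (Suc j) p) \<le> 1 then \<psi> (S j p) else 0) \<partial>(\<pi> \<Otimes>\<^sub>M M))"
  proof (rule ennreal_add_right_cancel_finite[rotated])
    have "(\<integral>\<^sup>+x. \<psi>' x \<partial>\<pi>) \<le> (\<integral>\<^sup>+x. 1 \<partial>\<pi>)" by (intro nn_integral_mono) (simp add: \<psi>'_def bounded)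
    then show "(\<integral>\<^sup>+x. \<psi>' x \<partial>\<pi>) < \<infinity>" by (simp add: pi.emeasure_space_1 order_le_less_trans)
  qed
  have "(\<integral>\<^sup>+w. (\<integral>\<^sup>+\<omega>. \<psi> (next_seen w (E 0 \<omega>)) \<partial>M) \<partial>arrival_law) =
      (\<Sum>j. \<integral>\<^sup>+p. (if fst (Z (Suc j) p) \<le> 1 then \<psi> (S (Suc j) p) else 0) \<partial>(\<pi> \<Otimes>\<^sub>M M)) / ennreal r"
    unfolding S_Suc unfolding S_def by (rule nn_integral_arrival_law_input) measurable
  also have "\<dots> = (\<Sum>j. \<integral>\<^sup>+p. (if fst (Z (Suc j) p) \<le> 1 then \<psi> (S j p) else 0) \<partial>(\<pi> \<Otimes>\<^sub>M M)) / ennreal r"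
    using eq by (simp add: nn_integral_suminf)
  also have "\<dots> = (\<integral>\<^sup>+w. \<psi> w \<partial>arrival_law)"
    unfolding S_def by (rule nn_integral_arrival_law[symmetric]) measurable
  finally show ?thesis .
qed

text \<open>
  The cost of the epochs opened by arrivals in \<open>(0, 1]\<close> is the cost over \<open>[0, 1)\<close>, plus the remainder of
  the epoch running at time 1, minus the remainder of the epoch running at time 0. The two remainders
  have equal expectations by stationarity; they are finite because the cost rate vanishes while the next
  arrival is far away.
\<close>

lemma inversion_bounded:
  assumes [measurable]: "k \<in> borel_measurable borel"
    and support: "\<And>c. k c \<le> 1" "\<And>c. K < fst c \<Longrightarrow> k c = 0"
  shows "(\<integral>\<^sup>+x. k x \<partial>\<pi>) = ennreal r * (\<integral>\<^sup>+w. (\<integral>\<^sup>+\<omega>.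
    residual_cost k (fst (admit w (E 0 \<omega>)), fst (snd (admit w (E 0 \<omega>)))) \<partial>M) \<partial>arrival_law)"
proof -
  define R where "R z = residual_cost k (fst z, fst (snd z))" for z :: "real \<times> real \<times> real"
  have [measurable]: "R \<in> borel_measurable borel" unfolding R_def[abs_def] by measurable
  have fin: "residual_cost k c \<le> ennreal (max 0 K)" for c
  proof -
    have "residual_cost k c \<le> (\<integral>\<^sup>+s. indicator {fst c - max 0 K..fst c} s \<partial>lborel)"
      unfolding residual_cost_def
      by (intro nn_integral_mono) (auto simp: indicator_def support max_def split: if_splits)
    then show ?thesis by simp
  qed
  have "(\<integral>\<^sup>+p. (\<Sum>j. if fst (Z j p) \<le> 1 then R (snd (Z j p)) else 0) \<partial>(\<pi> \<Otimes>\<^sub>M M)) =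
      (\<integral>\<^sup>+p. (\<integral>\<^sup>+s. (if 0 \<le> s \<and> s < 1 then k (state_at (fst p) (\<lambda>i. E i (snd p)) s) else 0) \<partial>lborel) +
        residual_cost k (state_at (fst p) (\<lambda>i. E i (snd p)) 1) \<partial>(\<pi> \<Otimes>\<^sub>M M))"
  proof (rule nn_integral_cong_AE, use AE_regular in eventually_elim)
    case (elim p)
    show ?case unfolding Z_def R_def by (rule epoch_costs_until_one[OF elim]) measurable
  qed
  also have "\<dots> = (\<integral>\<^sup>+p. (\<integral>\<^sup>+s. (if 0 \<le> s \<and> s < 1 then k (state_at (fst p) (\<lambda>i. E i (snd p)) s) else 0) \<partial>lborel) \<partial>(\<pi> \<Otimes>\<^sub>M M)) +
      (\<integral>\<^sup>+x. residual_cost k x \<partial>\<pi>)"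
    by (subst nn_integral_add) (auto simp: nn_integral_state_at)
  also have "(\<integral>\<^sup>+p. (\<integral>\<^sup>+s. (if 0 \<le> s \<and> s < 1 then k (state_at (fst p) (\<lambda>i. E i (snd p)) s) else 0) \<partial>lborel) \<partial>(\<pi> \<Otimes>\<^sub>M M)) =
      (\<integral>\<^sup>+s. (\<integral>\<^sup>+p. (if 0 \<le> s \<and> s < 1 then k (state_at (fst p) (\<lambda>i. E i (snd p)) s) else 0) \<partial>(\<pi> \<Otimes>\<^sub>M M)) \<partial>lborel)"
  proof -
    interpret L: pair_sigma_finite lborel "\<pi> \<Otimes>\<^sub>M M" ..
    show ?thesis by (rule L.Fubini') measurable
  qed
  also have "\<dots> = (\<integral>\<^sup>+s. (\<integral>\<^sup>+x. k x \<partial>\<pi>) * indicator {0..<1::real} s \<partial>lborel)"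
    by (intro nn_integral_cong) (auto simp: nn_integral_state_at indicator_def)
  also have "\<dots> = (\<integral>\<^sup>+x. k x \<partial>\<pi>)"
    by (subst nn_integral_cmult_indicator) auto
  also have "(\<integral>\<^sup>+p. (\<Sum>j. if fst (Z j p) \<le> 1 then R (snd (Z j p)) else 0) \<partial>(\<pi> \<Otimes>\<^sub>M M)) =
      (\<Sum>j. \<integral>\<^sup>+p. (if fst (Z j p) \<le> 1 then R (snd (Z j p)) else 0) \<partial>(\<pi> \<Otimes>\<^sub>M M))"
    by (rule nn_integral_suminf) measurable
  also have "\<dots> = (\<Sum>j. \<integral>\<^sup>+p. (if fst (Z (Suc j) p) \<le> 1 then R (snd (Z (Suc j) p)) else 0) \<partial>(\<pi> \<Otimes>\<^sub>M M)) +
      (\<integral>\<^sup>+p. (if fst (Z 0 p) \<le> 1 then R (snd (Z 0 p)) else 0) \<partial>(\<pi> \<Otimes>\<^sub>M M))"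
    by (rule suminf_ennreal_head)
  also have "(\<integral>\<^sup>+p. (if fst (Z 0 p) \<le> 1 then R (snd (Z 0 p)) else 0) \<partial>(\<pi> \<Otimes>\<^sub>M M)) = (\<integral>\<^sup>+x. residual_cost k x \<partial>\<pi>)"
  proof -
    have "(\<integral>\<^sup>+p. (if fst (Z 0 p) \<le> 1 then R (snd (Z 0 p)) else 0) \<partial>(\<pi> \<Otimes>\<^sub>M M)) = (\<integral>\<^sup>+x. (\<integral>\<^sup>+\<omega>. residual_cost k x \<partial>M) \<partial>\<pi>)"
      by (subst nn_integral_fst[symmetric]) (auto simp: Z_def R_def)
    then show ?thesis by (simp add: emeasure_space_1)
  qed
  finally have eq: "(\<Sum>j. \<integral>\<^sup>+p. (if fst (Z (Suc j) p) \<le> 1 then R (snd (Z (Suc j) p)) else 0) \<partial>(\<pi> \<Otimes>\<^sub>M M)) = (\<integral>\<^sup>+x. k x \<partial>\<pi>)"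
  proof (rule ennreal_add_right_cancel_finite[rotated])
    have "(\<integral>\<^sup>+x. residual_cost k x \<partial>\<pi>) \<le> (\<integral>\<^sup>+x. ennreal (max 0 K) \<partial>\<pi>)" by (intro nn_integral_mono fin)
    also have "\<dots> < \<infinity>" by (simp add: pi.emeasure_space_1)
    finally show "(\<integral>\<^sup>+x. residual_cost k x \<partial>\<pi>) < \<infinity>" .
  qed
  have "(\<integral>\<^sup>+w. (\<integral>\<^sup>+\<omega>. R (admit w (E 0 \<omega>)) \<partial>M) \<partial>arrival_law) =
      (\<Sum>j. \<integral>\<^sup>+p. (if fst (Z (Suc j) p) \<le> 1 then R (snd (Z (Suc j) p)) else 0) \<partial>(\<pi> \<Otimes>\<^sub>M M)) / ennreal r"
  proof -
    have Z_Suc: "snd (Z (Suc j) p) = admit (seen_state (snd (Z j p))) (E j (snd p))" for j p by (simp add: Z_def)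
    show ?thesis unfolding Z_Suc by (rule nn_integral_arrival_law_input) measurable
  qed
  then have "ennreal r * (\<integral>\<^sup>+w. (\<integral>\<^sup>+\<omega>. R (admit w (E 0 \<omega>)) \<partial>M) \<partial>arrival_law) = ennreal r * ((\<integral>\<^sup>+x. k x \<partial>\<pi>) / ennreal r)"
    unfolding eq by simp
  also have "\<dots> = (\<integral>\<^sup>+x. k x \<partial>\<pi>)"
    using rate_pos by (metis ennreal_eq_0_iff ennreal_mult_divide_eq ennreal_neq_top ennreal_times_divide mult.commute not_le)
  finally show ?thesis by (simp add: R_def)
qed

text \<open>
  Decomposing the cost rate by the integer part of the time to the next arrival reduces the claim to
  cost rates that vanish while the next arrival is far away.
\<close>

lemma inversion:
  assumes [measurable]: "k \<in> borel_measurable borel" and bounded: "\<And>c. k c \<le> 1"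
  shows "(\<integral>\<^sup>+x. k x \<partial>\<pi>) = ennreal r * (\<integral>\<^sup>+w. (\<integral>\<^sup>+\<omega>.
    residual_cost k (fst (admit w (E 0 \<omega>)), fst (snd (admit w (E 0 \<omega>)))) \<partial>M) \<partial>arrival_law)"
proof -
  define q where "q i c = k c * indicator {c. \<lfloor>fst c\<rfloor> = int i} c" for i :: nat and c :: "real \<times> real"
  have [measurable]: "q i \<in> borel_measurable borel" for i unfolding q_def by measurable
  have q_sum: "(\<Sum>i. q i c) = k c" if "0 \<le> fst c" for c
  proof -
    have "(\<Sum>i. q i c) = (\<Sum>i\<in>{nat \<lfloor>fst c\<rfloor>}. q i c)"
      by (rule suminf_finite) (auto simp: q_def indicator_def)
    then show ?thesis using that by (simp add: q_def)
  qed
  have R_sum: "(\<Sum>i. residual_cost (q i) c) = residual_cost k c" for c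
  proof -
    have "(\<Sum>i. residual_cost (q i) c) =
        (\<integral>\<^sup>+s. (\<Sum>i. if 0 \<le> s \<and> s < fst c then q i (fst c - s, max 0 (snd c - s)) else 0) \<partial>lborel)"
      unfolding residual_cost_def by (rule nn_integral_suminf[symmetric]) measurable
    also have "\<dots> = residual_cost k c"
      unfolding residual_cost_def
    proof (intro nn_integral_cong)
      fix s :: real
      show "(\<Sum>i. if 0 \<le> s \<and> s < fst c then q i (fst c - s, max 0 (snd c - s)) else 0) =
          (if 0 \<le> s \<and> s < fst c then k (fst c - s, max 0 (snd c - s)) else 0)"
        by (cases "0 \<le> s \<and> s < fst c") (auto simp: q_sum)
    qed
    finally show ?thesis .
  qed
  have "(\<integral>\<^sup>+x. k x \<partial>\<pi>) = (\<integral>\<^sup>+x. (\<Sum>i. q i x) \<partial>\<pi>)"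
    using AE_pi_pos by (intro nn_integral_cong_AE) (auto elim!: eventually_mono simp: q_sum)
  also have "\<dots> = (\<Sum>i. \<integral>\<^sup>+x. q i x \<partial>\<pi>)"
    by (rule nn_integral_suminf) measurable
  also have "\<dots> = (\<Sum>i. ennreal r * (\<integral>\<^sup>+w. (\<integral>\<^sup>+\<omega>.
      residual_cost (q i) (fst (admit w (E 0 \<omega>)), fst (snd (admit w (E 0 \<omega>)))) \<partial>M) \<partial>arrival_law))"
  proof (intro suminf_cong inversion_bounded)
    fix i c
    show "q i c \<le> 1" using bounded[of c] by (auto simp: q_def indicator_def)
    show "q i c = 0" if "real i + 1 < fst c"
      using that by (auto simp: q_def indicator_def floor_eq_iff)
  qed measurable
  also have "\<dots> = ennreal r * (\<Sum>i. \<integral>\<^sup>+w. (\<integral>\<^sup>+\<omega>.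
      residual_cost (q i) (fst (admit w (E 0 \<omega>)), fst (snd (admit w (E 0 \<omega>)))) \<partial>M) \<partial>arrival_law)"
    by (rule ennreal_suminf_cmult)
  also have "\<dots> = ennreal r * (\<integral>\<^sup>+w. (\<Sum>i. \<integral>\<^sup>+\<omega>.
      residual_cost (q i) (fst (admit w (E 0 \<omega>)), fst (snd (admit w (E 0 \<omega>)))) \<partial>M) \<partial>arrival_law)"
    by (subst nn_integral_suminf) simp_all
  also have "\<dots> = ennreal r * (\<integral>\<^sup>+w. (\<integral>\<^sup>+\<omega>. (\<Sum>i.
      residual_cost (q i) (fst (admit w (E 0 \<omega>)), fst (snd (admit w (E 0 \<omega>))))) \<partial>M) \<partial>arrival_law)"
    by (intro arg_cong[where f = "\<lambda>a. ennreal r * a"] nn_integral_cong nn_integral_suminf[symmetric]) simp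
  finally show ?thesis unfolding R_sum .
qed

text \<open>
  The inversion formula for the cost rate 1, as the mean interarrival time is the reciprocal rate.
\<close>

lemma prob_arrival_law: "prob_space arrival_law"
proof (rule prob_spaceI)
  have one: "residual_cost (\<lambda>_. 1) c = ennreal (fst c)" for c
  proof -
    have "residual_cost (\<lambda>_. 1) c = (\<integral>\<^sup>+s. indicator {0..<fst c} s \<partial>lborel)"
      unfolding residual_cost_def by (intro nn_integral_cong) (auto simp: indicator_def)
    also have "\<dots> = ennreal (fst c)" by (cases "0 \<le> fst c") (auto simp: ennreal_neg)
    finally show ?thesis .
  qed
  have "1 = ennreal r * (\<integral>\<^sup>+w. (\<integral>\<^sup>+\<omega>. ennreal (fst (E 0 \<omega>)) \<partial>M) \<partial>arrival_law)"
    using inversion[of "\<lambda>_. 1"] by (simp add: one admit_def pi.emeasure_space_1)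
  also have "\<dots> = ennreal r * ennreal (1 / r) * emeasure arrival_law (space arrival_law)"
    by (simp add: mean_interarrival mult.assoc)
  also have "ennreal r * ennreal (1 / r) = 1"
    using rate_pos by (simp flip: ennreal_mult ennreal_1)
  finally show "emeasure arrival_law (space arrival_law) = 1" by simp
qed

lemma distr_next_seen:
  "distr (arrival_law \<Otimes>\<^sub>M M) borel (\<lambda>p. next_seen (fst p) (E 0 (snd p))) = arrival_law"
proof (rule measure_eqI)
  fix A :: "(real \<times> real) set" assume "A \<in> sets (distr (arrival_law \<Otimes>\<^sub>M M) borel (\<lambda>p. next_seen (fst p) (E 0 (snd p))))"
  then have [measurable]: "A \<in> sets borel" by simp
  have [measurable]: "fst \<in> borel_measurable (arrival_law \<Otimes>\<^sub>M M)"
    using measurable_fst[of arrival_law M] by (simp cong: measurable_cong_sets)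
  have "emeasure (distr (arrival_law \<Otimes>\<^sub>M M) borel (\<lambda>p. next_seen (fst p) (E 0 (snd p)))) A =
      (\<integral>\<^sup>+x. indicator A x \<partial>distr (arrival_law \<Otimes>\<^sub>M M) borel (\<lambda>p. next_seen (fst p) (E 0 (snd p))))"
    by (subst nn_integral_indicator) auto
  also have "\<dots> = (\<integral>\<^sup>+p. indicator A (next_seen (fst p) (E 0 (snd p))) \<partial>(arrival_law \<Otimes>\<^sub>M M))"
    by (rule nn_integral_distr) measurable
  also have "\<dots> = (\<integral>\<^sup>+w. (\<integral>\<^sup>+\<omega>. indicator A (next_seen w (E 0 \<omega>)) \<partial>M) \<partial>arrival_law)"
    by (subst nn_integral_fst[symmetric]) simp_all
  also have "\<dots> = emeasure arrival_law A"
    by (subst arrival_law_invariant) (auto simp: indicator_def)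
  finally show "emeasure (distr (arrival_law \<Otimes>\<^sub>M M) borel (\<lambda>p. next_seen (fst p) (E 0 (snd p)))) A = emeasure arrival_law A" .
qed simp

lemma AE_arrival_law: "AE w in arrival_law. 0 \<le> snd w \<and> snd w \<le> fst w"
proof -
  define B where "B = {w :: real \<times> real. \<not> (0 \<le> snd w \<and> snd w \<le> fst w)}"
  have [measurable]: "B \<in> sets borel" unfolding B_def by measurable
  have "(\<integral>\<^sup>+p. (if fst (Z (Suc j) p) \<le> 1 then indicator B (seen_state (snd (Z j p))) else 0 :: ennreal) \<partial>(\<pi> \<Otimes>\<^sub>M M)) = 0" for j
  proof (subst nn_integral_0_iff_AE, simp, use AE_regular in eventually_elim)
    case (elim p)
    then show ?case using seen_state_bounds[OF elim, of j] by (auto simp: B_def Z_def)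
  qed
  then have "(\<integral>\<^sup>+w. indicator B w \<partial>arrival_law) = 0"
    by (subst nn_integral_arrival_law) auto
  then have "AE w in arrival_law. (indicator B w :: ennreal) = 0"
    by (subst (asm) nn_integral_0_iff_AE) auto
  then show ?thesis by eventually_elim (auto simp: B_def indicator_def split: if_splits)
qed

end

section \<open>From the queueing model to stationary epochs\<close>

text \<open>
  The constant second component in the first pair only serves to give both random variables the same
  value type, as \<^const>\<open>prob_space.indep_var\<close> requires.
\<close>

lemma primitives_indep:
  assumes prim: "queue_primitives M u v d" and ij: "2 \<le> i" "1 \<le> j"
  shows "prob_space.indep_var M borel (v j) borel (d j)"
    and "prob_space.indep_var M borel (\<lambda>\<omega>. (u i \<omega>, 0::real)) borel (\<lambda>\<omega>. (v j \<omega>, d j \<omega>))"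
proof -
  interpret prob_space M using prim by (simp add: queue_primitives_def)
  let ?X = "case_sum u (case_sum v d)"
  have ind: "indep_vars (\<lambda>_. borel) ?X ({2..} <+> ({1..} <+> {1..}))"
    using prim by (simp add: queue_primitives_def)
  have "indep_var borel ((\<lambda>h. h (Inr (Inl j))) \<circ> (\<lambda>\<omega>. restrict (\<lambda>i. ?X i \<omega>) {Inr (Inl j)}))
      borel ((\<lambda>h. h (Inr (Inr j))) \<circ> (\<lambda>\<omega>. restrict (\<lambda>i. ?X i \<omega>) {Inr (Inr j)}))"
    by (rule indep_var_compose[OF indep_var_restrict[OF ind]])
      (use ij in \<open>auto intro!: measurable_component_singleton\<close>)
  then show "indep_var borel (v j) borel (d j)" by (simp add: comp_def)
  have m: "(\<lambda>h. h k) \<in> borel_measurable (PiM I (\<lambda>_. borel))" if "k \<in> I" for k :: "nat + nat + nat" and I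
    using measurable_component_singleton[OF that, of "\<lambda>_. borel"] .
  have "indep_var borel ((\<lambda>h. (h (Inl i), 0::real)) \<circ> (\<lambda>\<omega>. restrict (\<lambda>i. ?X i \<omega>) {Inl i}))
      borel ((\<lambda>h. (h (Inr (Inl j)), h (Inr (Inr j)))) \<circ> (\<lambda>\<omega>. restrict (\<lambda>i. ?X i \<omega>) {Inr (Inl j), Inr (Inr j)}))"
    by (rule indep_var_compose[OF indep_var_restrict[OF ind]])
      (use ij in \<open>auto intro!: borel_measurable_Pair m\<close>)
  then show "indep_var borel (\<lambda>\<omega>. (u i \<omega>, 0::real)) borel (\<lambda>\<omega>. (v j \<omega>, d j \<omega>))"
    by (simp add: comp_def)
qed

lemma primitives_triple_law:
  assumes prim: "queue_primitives M u v d" and ij: "2 \<le> i" "1 \<le> j"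
  shows "distr M borel (\<lambda>\<omega>. (u i \<omega>, v j \<omega>, d j \<omega>)) = distr M borel (\<lambda>\<omega>. (u 2 \<omega>, v 1 \<omega>, d 1 \<omega>))"
proof -
  interpret prob_space M using prim by (simp add: queue_primitives_def)
  have law: "distr M borel (\<lambda>\<omega>. (u i \<omega>, v j \<omega>, d j \<omega>)) =
      distr (distr (distr M borel (u 2)) borel (\<lambda>x. (x, 0::real)) \<Otimes>\<^sub>M
        distr (distr M borel (v 1) \<Otimes>\<^sub>M distr M borel (d 1)) borel (\<lambda>p. p)) borel (\<lambda>p. (fst (fst p), snd p))"
    if ij: "2 \<le> i" "1 \<le> j" for i j
  proof -
    note ind = primitives_indep[OF prim ij]
    have rv [measurable]: "v j \<in> borel_measurable M" "d j \<in> borel_measurable M"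
      using indep_var_rv1[OF ind(1)] indep_var_rv2[OF ind(1)] by simp_all
    have "fst \<circ> (\<lambda>\<omega>. (u i \<omega>, 0::real)) \<in> borel_measurable M"
      using indep_var_rv1[OF ind(2)] by (rule measurable_comp) simp
    then have [measurable]: "u i \<in> borel_measurable M" by (simp add: comp_def)
    have same: "distr M borel (u i) = distr M borel (u 2)" "distr M borel (v j) = distr M borel (v 1)"
       "distr M borel (d j) = distr M borel (d 1)"
      using prim ij unfolding queue_primitives_def by blast+
    have vd: "distr M borel (\<lambda>\<omega>. (v j \<omega>, d j \<omega>)) = distr (distr M borel (v 1) \<Otimes>\<^sub>M distr M borel (d 1)) borel (\<lambda>p. p)"
    proof -
      have "distr M borel (v j) \<Otimes>\<^sub>M distr M borel (d j) = distr M (borel \<Otimes>\<^sub>M borel) (\<lambda>\<omega>. (v j \<omega>, d j \<omega>))"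
        using ind(1) unfolding indep_var_distribution_eq by blast
      then show ?thesis unfolding same by (simp add: borel_prod distr_distr comp_def)
    qed
    have u0: "distr M borel (\<lambda>\<omega>. (u i \<omega>, 0::real)) = distr (distr M borel (u 2)) borel (\<lambda>x. (x, 0::real))"
      unfolding same[symmetric] by (subst distr_distr) (auto simp: comp_def)
    have "distr M borel (\<lambda>\<omega>. (u i \<omega>, 0::real)) \<Otimes>\<^sub>M distr M borel (\<lambda>\<omega>. (v j \<omega>, d j \<omega>)) =
        distr M (borel \<Otimes>\<^sub>M borel) (\<lambda>\<omega>. ((u i \<omega>, 0::real), (v j \<omega>, d j \<omega>)))"
      using ind(2) unfolding indep_var_distribution_eq by blast
    then have "distr (distr M borel (\<lambda>\<omega>. (u i \<omega>, 0::real)) \<Otimes>\<^sub>M distr M borel (\<lambda>\<omega>. (v j \<omega>, d j \<omega>))) borel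
        (\<lambda>p. (fst (fst p), snd p)) = distr M borel (\<lambda>\<omega>. (u i \<omega>, v j \<omega>, d j \<omega>))"
      by (simp add: distr_distr comp_def)
    then show ?thesis unfolding vd u0 by simp
  qed
  show ?thesis using law[OF ij] law[of 2 1] by simp
qed

lemma measurable_remaining_arrival_time:
  assumes U: "\<And>j. 2 \<le> j \<Longrightarrow> U j \<in> borel_measurable M"
  shows "(\<lambda>\<omega>. remaining_arrival_time (\<lambda>j. U j \<omega>) a t) \<in> borel_measurable M"
proof -
  have [measurable]: "(\<lambda>\<omega>. arrival_time (\<lambda>j. U j \<omega>) a i) \<in> borel_measurable M" for i
    unfolding arrival_time_def by (intro borel_measurable_add borel_measurable_const borel_measurable_sum U) simp
  have "{0} \<union> {i. 1 \<le> i \<and> Q i} = {i. i = 0 \<or> (1 \<le> i \<and> Q i)}" for Q :: "nat \<Rightarrow> bool" by auto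
  then have [measurable]: "(\<lambda>\<omega>. arrival_count (\<lambda>j. U j \<omega>) a t) \<in> measurable M (count_space UNIV)"
    unfolding arrival_count_def by simp
  have "(\<lambda>\<omega>. arrival_time (\<lambda>j. U j \<omega>) a (Suc (arrival_count (\<lambda>j. U j \<omega>) a t))) \<in> borel_measurable M"
    by (rule measurable_compose_countable[where f = "\<lambda>k \<omega>. arrival_time (\<lambda>j. U j \<omega>) a (Suc k)"]) measurable
  then show ?thesis unfolding remaining_arrival_time_def by simp
qed

text \<open>
  Almost surely the inputs are regular, and then the given process coincides with the explicit
  solution; hence invariance of \<open>\<pi>\<close> for the former is invariance for the latter.
\<close>

lemma stationary_queueI:
  fixes u v d :: "nat \<Rightarrow> 'a \<Rightarrow> real"
  assumes prim: "queue_primitives M u v d" and rates: "0 < a" "0 < b"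
    and offered: "\<And>x. x \<in> queue_states \<Longrightarrow>
      offered_waiting_process M (\<lambda>j \<omega>. u j \<omega> / a) (\<lambda>j \<omega>. v j \<omega> / b) d x (V x)"
    and stat: "stationary_distribution M (queue_process (\<lambda>j \<omega>. u j \<omega> / a) V) \<pi>"
  shows "stationary_queue M (\<lambda>k \<omega>. (u (k + 2) \<omega> / a, v (k + 1) \<omega> / b, d (k + 1) \<omega>)) a \<pi>"
proof -
  interpret prob_space M using prim by (simp add: queue_primitives_def)
  let ?X = "case_sum u (case_sum v d)"
  define E where "E k \<omega> = (u (k + 2) \<omega> / a, v (k + 1) \<omega> / b, d (k + 1) \<omega>)" for k \<omega>
  have ind: "indep_vars (\<lambda>_. borel) ?X ({2..} <+> ({1..} <+> {1..}))"
    using prim by (simp add: queue_primitives_def)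
  have rv [measurable]: "u (k + 2) \<in> borel_measurable M" "v (k + 1) \<in> borel_measurable M" "d (k + 1) \<in> borel_measurable M" for k
  proof -
    have "?X i \<in> borel_measurable M" if "i \<in> {2..} <+> ({1..} <+> {1..})" for i
      using ind that unfolding indep_vars_def by blast
    from this[of "Inl (k + 2)"] this[of "Inr (Inl (k + 1))"] this[of "Inr (Inr (k + 1))"]
    show "u (k + 2) \<in> borel_measurable M" "v (k + 1) \<in> borel_measurable M" "d (k + 1) \<in> borel_measurable M"
      by (simp_all add: InlI InrI)
  qed
  have u_meas: "u j \<in> borel_measurable M" if "2 \<le> j" for j
    using rv(1)[of "j - 2"] that by (simp only: le_add_diff_inverse2)
  have iid: "iid_customers M E a"
  proof
    define K :: "nat \<Rightarrow> (nat + nat + nat) set" where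
      "K k = {Inl (k + 2), Inr (Inl (k + 1)), Inr (Inr (k + 1))}" for k
    have res: "indep_vars (\<lambda>k. PiM (K k) (\<lambda>_. borel)) (\<lambda>k \<omega>. restrict (\<lambda>i. ?X i \<omega>) (K k)) UNIV"
      by (rule indep_vars_restrict[OF ind]) (auto simp: K_def disjoint_family_on_def)
    define Y :: "nat \<Rightarrow> (nat + nat + nat \<Rightarrow> real) \<Rightarrow> real \<times> real \<times> real" where
      "Y k h = (h (Inl (k + 2)) / a, h (Inr (Inl (k + 1))) / b, h (Inr (Inr (k + 1))))" for k h
    have m: "(\<lambda>h. h k) \<in> borel_measurable (PiM I (\<lambda>_. borel))" if "k \<in> I" for k :: "nat + nat + nat" and I
      using measurable_component_singleton[OF that, of "\<lambda>_. borel"] .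
    have Y: "Y k \<in> borel_measurable (PiM (K k) (\<lambda>_. borel))" for k
      unfolding Y_def by (intro borel_measurable_Pair borel_measurable_divide m borel_measurable_const) (auto simp: K_def)
    have "indep_vars (\<lambda>_. borel) (\<lambda>k \<omega>. Y k (restrict (\<lambda>i. ?X i \<omega>) (K k))) UNIV"
      by (rule indep_vars_compose2[OF res]) (rule Y)
    then show "indep_vars (\<lambda>_. borel) E UNIV" by (simp add: K_def Y_def E_def[abs_def])
    fix k
    have "distr M borel (E k) = distr (distr M borel (\<lambda>\<omega>. (u (k + 2) \<omega>, v (k + 1) \<omega>, d (k + 1) \<omega>))) borel
        (\<lambda>c. (fst c / a, fst (snd c) / b, snd (snd c)))" for k
    proof -
      have 1: "(\<lambda>\<omega>. (u (k + 2) \<omega>, v (k + 1) \<omega>, d (k + 1) \<omega>)) \<in> borel_measurable M" by measurable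
      have 2: "(\<lambda>c :: real \<times> real \<times> real. (fst c / a, fst (snd c) / b, snd (snd c))) \<in> borel_measurable borel"
        by measurable
      show ?thesis unfolding distr_distr[OF 2 1] by (simp add: comp_def E_def[abs_def])
    qed
    then show "distr M borel (E k) = distr M borel (E 0)"
      using primitives_triple_law[OF prim, of "k + 2" "k + 1"] by (simp add: numeral_2_eq_2)
    have "\<forall>i\<ge>2. AE \<omega> in M. 0 \<le> u i \<omega>" "\<forall>i\<ge>1. AE \<omega> in M. 0 \<le> v i \<omega>"
      using prim unfolding queue_primitives_def by blast+
    then have "AE \<omega> in M. 0 \<le> u (k + 2) \<omega>" "AE \<omega> in M. 0 \<le> v (k + 1) \<omega>" by auto
    then show "AE \<omega> in M. 0 \<le> fst (E k \<omega>) \<and> 0 \<le> fst (snd (E k \<omega>))"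
      by eventually_elim (use rates in \<open>simp add: E_def\<close>)
    have "\<forall>i\<ge>2. integrable M (u i) \<and> (\<integral>\<omega>. u i \<omega> \<partial>M) = 1" "\<forall>i\<ge>2. AE \<omega> in M. 0 \<le> u i \<omega>"
      using prim unfolding queue_primitives_def by blast+
    then have "integrable M (u 2)" "(\<integral>\<omega>. u 2 \<omega> \<partial>M) = 1" "AE \<omega> in M. 0 \<le> u 2 \<omega>" by auto
    then show "(\<integral>\<^sup>+\<omega>. ennreal (fst (E 0 \<omega>)) \<partial>M) = ennreal (1 / a)"
      using rates by (subst nn_integral_eq_integral) (auto simp: E_def numeral_2_eq_2)
  qed (fact rates)
  interpret iid_customers M E a by (fact iid)
  have sets_pi: "sets \<pi> = sets borel" and pr: "prob_space \<pi>" and st: "AE x in \<pi>. x \<in> queue_states"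
    using stat by (auto simp: stationary_distribution_def)
  interpret pi: prob_space \<pi> by (fact pr)
  have [measurable]: "fst \<in> borel_measurable (\<pi> \<Otimes>\<^sub>M M)"
    using measurable_fst[of \<pi> M] by (simp cong: measurable_cong_sets add: sets_pi)
  have "distr (\<pi> \<Otimes>\<^sub>M M) borel (\<lambda>p. state_at (fst p) (\<lambda>i. E i (snd p)) s) = \<pi>" if s: "0 \<le> s" for s
  proof (rule measure_eqI)
    fix B assume "B \<in> sets (distr (\<pi> \<Otimes>\<^sub>M M) borel (\<lambda>p. state_at (fst p) (\<lambda>i. E i (snd p)) s))"
    then have B [measurable]: "B \<in> sets borel" by simp
    have X: "(\<lambda>p. state_at (fst p) (\<lambda>i. E i (snd p)) s) \<in> borel_measurable (\<pi> \<Otimes>\<^sub>M M)" by measurable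
    have "emeasure (distr (\<pi> \<Otimes>\<^sub>M M) borel (\<lambda>p. state_at (fst p) (\<lambda>i. E i (snd p)) s)) B =
        (\<integral>\<^sup>+x. emeasure M (Pair x -` ((\<lambda>p. state_at (fst p) (\<lambda>i. E i (snd p)) s) -` B \<inter> space (\<pi> \<Otimes>\<^sub>M M))) \<partial>\<pi>)"
      unfolding emeasure_distr[OF X B] by (rule emeasure_pair_measure_alt[OF measurable_sets[OF X B]])
    also have "\<dots> = (\<integral>\<^sup>+x. emeasure M {\<omega> \<in> space M. queue_process (\<lambda>j \<omega>. u j \<omega> / a) V x s \<omega> \<in> B} \<partial>\<pi>)"
    proof (rule nn_integral_cong_AE, use st AE_space in eventually_elim)
      case (elim x)
      have [measurable]: "V x s \<in> borel_measurable M"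
        using offered[OF elim(1)] s by (simp add: offered_waiting_process_def)
      have [measurable]: "(\<lambda>\<omega>. queue_process (\<lambda>j \<omega>. u j \<omega> / a) V x s \<omega>) \<in> borel_measurable M"
        unfolding queue_process_def
        by (intro borel_measurable_Pair measurable_remaining_arrival_time borel_measurable_divide u_meas) measurable
      have eq: "Pair x -` ((\<lambda>p. state_at (fst p) (\<lambda>i. E i (snd p)) s) -` B \<inter> space (\<pi> \<Otimes>\<^sub>M M)) =
          {\<omega> \<in> space M. state_at x (\<lambda>i. E i \<omega>) s \<in> B}"
        using elim(2) by (auto simp: space_pair_measure)
      have "AE \<omega> in M. offered_waiting_path (\<lambda>j. u j \<omega> / a) (\<lambda>j. v j \<omega> / b) (\<lambda>j. d j \<omega>) (fst x) (snd x) (\<lambda>t. V x t \<omega>)"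
        using offered[OF elim(1)] by (simp add: offered_waiting_process_def)
      then have "AE \<omega> in M. queue_process (\<lambda>j \<omega>. u j \<omega> / a) V x s \<omega> = state_at x (\<lambda>i. E i \<omega>) s"
        using AE_regular_input[OF elim(1)]
      proof eventually_elim
        case (elim \<omega>)
        show ?case
          using offered_waiting_path_determined[OF elim(1) _ s] elim(2)
          by (simp add: queue_process_def E_def)
      qed
      then show ?case unfolding eq by (intro emeasure_eq_AE) auto
    qed
    also have "\<dots> = emeasure \<pi> B"
      using stat s B by (simp add: stationary_distribution_def)
    finally show "emeasure (distr (\<pi> \<Otimes>\<^sub>M M) borel (\<lambda>p. state_at (fst p) (\<lambda>i. E i (snd p)) s)) B = emeasure \<pi> B" .
  qed (simp add: sets_pi)
  then have "stationary_queue M E a \<pi>"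
    by (intro stationary_queue.intro stationary_queue_axioms.intro iid pr sets_pi st)
  then show ?thesis by (simp add: E_def[abs_def])
qed

section \<open>Expansions of powers and of smooth functions\<close>

lemma powr_add_le_split:
  fixes x y s \<eta> :: real
  assumes "0 \<le> x" "0 \<le> y" "0 < s" "0 < \<eta>"
  shows "(x + y) powr s \<le> (1 + \<eta>) powr s * x powr s + (1 + 1 / \<eta>) powr s * y powr s"
proof (cases "y \<le> \<eta> * x")
  case True
  have "(x + y) powr s \<le> ((1 + \<eta>) * x) powr s"
    using assms True by (intro powr_mono2) (auto simp: algebra_simps)
  also have "\<dots> = (1 + \<eta>) powr s * x powr s" using assms by (simp add: powr_mult)
  finally show ?thesis by (simp add: add_increasing2)
next
  case False
  then have "x \<le> y / \<eta>" using assms by (simp add: field_simps)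
  then have "(x + y) powr s \<le> ((1 + 1 / \<eta>) * y) powr s"
    using assms by (intro powr_mono2) (auto simp: algebra_simps)
  also have "\<dots> = (1 + 1 / \<eta>) powr s * y powr s" using assms by (simp add: powr_mult)
  finally show ?thesis by (simp add: add_increasing)
qed

lemma powr_le_one_add:
  fixes x a b :: real
  assumes "0 \<le> x" "0 \<le> a" "a \<le> b"
  shows "x powr a \<le> 1 + x powr b"
proof (cases "x \<le> 1")
  case True
  then have "x powr a \<le> 1" using assms by (intro powr_le1) auto
  then show ?thesis by (simp add: add_increasing2)
next
  case False
  then have "x powr a \<le> x powr b" using assms by (intro powr_mono) auto
  then show ?thesis by simp
qed

text \<open>
  A second-order expansion with one-sided error: the remainder is of size \<open>w powr (p - 2) * D\<^sup>2\<close> when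
  \<open>w\<close> dominates \<open>\<bar>D\<bar>\<close>, and of size \<open>\<bar>D\<bar> powr p\<close> otherwise.
\<close>

lemma positive_part_powr_expansion:
  fixes w D p :: real
  assumes p: "2 < p" and w: "0 \<le> w"
  shows "(max 0 (w + D)) powr p \<le> w powr p + p * w powr (p - 1) * D +
    p * p * 2 powr p * (w powr (p - 2) * D\<^sup>2 + \<bar>D\<bar> powr p)"
proof -
  define c where "c = p * p * 2 powr p"
  have "1 * 1 \<le> p * 2 powr p" using p by (intro mult_mono ge_one_powr_ge_zero) auto
  then have "p * 1 \<le> p * (p * 2 powr p)" using p by (intro mult_left_mono) auto
  then have "p \<le> c" by (simp add: c_def mult.assoc)
  with p have c: "p \<le> c" "1 \<le> c" by simp_all
  have nn: "0 \<le> w powr (p - 2) * D\<^sup>2 + \<bar>D\<bar> powr p" by simp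
  have "(max 0 (w + D)) powr p \<le> w powr p + p * w powr (p - 1) * D + c * (w powr (p - 2) * D\<^sup>2 + \<bar>D\<bar> powr p)"
  proof (cases "w + D \<le> 0")
    case True
    then have D: "w \<le> \<bar>D\<bar>" "D \<le> 0" using w by auto
    have "p * w powr (p - 1) * \<bar>D\<bar> \<le> p * \<bar>D\<bar> powr (p - 1) * \<bar>D\<bar>"
      using D p w by (intro mult_right_mono mult_left_mono powr_mono2) auto
    also have "\<bar>D\<bar> powr (p - 1) * \<bar>D\<bar> = \<bar>D\<bar> powr p"
      by (cases "D = 0") (use p in \<open>auto simp: powr_mult_base[symmetric] powr_diff\<close>)
    then have "p * \<bar>D\<bar> powr (p - 1) * \<bar>D\<bar> = p * \<bar>D\<bar> powr p" by (simp add: mult.assoc)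
    also have "\<dots> \<le> c * \<bar>D\<bar> powr p" using c by (intro mult_right_mono) auto
    also have "\<dots> \<le> c * (w powr (p - 2) * D\<^sup>2 + \<bar>D\<bar> powr p)"
      using c by (intro mult_left_mono) auto
    finally have "- (p * w powr (p - 1) * D) \<le> c * (w powr (p - 2) * D\<^sup>2 + \<bar>D\<bar> powr p)"
      using D by (simp add: abs_of_nonpos)
    moreover have "(max 0 (w + D)) powr p = 0" "0 \<le> w powr p" using True p by auto
    ultimately show ?thesis by linarith
  next
    case False
    show ?thesis
    proof (cases "w = 0")
      case True
      then have "\<bar>D\<bar> powr p \<le> c * \<bar>D\<bar> powr p" using mult_right_mono[OF c(2), of "\<bar>D\<bar> powr p"] by simp
      then show ?thesis using True False p by simp
    next
      case w0: False
      define I where "I = {min w (w + D)..max w (w + D)}"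
      have pos: "0 < z" "z \<le> w + \<bar>D\<bar>" "\<bar>z - w\<bar> \<le> \<bar>D\<bar>" if "z \<in> I" for z
        using that w w0 False by (auto simp: I_def)
      have mvt: "\<exists>\<xi>\<in>I. (w + D) powr p - w powr p = p * \<xi> powr (p - 1) * D"
      proof (cases "D = 0")
        case False
        then consider "w < w + D" | "w + D < w" by linarith
        then show ?thesis
        proof cases
          case 1
          have "\<exists>\<xi>. w < \<xi> \<and> \<xi> < w + D \<and> (w + D) powr p - w powr p = (w + D - w) * (p * \<xi> powr (p - 1))"
            by (rule MVT2[OF 1]) (use w w0 in \<open>auto intro!: has_real_derivative_powr\<close>)
          then show ?thesis using 1 by (auto simp: I_def intro!: bexI)
        next
          case 2
          have "\<exists>\<xi>. w + D < \<xi> \<and> \<xi> < w \<and> w powr p - (w + D) powr p = (w - (w + D)) * (p * \<xi> powr (p - 1))"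
            by (rule MVT2[OF 2]) (use \<open>\<not> w + D \<le> 0\<close> in \<open>auto intro!: has_real_derivative_powr\<close>)
          then obtain \<xi> where "w + D < \<xi>" "\<xi> < w" "w powr p - (w + D) powr p = - D * (p * \<xi> powr (p - 1))" by auto
          then show ?thesis using 2 by (auto simp: I_def algebra_simps intro!: bexI[of _ \<xi>])
        qed
      qed (auto simp: I_def)
      then obtain \<xi> where xi: "\<xi> \<in> I" "(w + D) powr p - w powr p = p * \<xi> powr (p - 1) * D" by blast
      have "\<bar>\<xi> powr (p - 1) - w powr (p - 1)\<bar> \<le> (p * (w + \<bar>D\<bar>) powr (p - 2)) * \<bar>\<xi> - w\<bar>"
      proof (rule field_differentiable_bound[where S = I and f' = "\<lambda>z. (p - 1) * z powr (p - 1 - 1)", simplified real_norm_def])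
        show "convex I" by (simp add: I_def)
        fix z assume z: "z \<in> I"
        show "((\<lambda>z. z powr (p - 1)) has_field_derivative (p - 1) * z powr (p - 1 - 1)) (at z within I)"
          using pos[OF z] by (intro has_field_derivative_at_within[OF has_real_derivative_powr])
        have "z powr (p - 1 - 1) \<le> (w + \<bar>D\<bar>) powr (p - 2)"
          using pos[OF z] p by (simp add: powr_mono2)
        then have "(p - 1) * z powr (p - 1 - 1) \<le> p * (w + \<bar>D\<bar>) powr (p - 2)"
          using p by (intro mult_mono) auto
        then show "\<bar>(p - 1) * z powr (p - 1 - 1)\<bar> \<le> p * (w + \<bar>D\<bar>) powr (p - 2)"
          using p by simp
      qed (use xi in \<open>auto simp: I_def\<close>)
      also have "\<dots> \<le> (p * (w + \<bar>D\<bar>) powr (p - 2)) * \<bar>D\<bar>"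
        using pos[OF xi(1)] p by (intro mult_left_mono) auto
      finally have diff: "\<bar>\<xi> powr (p - 1) - w powr (p - 1)\<bar> \<le> p * (w + \<bar>D\<bar>) powr (p - 2) * \<bar>D\<bar>" .
      have "(w + \<bar>D\<bar>) powr (p - 2) \<le> (1 + 1) powr (p - 2) * w powr (p - 2) + (1 + 1 / 1) powr (p - 2) * \<bar>D\<bar> powr (p - 2)"
        using w p by (intro powr_add_le_split) auto
      also have "\<dots> = 2 powr (p - 2) * (w powr (p - 2) + \<bar>D\<bar> powr (p - 2))" by (simp add: algebra_simps)
      also have "\<dots> \<le> 2 powr p * (w powr (p - 2) + \<bar>D\<bar> powr (p - 2))" by (intro mult_right_mono powr_mono) auto
      finally have sp: "(w + \<bar>D\<bar>) powr (p - 2) \<le> 2 powr p * (w powr (p - 2) + \<bar>D\<bar> powr (p - 2))" .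
      have D2: "\<bar>D\<bar> powr (p - 2) * D\<^sup>2 = \<bar>D\<bar> powr p"
        by (cases "D = 0") (use p in \<open>auto simp: powr_diff powr_numeral\<close>)
      have "p * \<xi> powr (p - 1) * D - p * w powr (p - 1) * D = p * ((\<xi> powr (p - 1) - w powr (p - 1)) * D)"
        by (simp add: algebra_simps)
      also have "\<dots> \<le> p * (\<bar>\<xi> powr (p - 1) - w powr (p - 1)\<bar> * \<bar>D\<bar>)"
        using p by (intro mult_left_mono) (simp_all flip: abs_mult)
      also have "\<dots> \<le> p * ((p * (w + \<bar>D\<bar>) powr (p - 2) * \<bar>D\<bar>) * \<bar>D\<bar>)"
        using p by (intro mult_left_mono mult_right_mono diff) auto
      also have "\<dots> = p * p * ((w + \<bar>D\<bar>) powr (p - 2) * D\<^sup>2)" by (simp add: power2_eq_square algebra_simps)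
      also have "\<dots> \<le> p * p * ((2 powr p * (w powr (p - 2) + \<bar>D\<bar> powr (p - 2))) * D\<^sup>2)"
        using p sp by (intro mult_left_mono mult_right_mono) auto
      also have "\<dots> = c * (w powr (p - 2) * D\<^sup>2 + \<bar>D\<bar> powr (p - 2) * D\<^sup>2)" by (simp add: c_def algebra_simps)
      finally show ?thesis using xi(2) False unfolding D2 by simp
    qed
  qed
  then show ?thesis by (simp add: c_def)
qed

lemma second_order_remainder:
  fixes f g \<gamma> :: "real \<Rightarrow> real"
  assumes f: "\<And>z. (f has_real_derivative g z) (at z)" and g: "\<And>z. (g has_real_derivative \<gamma> z) (at z)"
    and S: "\<And>z. \<bar>z - w\<bar> \<le> \<bar>D\<bar> \<Longrightarrow> \<bar>\<gamma> z - \<gamma> w\<bar> \<le> S"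
  shows "\<bar>f (w + D) - f w - g w * D - \<gamma> w * D\<^sup>2 / 2\<bar> \<le> S * D\<^sup>2"
proof -
  define B where "B = cball w \<bar>D\<bar>"
  define h where "h z = f z - f w - g w * (z - w) - \<gamma> w * (z - w)\<^sup>2 / 2" for z
  have S0: "0 \<le> S" using S[of w] by simp
  have B: "convex B" "w \<in> B" "w + D \<in> B" "\<And>z. z \<in> B \<Longrightarrow> \<bar>z - w\<bar> \<le> \<bar>D\<bar>"
    by (auto simp: B_def dist_real_def abs_minus_commute)
  have dh: "(h has_real_derivative (g z - g w - \<gamma> w * (z - w))) (at z)" for z
    unfolding h_def by (auto intro!: derivative_eq_intros f)
  have gb: "\<bar>g z - g w - \<gamma> w * (z - w)\<bar> \<le> S * \<bar>D\<bar>" if z: "z \<in> B" for z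
  proof -
    have "norm ((g z - \<gamma> w * z) - (g w - \<gamma> w * w)) \<le> S * norm (z - w)"
    proof (rule field_differentiable_bound[where S = B])
      fix y assume "y \<in> B"
      show "((\<lambda>z. g z - \<gamma> w * z) has_field_derivative (\<gamma> y - \<gamma> w)) (at y within B)"
        by (auto intro!: derivative_eq_intros has_field_derivative_at_within[OF g])
      show "norm (\<gamma> y - \<gamma> w) \<le> S" using S B(4)[OF \<open>y \<in> B\<close>] by simp
    qed (use B z in auto)
    also have "\<dots> \<le> S * \<bar>D\<bar>" using B(4)[OF z] S0 by (intro mult_left_mono) auto
    finally show ?thesis by (simp add: algebra_simps)
  qed
  have "norm (h (w + D) - h w) \<le> S * \<bar>D\<bar> * norm (w + D - w)"
  proof (rule field_differentiable_bound[where S = B])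
    fix z assume "z \<in> B"
    show "(h has_field_derivative (g z - g w - \<gamma> w * (z - w))) (at z within B)"
      by (rule has_field_derivative_at_within[OF dh])
    show "norm (g z - g w - \<gamma> w * (z - w)) \<le> S * \<bar>D\<bar>" using gb[OF \<open>z \<in> B\<close>] by simp
  qed (use B in auto)
  then show ?thesis by (simp add: h_def power2_eq_square mult.assoc abs_mult[symmetric])
qed

section \<open>The Stein equation of the limit density\<close>

lemma antiderivative_exists:
  fixes f :: "real \<Rightarrow> real"
  assumes "continuous_on UNIV f"
  obtains F where "F 0 = 0" "\<And>x. (F has_real_derivative f x) (at x)"
proof -
  have "\<exists>F. \<forall>x::real. - \<infinity> < ereal x \<longrightarrow> ereal x < \<infinity> \<longrightarrow> (F has_vector_derivative f x) (at x)"
    by (rule einterval_antiderivative) (use assms in \<open>auto simp: continuous_on_eq_continuous_at\<close>)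
  then obtain F where F: "\<And>x. (F has_real_derivative f x) (at x)"
    by (auto simp: has_real_derivative_iff_has_vector_derivative)
  show ?thesis
  proof (rule that[of "\<lambda>x. F x - F 0"])
    show "((\<lambda>x. F x - F 0) has_real_derivative f x) (at x)" for x
      using F by (auto intro!: derivative_eq_intros)
  qed simp
qed

text \<open>
  With \<open>f\<close> the density and \<open>F\<close> its distribution function, the ratio \<open>k = c (1 - F) / f\<close> solves
  \<open>s2 / 2 k' + (a - H) k = - s2 c / 2\<close>, because \<open>f' = 2 (a - H) f / s2\<close>. Integrating the latter equation
  over the half-line gives \<open>a + s2 c / 2\<close> for the mean of \<open>H\<close>, so that \<open>g = k - 1\<close> solves the Stein
  equation for the test function \<open>H\<close> itself, and \<open>f 0 = c\<close> gives the reflecting boundary value \<open>g 0 = 0\<close>.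
  Monotonicity of \<open>H\<close> bounds \<open>k\<close> and its derivative by a Mills ratio estimate, however fast \<open>H\<close> grows.
\<close>

lemma stein_solution:
  fixes H \<phi> :: "real \<Rightarrow> real" and a s2 c x0 \<delta> :: real
  assumes H: "continuous_on {0..} H" "\<And>x y. 0 \<le> x \<Longrightarrow> x \<le> y \<Longrightarrow> H x \<le> H y" "\<And>x. 0 \<le> x \<Longrightarrow> 0 \<le> H x"
    and x0: "0 \<le> x0" "0 < \<delta>" "a + \<delta> \<le> H x0"
    and s2: "0 < s2" and c: "0 < c"
    and \<phi>: "\<And>x. \<phi> x = (if x \<ge> 0 then c * exp (2 / s2 * (a * x - integral {0..x} H)) else 0)"
    and total: "(\<phi> has_integral 1) {0..}"
  obtains \<gamma> g \<Gamma> G where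
    "continuous_on UNIV \<gamma>" "\<And>x. \<bar>\<gamma> x\<bar> \<le> \<Gamma>" "\<And>x. (g has_real_derivative \<gamma> x) (at x)" "g 0 = 0"
    "\<And>x. 0 \<le> x \<Longrightarrow> \<bar>g x\<bar> \<le> G"
    "\<And>x. 0 \<le> x \<Longrightarrow> s2 / 2 * \<gamma> x + (a - H x) * g x = H x - (\<integral>x. \<phi> x * H (max 0 x) \<partial>lborel)"
proof -
  define b where "b x = a - H (max 0 x)" for x
  have cH: "continuous_on UNIV (\<lambda>x. H (max 0 x))"
    by (rule continuous_on_compose2[OF H(1)]) (auto intro!: continuous_intros)
  have cb: "continuous_on UNIV b" unfolding b_def by (intro continuous_intros cH)
  obtain A where A: "A 0 = 0" "\<And>x. (A has_real_derivative H (max 0 x)) (at x)"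
    using antiderivative_exists[OF cH] by blast
  define f where "f x = c * exp (2 / s2 * (a * x - A x))" for x
  have f_pos: "0 < f x" for x using c by (simp add: f_def)
  have df: "(f has_real_derivative 2 / s2 * b x * f x) (at x)" for x
    unfolding f_def b_def using s2 by (auto intro!: derivative_eq_intros A simp: algebra_simps)
  have cf: "continuous_on UNIV f"
    using df by (intro continuous_at_imp_continuous_on) (auto intro: DERIV_isCont)
  have \<phi>_eq: "\<phi> x = f x" if "0 \<le> x" for x
  proof -
    have "((\<lambda>x. H (max 0 x)) has_integral A x - A 0) {0..x}"
      using has_field_derivative_at_within[OF A(2)]
      by (intro fundamental_theorem_of_calculus that) (simp only: has_real_derivative_iff_has_vector_derivative)
    then have "(H has_integral A x) {0..x}"
      using A(1) by (subst (asm) has_integral_cong[where g = H]) (auto simp: max_def)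
    then show ?thesis using that by (simp add: \<phi> f_def integral_unique)
  qed
  obtain F where F: "F 0 = 0" "\<And>x. (F has_real_derivative f x) (at x)"
    using antiderivative_exists[OF cf] by blast
  have F_mono: "F x \<le> F y" if "x \<le> y" for x y
    by (rule DERIV_nonneg_imp_nondecreasing[OF that]) (use F(2) f_pos less_imp_le in blast)
  have tot: "(f has_integral 1) {0..}"
    using total by (subst (asm) has_integral_cong[where g = f]) (auto simp: \<phi>_eq)
  have F_lim: "(F \<longlongrightarrow> 1) at_top"
  proof -
    have int: "(f has_integral F R) {0..R}" if "0 \<le> R" for R
    proof -
      have "(f has_integral F R - F 0) {0..R}"
        using has_field_derivative_at_within[OF F(2)]
        by (intro fundamental_theorem_of_calculus that) (simp only: has_real_derivative_iff_has_vector_derivative)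
      then show ?thesis using F(1) by simp
    qed
    have "F R \<le> 1" if "0 \<le> R" for R
      using has_integral_subset_le[OF _ int[OF that] tot] f_pos that by (auto intro: less_imp_le)
    then have bd: "F R \<le> 1" for R using F_mono[of R 0] F(1) by (cases "0 \<le> R") auto
    have "incseq (\<lambda>n. F (real n))" by (auto simp: incseq_def intro: F_mono)
    then obtain L where "(\<lambda>n. F (real n)) \<longlonglongrightarrow> L"
      using incseq_convergent[of "\<lambda>n. F (real n)" 1] bd by blast
    then have L: "(F \<longlongrightarrow> L) at_top"
      by (intro tendsto_at_topI_sequentially_real) (auto simp: mono_def intro: F_mono)
    have "(\<integral>\<^sup>+x. ennreal (f x) * indicator {0..} x \<partial>lborel) = ennreal (L - F 0)"
      by (rule nn_integral_FTC_atLeast[OF _ _ _ L]) (use F(2) f_pos cf in \<open>auto intro: less_imp_le borel_measurable_continuous_onI\<close>)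
    moreover have "(\<integral>\<^sup>+x. ennreal (indicator {0..} x * f x) \<partial>lborel) = ennreal 1"
      by (rule nn_integral_has_integral_lebesgue[OF _ tot]) (use f_pos less_imp_le in blast)
    moreover have "ennreal (indicator {0..} x * f x) = ennreal (f x) * indicator {0..} x" for x :: real
      by (simp add: indicator_def)
    ultimately have "ennreal L = ennreal 1" using F(1) by simp
    moreover have "0 \<le> L" using L by (rule tendsto_lowerbound) (auto intro!: eventually_at_top_linorderI[of 0] simp: F_mono[of 0, unfolded F(1)])
    ultimately have "L = 1" by simp
    then show ?thesis using L by simp
  qed
  have F_le: "F x \<le> 1" for x
    using F_lim by (rule tendsto_lowerbound) (auto intro!: eventually_at_top_linorderI[of x] F_mono)
  have b_neg: "b x \<le> - \<delta>" if "x0 \<le> x" for x using H(2)[of x0 x] x0 that by (simp add: b_def max_def)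
  have b_mono: "b y \<le> b x" if "x \<le> y" for x y using H(2)[of "max 0 x" "max 0 y"] that by (auto simp: b_def)
  have f_anti: "f y \<le> f x" if "x0 \<le> x" "x \<le> y" for x y
  proof (rule DERIV_nonpos_imp_nonincreasing[OF that(2)])
    fix z assume "x \<le> z"
    then have "b z \<le> 0" using b_neg[of z] that x0 by auto
    moreover have "0 \<le> 2 / s2 * f z" using s2 f_pos[of z] by simp
    ultimately have "(2 / s2 * f z) * b z \<le> 0" by (intro mult_nonneg_nonpos)
    then have "2 / s2 * b z * f z \<le> 0" by (simp only: mult_ac)
    then show "\<exists>y. (f has_real_derivative y) (at z) \<and> y \<le> 0" using df by blast
  qed
  have f_lim: "(f \<longlongrightarrow> 0) at_top"
  proof (rule tendsto_sandwich)
    show "((\<lambda>R. 0) \<longlongrightarrow> (0::real)) at_top" by simp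
    show "((\<lambda>R. 1 / (R - x0)) \<longlongrightarrow> 0) at_top" by real_asymp
    show "\<forall>\<^sub>F R in at_top. 0 \<le> f R" using f_pos less_imp_le by (intro always_eventually) blast
    show "\<forall>\<^sub>F R in at_top. f R \<le> 1 / (R - x0)"
    proof (rule eventually_mono[OF eventually_gt_at_top[of x0]])
      fix R assume R: "x0 < R"
      obtain \<xi> where xi: "x0 < \<xi>" "\<xi> < R" "F R - F x0 = (R - x0) * f \<xi>"
        using MVT2[OF R, of F f] F(2) by blast
      have "(R - x0) * f R \<le> (R - x0) * f \<xi>" using R xi f_anti[of \<xi> R] by (intro mult_left_mono) auto
      also have "\<dots> \<le> 1" using F_le[of R] F_mono[of 0 x0] F(1) x0 xi by simp
      finally show "f R \<le> 1 / (R - x0)" using R by (simp add: field_simps)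
    qed
  qed
  have f0: "f 0 = c" by (simp add: f_def A)
  define h where "h = a + s2 / 2 * c"
  have h_eq: "(\<integral>x. \<phi> x * H (max 0 x) \<partial>lborel) = h"
  proof -
    \<comment> \<open>An antiderivative of \<open>H f\<close>, by the differential equation of the density.\<close>
    define Q where "Q R = a * F R - s2 / 2 * (f R - f 0)" for R
    have dQ: "(Q has_real_derivative H (max 0 x) * f x) (at x)" for x
      unfolding Q_def using s2 by (auto intro!: derivative_eq_intros F df simp: b_def field_simps)
    have Q_lim: "(Q \<longlongrightarrow> a * 1 - s2 / 2 * (0 - f 0)) at_top"
      unfolding Q_def by (intro tendsto_intros F_lim f_lim)
    have nn: "0 \<le> H (max 0 x) * f x" for x using H(3) f_pos less_imp_le by (intro mult_nonneg_nonneg) auto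
    have [measurable]: "(\<lambda>x. H (max 0 x)) \<in> borel_measurable borel" "f \<in> borel_measurable borel"
      using cH cf by (auto intro: borel_measurable_continuous_onI)
    have "(\<integral>\<^sup>+x. ennreal (H (max 0 x) * f x) * indicator {0..} x \<partial>lborel) = ennreal (a * 1 - s2 / 2 * (0 - f 0) - Q 0)"
      by (rule nn_integral_FTC_atLeast[OF _ dQ nn Q_lim]) measurable
    moreover have "Q 0 \<le> Q R" if "0 \<le> R" for R
      by (rule DERIV_nonneg_imp_nondecreasing[OF that]) (use dQ nn in blast)
    then have "Q 0 \<le> a * 1 - s2 / 2 * (0 - f 0)"
      by (intro tendsto_lowerbound[OF Q_lim]) (auto intro!: eventually_at_top_linorderI[of 0])
    moreover have "Q 0 = 0" by (simp add: Q_def F)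
    ultimately have *: "(\<integral>\<^sup>+x. ennreal (H (max 0 x) * f x) * indicator {0..} x \<partial>lborel) = ennreal h" "0 \<le> h"
      by (simp_all add: h_def f0)
    have eq: "\<phi> x * H (max 0 x) = indicator {0..} x * (H (max 0 x) * f x)" for x
      by (cases "0 \<le> x") (auto simp: \<phi>_eq, simp add: \<phi>)
    have "(\<integral>x. \<phi> x * H (max 0 x) \<partial>lborel) = enn2real (\<integral>\<^sup>+x. ennreal (indicator {0..} x * (H (max 0 x) * f x)) \<partial>lborel)"
      unfolding eq by (rule integral_eq_nn_integral) (use nn in auto)
    also have "(\<integral>\<^sup>+x. ennreal (indicator {0..} x * (H (max 0 x) * f x)) \<partial>lborel) = ennreal h"
      unfolding *(1)[symmetric] by (intro nn_integral_cong) (simp add: indicator_def)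
    finally show ?thesis using *(2) by simp
  qed
  define k where "k x = c * (1 - F x) / f x" for x
  define \<kappa> where "\<kappa> x = - c - 2 / s2 * b x * k x" for x
  have dk: "(k has_real_derivative \<kappa> x) (at x)" for x
    unfolding k_def \<kappa>_def using f_pos[of x] s2
    by (auto intro!: derivative_eq_intros F df simp: field_simps power2_eq_square)
  have ck: "continuous_on UNIV k"
    using dk by (intro continuous_at_imp_continuous_on) (auto intro: DERIV_isCont)
  then have ckap: "continuous_on UNIV \<kappa>" unfolding \<kappa>_def by (intro continuous_intros cb)
  have k_nonneg: "0 \<le> k x" for x using F_le[of x] f_pos[of x] c by (simp add: k_def)
  \<comment> \<open>The Mills ratio estimate: beyond \<open>x\<close> the drift is at most \<open>b x\<close>, so the density decays at least
    exponentially there, at a rate proportional to \<open>- b x\<close>.\<close>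
  have mills: "- b x * k x \<le> s2 / 2 * c" if x: "x0 \<le> x" for x
  proof -
    have bound: "- b x * (F y - F x) + s2 / 2 * f y \<le> s2 / 2 * f x" if y: "x \<le> y" for y
    proof -
      have "- b x * (F y - F x) + s2 / 2 * f y \<le> - b x * (F x - F x) + s2 / 2 * f x"
      proof (rule DERIV_nonpos_imp_nonincreasing[OF y])
        fix z assume z: "x \<le> z"
        have "((\<lambda>y. - b x * (F y - F x) + s2 / 2 * f y) has_real_derivative (b z - b x) * f z) (at z)"
          using s2 by (auto intro!: derivative_eq_intros F df simp: field_simps)
        moreover have "(b z - b x) * f z \<le> 0"
          using b_mono[OF z] f_pos[of z] by (simp add: mult_nonpos_nonneg)
        ultimately show "\<exists>d. ((\<lambda>y. - b x * (F y - F x) + s2 / 2 * f y) has_real_derivative d) (at z) \<and> d \<le> 0" by blast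
      qed
      then show ?thesis by simp
    qed
    have "((\<lambda>y. - b x * (F y - F x) + s2 / 2 * f y) \<longlongrightarrow> - b x * (1 - F x) + s2 / 2 * 0) at_top"
      by (intro tendsto_intros F_lim f_lim)
    then have "- b x * (1 - F x) + s2 / 2 * 0 \<le> s2 / 2 * f x"
    proof (rule tendsto_upperbound)
      show "\<forall>\<^sub>F y in at_top. - b x * (F y - F x) + s2 / 2 * f y \<le> s2 / 2 * f x"
        by (rule eventually_at_top_linorderI[of x]) (rule bound)
    qed simp
    then have "c * (- b x * (1 - F x)) \<le> c * (s2 / 2 * f x)" using c by (intro mult_left_mono) auto
    then show ?thesis using f_pos[of x] by (simp add: k_def divide_simps algebra_simps split: if_splits)
  qed
  have k_tail: "k x \<le> s2 / 2 * c / \<delta>" if x: "x0 \<le> x" for x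
  proof -
    have "\<delta> * k x \<le> - b x * k x" using b_neg[OF x] k_nonneg by (intro mult_right_mono) auto
    with mills[OF x] x0 show ?thesis by (simp add: field_simps)
  qed
  have kap_tail: "\<bar>\<kappa> x\<bar> \<le> 2 * c" if x: "x0 \<le> x" for x
  proof -
    have "0 \<le> - b x * k x" using b_neg[OF x] x0 k_nonneg[of x] by (intro mult_nonneg_nonneg) auto
    moreover have "0 \<le> 2 / s2" using s2 by simp
    ultimately have "0 \<le> 2 / s2 * (- b x * k x)" by (rule mult_nonneg_nonneg[rotated])
    moreover have "2 / s2 * (- b x * k x) \<le> 2 / s2 * (s2 / 2 * c)"
      using mills[OF x] s2 by (intro mult_left_mono) auto
    ultimately show ?thesis using s2 c by (simp add: \<kappa>_def)
  qed
  have "compact (k ` {0..x0})" "compact (\<kappa> ` {0..x0})"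
    by (auto intro!: compact_continuous_image continuous_on_subset[OF ck] continuous_on_subset[OF ckap])
  then obtain B1 B2 where B: "\<And>x. x \<in> {0..x0} \<Longrightarrow> \<bar>k x\<bar> \<le> B1" "\<And>x. x \<in> {0..x0} \<Longrightarrow> \<bar>\<kappa> x\<bar> \<le> B2"
    unfolding compact_eq_bounded_closed bounded_iff by (metis image_eqI real_norm_def)
  define \<gamma> where "\<gamma> x = \<kappa> (max 0 x)" for x
  have c\<gamma>: "continuous_on UNIV \<gamma>"
    unfolding \<gamma>_def by (rule continuous_on_compose2[OF ckap]) (auto intro!: continuous_intros)
  obtain g where g: "g 0 = 0" "\<And>x. (g has_real_derivative \<gamma> x) (at x)"
    using antiderivative_exists[OF c\<gamma>] by blast
  have g_eq: "g x = k x - 1" if x: "0 \<le> x" for x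
  proof -
    have "\<exists>q. \<forall>x\<in>{0..}. g x - k x = q"
    proof (rule has_field_derivative_zero_constant)
      fix y :: real assume "y \<in> {0..}"
      then show "((\<lambda>x. g x - k x) has_field_derivative 0) (at y within {0..})"
        by (auto intro!: derivative_eq_intros has_field_derivative_at_within[OF g(2)] has_field_derivative_at_within[OF dk] simp: \<gamma>_def)
    qed auto
    then obtain q where q: "\<And>x. 0 \<le> x \<Longrightarrow> g x - k x = q" by auto
    have "k 0 = 1" using c by (simp add: k_def F f0)
    then show ?thesis using q[of 0] q[OF x] g(1) by simp
  qed
  show ?thesis
  proof (rule that[OF c\<gamma> _ g(2,1)])
    show "\<bar>\<gamma> x\<bar> \<le> max B2 (2 * c)" for x
      using B(2)[of "max 0 x"] kap_tail[of "max 0 x"] by (cases "max 0 x \<le> x0") (auto simp: \<gamma>_def)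
    show "\<bar>g x\<bar> \<le> max B1 (s2 / 2 * c / \<delta>) + 1" if "0 \<le> x" for x
    proof -
      have "\<bar>k x\<bar> \<le> max B1 (s2 / 2 * c / \<delta>)"
        using B(1)[of x] k_tail[of x] k_nonneg[of x] that by (cases "x \<le> x0") auto
      then show ?thesis using g_eq[OF that] by simp
    qed
    show "s2 / 2 * \<gamma> x + (a - H x) * g x = H x - (\<integral>x. \<phi> x * H (max 0 x) \<partial>lborel)" if "0 \<le> x" for x
      unfolding h_eq g_eq[OF that] using that s2 by (simp add: \<gamma>_def \<kappa>_def h_def b_def field_simps)
  qed
qed

section \<open>Increments of the scaled workload\<close>

lemma integrable_by_truncation:
  fixes f :: "nat \<Rightarrow> 'a \<Rightarrow> real"
  assumes "\<And>i. integrable M (f i)" "\<And>x. x \<in> space M \<Longrightarrow> mono (\<lambda>i. f i x)"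
    "\<And>x. x \<in> space M \<Longrightarrow> (\<lambda>i. f i x) \<longlonglongrightarrow> g x" "g \<in> borel_measurable M" "\<And>i. (\<integral>x. f i x \<partial>M) \<le> B"
  shows "integrable M g" "(\<integral>x. g x \<partial>M) \<le> B"
proof -
  have "incseq (\<lambda>i. \<integral>x. f i x \<partial>M)"
    unfolding incseq_def using assms(1,2) by (auto intro!: integral_mono simp: mono_def)
  then obtain L where L: "(\<lambda>i. \<integral>x. f i x \<partial>M) \<longlonglongrightarrow> L"
    using incseq_convergent[of _ B] assms(5) by blast
  note mc = assms(1) AE_I2[of M, OF assms(2)] AE_I2[of M, OF assms(3)] L assms(4)
  show "integrable M g" by (rule integrable_monotone_convergence[OF mc])
  have "(\<integral>x. g x \<partial>M) = L" by (rule integral_monotone_convergence[OF mc])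
  then show "(\<integral>x. g x \<partial>M) \<le> B" using LIMSEQ_le_const2[OF L, of B] assms(5) by auto
qed

text \<open>
  The data that remain of the queues: \<open>\<mu> n\<close> is the law of what an arriving customer meets, the workload
  in the first and the left limit in the second component, both scaled by \<open>sqrt n\<close>. The last assumption
  is its invariance under the one-customer transition. Existence of \<open>x0\<close> and \<open>\<delta>\<close> is the stability
  condition: the drift is eventually negative for large workloads.
\<close>

locale heavy_traffic = prob_space M for M :: "'a measure" +
  fixes u v :: "'a \<Rightarrow> real" and d :: "nat \<Rightarrow> 'a \<Rightarrow> real" and F :: "nat \<Rightarrow> real \<Rightarrow> real"
    and H :: "real \<Rightarrow> real" and srv :: "nat \<Rightarrow> real" and \<mu> :: "nat \<Rightarrow> (real \<times> real) measure"
    and lam \<theta> p m C x0 \<delta> :: real and n0 :: nat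
  assumes u_meas [measurable]: "u \<in> borel_measurable M" and v_meas [measurable]: "v \<in> borel_measurable M"
    and d_meas: "\<And>n. n0 \<le> n \<Longrightarrow> d n \<in> borel_measurable M"
    and uv_nonneg: "AE \<omega> in M. 0 \<le> u \<omega> \<and> 0 \<le> v \<omega>"
    and p2: "2 < p" and up: "integrable M (\<lambda>\<omega>. u \<omega> powr p)" and vp: "integrable M (\<lambda>\<omega>. v \<omega> powr p)"
    and u_mean: "(\<integral>\<omega>. u \<omega> \<partial>M) = 1" and v_mean: "(\<integral>\<omega>. v \<omega> \<partial>M) = 1"
    and patience: "\<And>n l. n0 \<le> n \<Longrightarrow> (\<integral>\<omega>. v \<omega> * of_bool (l < d n \<omega>) \<partial>M) = 1 - F n l"
      "\<And>n l. n0 \<le> n \<Longrightarrow> (\<integral>\<omega>. (v \<omega>)\<^sup>2 * of_bool (l < d n \<omega>) \<partial>M) = (1 - F n l) * (\<integral>\<omega>. (v \<omega>)\<^sup>2 \<partial>M)"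
      "\<And>n l. n0 \<le> n \<Longrightarrow> (\<integral>\<omega>. u \<omega> * (v \<omega> * of_bool (l < d n \<omega>)) \<partial>M) = 1 - F n l"
    and F_mono: "\<And>n. n0 \<le> n \<Longrightarrow> mono (F n)" and F_nonneg: "\<And>n x. n0 \<le> n \<Longrightarrow> 0 \<le> F n x"
    and F_le_1: "\<And>n x. n0 \<le> n \<Longrightarrow> F n x \<le> 1"
    and n0: "1 \<le> n0" and lam: "0 < lam" and srv: "\<And>n. n0 \<le> n \<Longrightarrow> 0 < srv n"
    and srv_lim: "(\<lambda>n. srv n / real n) \<longlonglongrightarrow> lam"
    and \<theta>_lim: "(\<lambda>n. sqrt (real n) * (lam - srv n / real n)) \<longlonglongrightarrow> \<theta>"
    and m: "0 < m" "m < p - 1" and C: "0 < C"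
    and growth: "\<And>n x. n0 \<le> n \<Longrightarrow> 0 \<le> x \<Longrightarrow> sqrt (real n) * F n (x / sqrt (real n)) \<le> C * (1 + x powr m)"
    and unif: "\<And>K. 0 < K \<Longrightarrow> uniform_limit {0..K} (\<lambda>n x. sqrt (real n) * F n (x / sqrt (real n))) H sequentially"
    and H_cont: "continuous_on {0..} H"
    and x0: "0 \<le> x0" "0 < \<delta>" "\<theta> / lam + \<delta> \<le> H x0"
    and mu_prob: "\<And>n. n0 \<le> n \<Longrightarrow> prob_space (\<mu> n)" and mu_sets: "\<And>n. n0 \<le> n \<Longrightarrow> sets (\<mu> n) = sets borel"
    and mu_states: "\<And>n. n0 \<le> n \<Longrightarrow> AE x in \<mu> n. 0 \<le> snd x \<and> snd x \<le> fst x"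
    and mu_invariant: "\<And>n. n0 \<le> n \<Longrightarrow> distr (\<mu> n \<Otimes>\<^sub>M M) borel
       (\<lambda>q. let w = max 0 (fst (fst q) + (sqrt (real n) / srv n * v (snd q) * of_bool (snd (fst q) / sqrt (real n) < d n (snd q))
            - 1 / (lam * sqrt (real n)) * u (snd q)))
          in (w, if 0 < u (snd q) then w else snd (fst q))) = \<mu> n"
begin

text \<open>
  The scaled net input brought by one customer who finds the left limit \<open>l\<close>, before reflection at zero.
\<close>

definition D :: "nat \<Rightarrow> real \<Rightarrow> 'a \<Rightarrow> real" where
  "D n l \<omega> = sqrt (real n) / srv n * v \<omega> * of_bool (l / sqrt (real n) < d n \<omega>) - 1 / (lam * sqrt (real n)) * u \<omega>"

definition nxt :: "nat \<Rightarrow> real \<times> real \<Rightarrow> 'a \<Rightarrow> real \<times> real" where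
  "nxt n x \<omega> = (let w = max 0 (fst x + D n (snd x) \<omega>) in (w, if 0 < u \<omega> then w else snd x))"

definition Fh :: "nat \<Rightarrow> real \<Rightarrow> real" where
  "Fh n x = sqrt (real n) * F n (x / sqrt (real n))"

definition X :: "'a \<Rightarrow> real" where "X \<omega> = u \<omega> + v \<omega>"

definition r :: "nat \<Rightarrow> real" where "r n = real n * lam / srv n"

definition excess :: "nat \<Rightarrow> real" where "excess n = sqrt (real n) * (r n - 1)"

lemma sqrt_n: "n0 \<le> n \<Longrightarrow> 1 \<le> sqrt (real n)" "n0 \<le> n \<Longrightarrow> 0 < real n"
  using n0 by auto

lemma X_meas [measurable]: "X \<in> borel_measurable M" unfolding X_def[abs_def] by measurable

lemma X_nonneg: "AE \<omega> in M. 0 \<le> X \<omega>" using uv_nonneg by eventually_elim (simp add: X_def)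

lemma X_moment: "0 \<le> q \<Longrightarrow> q \<le> p \<Longrightarrow> integrable M (\<lambda>\<omega>. X \<omega> powr q)"
proof (rule Bochner_Integration.integrable_bound)
  assume q: "0 \<le> q" "q \<le> p"
  show "integrable M (\<lambda>\<omega>. 1 + (2 powr p * u \<omega> powr p + 2 powr p * v \<omega> powr p))"
    by (intro Bochner_Integration.integrable_add integrable_const integrable_mult_right up vp)
  show "AE \<omega> in M. norm (X \<omega> powr q) \<le> norm (1 + (2 powr p * u \<omega> powr p + 2 powr p * v \<omega> powr p))"
    using uv_nonneg
  proof eventually_elim
    case (elim \<omega>)
    have "X \<omega> powr q \<le> 1 + X \<omega> powr p" using elim q by (intro powr_le_one_add) (auto simp: X_def)
    also have "X \<omega> powr p \<le> (1 + 1) powr p * u \<omega> powr p + (1 + 1 / 1) powr p * v \<omega> powr p"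
      unfolding X_def using elim p2 by (intro powr_add_le_split) auto
    finally show ?case by simp
  qed
qed measurable

lemma integrable_by_X:
  assumes [measurable]: "f \<in> borel_measurable M" and "0 \<le> q" "q \<le> p"
    and "AE \<omega> in M. \<bar>f \<omega>\<bar> \<le> c * X \<omega> powr q"
  shows "integrable M f"
proof (rule Bochner_Integration.integrable_bound)
  show "integrable M (\<lambda>\<omega>. c * X \<omega> powr q)" using X_moment assms by simp
  show "AE \<omega> in M. norm (f \<omega>) \<le> norm (c * X \<omega> powr q)" using assms(4) by eventually_elim auto
qed measurable

lemma integrable_X: "integrable M X"
  by (rule integrable_by_X[where q = 1 and c = 1]) (use p2 X_nonneg in \<open>auto elim!: eventually_mono\<close>)

lemma integrable_X2: "integrable M (\<lambda>\<omega>. (X \<omega>)\<^sup>2)"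
  by (rule integrable_by_X[where q = 2 and c = 1]) (use p2 X_nonneg in \<open>auto elim!: eventually_mono simp: powr_numeral\<close>)

lemma integrable_uv: "integrable M u" "integrable M v" "integrable M (\<lambda>\<omega>. (u \<omega>)\<^sup>2)" "integrable M (\<lambda>\<omega>. (v \<omega>)\<^sup>2)"
   "integrable M (\<lambda>\<omega>. u \<omega> * v \<omega>)"
proof -
  have "AE \<omega> in M. \<bar>u \<omega>\<bar> \<le> 1 * X \<omega> powr 1" "AE \<omega> in M. \<bar>v \<omega>\<bar> \<le> 1 * X \<omega> powr 1"
    using uv_nonneg by (eventually_elim, simp add: X_def)+
  then show "integrable M u" "integrable M v" using p2 by (auto intro!: integrable_by_X[where q = 1 and c = 1])
  have "AE \<omega> in M. \<bar>(u \<omega>)\<^sup>2\<bar> \<le> 1 * X \<omega> powr 2" "AE \<omega> in M. \<bar>(v \<omega>)\<^sup>2\<bar> \<le> 1 * X \<omega> powr 2" "AE \<omega> in M. \<bar>u \<omega> * v \<omega>\<bar> \<le> 1 * X \<omega> powr 2"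
    using uv_nonneg by (eventually_elim, simp add: X_def powr_numeral power2_sum)+
  then show "integrable M (\<lambda>\<omega>. (u \<omega>)\<^sup>2)" "integrable M (\<lambda>\<omega>. (v \<omega>)\<^sup>2)" "integrable M (\<lambda>\<omega>. u \<omega> * v \<omega>)"
    using p2 by (auto intro!: integrable_by_X[where q = 2 and c = 1])
qed

lemma r_lim: "r \<longlonglongrightarrow> 1"
proof -
  have "(\<lambda>n. lam / (srv n / real n)) \<longlonglongrightarrow> lam / lam" by (intro tendsto_divide srv_lim) (use lam in auto)
  moreover have "lam / (srv n / real n) = r n" for n by (simp add: r_def)
  ultimately show ?thesis using lam by simp
qed

lemma excess_lim: "excess \<longlonglongrightarrow> \<theta> / lam"
proof -
  have "(\<lambda>n. sqrt (real n) * (lam - srv n / real n) / (srv n / real n)) \<longlonglongrightarrow> \<theta> / lam"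
    by (intro tendsto_divide \<theta>_lim srv_lim) (use lam in auto)
  moreover have "\<forall>\<^sub>F n in sequentially. sqrt (real n) * (lam - srv n / real n) / (srv n / real n) = excess n"
    using eventually_ge_at_top[of n0]
  proof eventually_elim
    case (elim n)
    then show ?case using srv[of n] sqrt_n[of n] by (simp add: excess_def r_def field_simps)
  qed
  ultimately show ?thesis by (rule Lim_transform_eventually)
qed

lemma scale_bound:
  obtains c0 where "0 < c0" "1 / lam \<le> c0" "\<And>n. n0 \<le> n \<Longrightarrow> real n / srv n \<le> c0"
proof -
  have "Bseq r" using r_lim by (intro convergent_imp_Bseq convergentI)
  then obtain B where B: "\<And>n. \<bar>r n\<bar> \<le> B" unfolding Bseq_def by auto
  show ?thesis
  proof (rule that[of "(max 1 B) / lam"])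
    fix n assume "n0 \<le> n"
    have "real n / srv n = r n / lam" using lam by (simp add: r_def)
    also have "\<dots> \<le> max 1 B / lam" using B[of n] lam by (intro divide_right_mono) auto
    finally show "real n / srv n \<le> max 1 B / lam" .
  qed (use lam in \<open>auto simp: divide_right_mono\<close>)
qed

text \<open>
  A common bound for the scaled mean service and interarrival times; the rates \<open>srv n / n\<close> converge to \<open>lam > 0\<close>
  and are positive from \<open>n0\<close> on.
\<close>

definition c0 :: real where
  "c0 = (SOME c. 0 < c \<and> 1 / lam \<le> c \<and> (\<forall>n. n0 \<le> n \<longrightarrow> real n / srv n \<le> c))"

lemma c0: "0 < c0" "1 / lam \<le> c0" "n0 \<le> n \<Longrightarrow> real n / srv n \<le> c0"
proof -
  have "\<exists>c. 0 < c \<and> 1 / lam \<le> c \<and> (\<forall>n. n0 \<le> n \<longrightarrow> real n / srv n \<le> c)"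
    using scale_bound by metis
  from someI_ex[OF this] show "0 < c0" "1 / lam \<le> c0" "n0 \<le> n \<Longrightarrow> real n / srv n \<le> c0"
    unfolding c0_def by blast+
qed

lemma coeff_bound:
  assumes "n0 \<le> n"
  shows "0 \<le> sqrt (real n) / srv n" "sqrt (real n) / srv n \<le> c0 / sqrt (real n)"
    "0 \<le> 1 / (lam * sqrt (real n))" "1 / (lam * sqrt (real n)) \<le> c0 / sqrt (real n)"
proof -
  show "0 \<le> sqrt (real n) / srv n" "0 \<le> 1 / (lam * sqrt (real n))" using srv[OF assms] lam by auto
  have "sqrt (real n) / srv n = (real n / srv n) / sqrt (real n)"
    using real_div_sqrt[of "real n"] by (metis divide_divide_eq_left mult.commute of_nat_0_le_iff)
  also have "\<dots> \<le> c0 / sqrt (real n)" using c0(3)[OF assms] sqrt_n[OF assms] by (intro divide_right_mono) auto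
  finally show "sqrt (real n) / srv n \<le> c0 / sqrt (real n)" .
  have "1 / (lam * sqrt (real n)) = (1 / lam) / sqrt (real n)" by simp
  also have "\<dots> \<le> c0 / sqrt (real n)" using c0(2) sqrt_n[OF assms] by (intro divide_right_mono) auto
  finally show "1 / (lam * sqrt (real n)) \<le> c0 / sqrt (real n)" .
qed

lemma D_meas [measurable (raw)]:
  assumes n: "n0 \<le> n" and [measurable]: "f \<in> borel_measurable N" "g \<in> measurable N M"
  shows "(\<lambda>q. D n (f q) (g q)) \<in> borel_measurable N"
proof -
  note [measurable] = d_meas[OF n]
  show ?thesis unfolding D_def by measurable
qed

lemma nxt_meas [measurable (raw)]:
  assumes n: "n0 \<le> n" and [measurable]: "f \<in> borel_measurable N" "g \<in> measurable N M"
  shows "(\<lambda>q. nxt n (f q) (g q)) \<in> borel_measurable N"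
proof -
  have [measurable]: "(\<lambda>q. D n (snd (f q)) (g q)) \<in> borel_measurable N" by (rule D_meas[OF n]) measurable
  show ?thesis unfolding nxt_def Let_def by measurable
qed

lemma D_bound:
  assumes n: "n0 \<le> n" and uv: "0 \<le> u \<omega>" "0 \<le> v \<omega>"
  shows "\<bar>D n l \<omega>\<bar> \<le> c0 / sqrt (real n) * X \<omega>"
    and "- D n l \<omega> \<le> c0 / sqrt (real n) * u \<omega>"
    and "D n l \<omega> \<le> c0 / sqrt (real n) * v \<omega>"
proof -
  note cb = coeff_bound[OF n]
  have 1: "0 \<le> sqrt (real n) / srv n * v \<omega> * of_bool (l / sqrt (real n) < d n \<omega>)"
      "sqrt (real n) / srv n * v \<omega> * of_bool (l / sqrt (real n) < d n \<omega>) \<le> c0 / sqrt (real n) * v \<omega>"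
    using cb uv mult_right_mono[OF cb(2) uv(2)] mult_nonneg_nonneg[OF cb(1) uv(2)] by auto
  have 2: "0 \<le> 1 / (lam * sqrt (real n)) * u \<omega>" "1 / (lam * sqrt (real n)) * u \<omega> \<le> c0 / sqrt (real n) * u \<omega>"
    using mult_right_mono[OF cb(4) uv(1)] mult_nonneg_nonneg[OF cb(3) uv(1)] by auto
  have X: "c0 / sqrt (real n) * X \<omega> = c0 / sqrt (real n) * u \<omega> + c0 / sqrt (real n) * v \<omega>"
    by (simp add: X_def algebra_simps add_divide_distrib)
  show "\<bar>D n l \<omega>\<bar> \<le> c0 / sqrt (real n) * X \<omega>" using 1 2 unfolding D_def X by (auto simp: abs_le_iff)
  show "- D n l \<omega> \<le> c0 / sqrt (real n) * u \<omega>" "D n l \<omega> \<le> c0 / sqrt (real n) * v \<omega>"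
    using 1 2 unfolding D_def by auto
qed

lemma AE_D_bound: "n0 \<le> n \<Longrightarrow> AE \<omega> in M. \<bar>D n l \<omega>\<bar> \<le> c0 / sqrt (real n) * X \<omega>"
  using uv_nonneg by eventually_elim (rule D_bound(1), auto)

lemma integrable_D:
  assumes n: "n0 \<le> n"
  shows "integrable M (D n l)"
  by (rule integrable_by_X[where q = 1 and c = "c0 / sqrt (real n)"])
    (use AE_D_bound[OF n, of l] X_nonneg p2 in \<open>auto intro!: D_meas[OF n] elim: eventually_elim2\<close>)

lemma D_mean:
  assumes n: "n0 \<le> n"
  shows "real n * (\<integral>\<omega>. D n l \<omega> \<partial>M) = (excess n - r n * Fh n l) / lam"
proof -
  note [measurable] = d_meas[OF n]
  have int: "integrable M (\<lambda>\<omega>. v \<omega> * of_bool (l / sqrt (real n) < d n \<omega>))"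
    by (rule Bochner_Integration.integrable_bound[OF integrable_uv(2)]) auto
  have calc: "(\<integral>\<omega>. D n l \<omega> \<partial>M) = sqrt (real n) / srv n * (1 - F n (l / sqrt (real n))) - 1 / (lam * sqrt (real n))"
    unfolding D_def mult.assoc using int integrable_uv by (simp add: patience[OF n] u_mean)
  define q where "q = sqrt (real n)"
  have q: "0 < q" "real n = q * q" using sqrt_n[OF n] by (auto simp: q_def)
  have "(\<integral>\<omega>. D n l \<omega> \<partial>M) = q / srv n * (1 - F n (l / q)) - 1 / (lam * q)"
    unfolding calc by (simp add: q_def)
  note E = this
  show ?thesis
    unfolding E excess_def r_def Fh_def q_def[symmetric] q(2)
    using q(1) srv[OF n] lam by (simp add: field_simps)
qed

definition U2 :: real where "U2 = (\<integral>\<omega>. (u \<omega>)\<^sup>2 \<partial>M)"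
definition V2 :: real where "V2 = (\<integral>\<omega>. (v \<omega>)\<^sup>2 \<partial>M)"

text \<open>
  The leading term tends to \<open>(U2 + V2 - 2) / lam\<^sup>2\<close>, and \<open>U2 + V2 - 2\<close> is the sum of the variances of
  \<open>u\<close> and \<open>v\<close>, whose means are 1.
\<close>

lemma D_square_mean:
  assumes n: "n0 \<le> n"
  shows "real n * (\<integral>\<omega>. (D n l \<omega>)\<^sup>2 \<partial>M) =
    ((r n)\<^sup>2 * V2 - 2 * r n + U2) / lam\<^sup>2 - F n (l / sqrt (real n)) * (((r n)\<^sup>2 * V2 - 2 * r n) / lam\<^sup>2)"
proof -
  note [measurable] = d_meas[OF n]
  define a b where "a = sqrt (real n) / srv n" and "b = 1 / (lam * sqrt (real n))"
  define I :: "'a \<Rightarrow> real" where "I \<omega> = of_bool (l / sqrt (real n) < d n \<omega>)" for \<omega>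
  have [measurable]: "I \<in> borel_measurable M" unfolding I_def[abs_def] by measurable
  have int: "integrable M (\<lambda>\<omega>. (v \<omega>)\<^sup>2 * I \<omega>)" "integrable M (\<lambda>\<omega>. u \<omega> * (v \<omega> * I \<omega>))"
    by (rule Bochner_Integration.integrable_bound[OF integrable_uv(4)], auto simp: I_def)
      (rule Bochner_Integration.integrable_bound[OF integrable_uv(5)], auto simp: I_def)
  have "(D n l \<omega>)\<^sup>2 = a\<^sup>2 * ((v \<omega>)\<^sup>2 * I \<omega>) - 2 * a * b * (u \<omega> * (v \<omega> * I \<omega>)) + b\<^sup>2 * (u \<omega>)\<^sup>2" for \<omega>
    unfolding D_def a_def[symmetric] b_def[symmetric] I_def by (simp add: power2_eq_square algebra_simps)
  then have calc: "(\<integral>\<omega>. (D n l \<omega>)\<^sup>2 \<partial>M) = a\<^sup>2 * ((1 - F n (l / sqrt (real n))) * V2) - 2 * a * b * (1 - F n (l / sqrt (real n))) + b\<^sup>2 * U2"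
    using int integrable_uv by (simp add: I_def patience[OF n] U2_def V2_def)
  have n_ab: "real n * a\<^sup>2 = (r n)\<^sup>2 / lam\<^sup>2" "real n * (a * b) = r n / lam\<^sup>2" "real n * b\<^sup>2 = 1 / lam\<^sup>2"
    using sqrt_n[OF n] lam srv[OF n]
    by (simp_all add: a_def b_def r_def power_divide power_mult_distrib) (simp_all add: power2_eq_square field_simps)
  have "real n * (a\<^sup>2 * ((1 - F n (l / sqrt (real n))) * V2) - 2 * a * b * (1 - F n (l / sqrt (real n))) + b\<^sup>2 * U2) =
     (real n * a\<^sup>2) * ((1 - F n (l / sqrt (real n))) * V2) - 2 * (real n * (a * b)) * (1 - F n (l / sqrt (real n))) + (real n * b\<^sup>2) * U2"
    by (simp add: algebra_simps)
  then show ?thesis unfolding calc n_ab by (simp add: algebra_simps diff_divide_distrib add_divide_distrib)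
qed

lemma integrable_D_square:
  assumes n: "n0 \<le> n"
  shows "integrable M (\<lambda>\<omega>. (D n l \<omega>)\<^sup>2)"
    and "real n * (\<integral>\<omega>. (D n l \<omega>)\<^sup>2 \<partial>M) \<le> c0\<^sup>2 * (\<integral>\<omega>. (X \<omega>)\<^sup>2 \<partial>M)"
proof -
  have ae: "AE \<omega> in M. (D n l \<omega>)\<^sup>2 \<le> c0\<^sup>2 / real n * (X \<omega>)\<^sup>2"
    using AE_D_bound[OF n, of l]
  proof eventually_elim
    case (elim \<omega>)
    have "(D n l \<omega>)\<^sup>2 \<le> (c0 / sqrt (real n) * X \<omega>)\<^sup>2" using power_mono[OF elim, of 2] by simp
    then show ?case by (simp add: power_mult_distrib power_divide)
  qed
  have [measurable]: "D n l \<in> borel_measurable M" by (rule D_meas[OF n]) measurable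
  show i: "integrable M (\<lambda>\<omega>. (D n l \<omega>)\<^sup>2)"
    by (rule Bochner_Integration.integrable_bound[of _ "\<lambda>\<omega>. c0\<^sup>2 / real n * (X \<omega>)\<^sup>2"])
      (use ae integrable_X2 in \<open>auto elim!: eventually_mono\<close>)
  have "(\<integral>\<omega>. (D n l \<omega>)\<^sup>2 \<partial>M) \<le> (\<integral>\<omega>. c0\<^sup>2 / real n * (X \<omega>)\<^sup>2 \<partial>M)"
    by (intro integral_mono_AE i ae integrable_mult_right integrable_X2)
  then have "real n * (\<integral>\<omega>. (D n l \<omega>)\<^sup>2 \<partial>M) \<le> real n * (c0\<^sup>2 / real n * (\<integral>\<omega>. (X \<omega>)\<^sup>2 \<partial>M))"
    by (intro mult_left_mono) auto
  then show "real n * (\<integral>\<omega>. (D n l \<omega>)\<^sup>2 \<partial>M) \<le> c0\<^sup>2 * (\<integral>\<omega>. (X \<omega>)\<^sup>2 \<partial>M)" using sqrt_n[OF n] by simp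
qed

lemma integrable_D_powr:
  assumes n: "n0 \<le> n"
  shows "integrable M (\<lambda>\<omega>. \<bar>D n l \<omega>\<bar> powr p)"
    and "real n * (\<integral>\<omega>. \<bar>D n l \<omega>\<bar> powr p \<partial>M) \<le> c0 powr p * (\<integral>\<omega>. X \<omega> powr p \<partial>M) * (sqrt (real n)) powr (2 - p)"
proof -
  have ae: "AE \<omega> in M. \<bar>D n l \<omega>\<bar> powr p \<le> (c0 / sqrt (real n)) powr p * X \<omega> powr p"
    using AE_D_bound[OF n, of l] X_nonneg
  proof eventually_elim
    case (elim \<omega>)
    have "\<bar>D n l \<omega>\<bar> powr p \<le> (c0 / sqrt (real n) * X \<omega>) powr p" using elim p2 by (intro powr_mono2) auto
    also have "\<dots> = (c0 / sqrt (real n)) powr p * X \<omega> powr p" using elim c0(1) by (subst powr_mult) auto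
    finally show ?case .
  qed
  have [measurable]: "D n l \<in> borel_measurable M" by (rule D_meas[OF n]) measurable
  have iX: "integrable M (\<lambda>\<omega>. X \<omega> powr p)" using p2 by (intro X_moment) auto
  show i: "integrable M (\<lambda>\<omega>. \<bar>D n l \<omega>\<bar> powr p)"
    by (rule Bochner_Integration.integrable_bound[of _ "\<lambda>\<omega>. (c0 / sqrt (real n)) powr p * X \<omega> powr p"])
      (use ae iX in \<open>auto elim!: eventually_mono\<close>)
  have "(\<integral>\<omega>. \<bar>D n l \<omega>\<bar> powr p \<partial>M) \<le> (\<integral>\<omega>. (c0 / sqrt (real n)) powr p * X \<omega> powr p \<partial>M)"
    by (intro integral_mono_AE i ae integrable_mult_right iX)
  then have "real n * (\<integral>\<omega>. \<bar>D n l \<omega>\<bar> powr p \<partial>M) \<le> real n * ((c0 / sqrt (real n)) powr p * (\<integral>\<omega>. X \<omega> powr p \<partial>M))"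
    by (intro mult_left_mono) auto
  also have "\<dots> = c0 powr p * (\<integral>\<omega>. X \<omega> powr p \<partial>M) * (real n / sqrt (real n) powr p)"
    using c0 sqrt_n[OF n] by (simp add: powr_divide)
  also have "real n / sqrt (real n) powr p = (sqrt (real n)) powr (2 - p)"
    using sqrt_n[OF n] by (simp add: powr_diff powr_numeral)
  finally show "real n * (\<integral>\<omega>. \<bar>D n l \<omega>\<bar> powr p \<partial>M) \<le> c0 powr p * (\<integral>\<omega>. X \<omega> powr p \<partial>M) * (sqrt (real n)) powr (2 - p)" .
qed

lemma stationarity:
  fixes f :: "real \<times> real \<Rightarrow> real"
  assumes n: "n0 \<le> n" and int: "integrable (\<mu> n) f"
  shows "(\<integral>x. f x \<partial>\<mu> n) = (\<integral>x. (\<integral>\<omega>. f (nxt n x \<omega>) \<partial>M) \<partial>\<mu> n)"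
    and "AE x in \<mu> n. integrable M (\<lambda>\<omega>. f (nxt n x \<omega>))"
    and "integrable (\<mu> n) (\<lambda>x. \<integral>\<omega>. f (nxt n x \<omega>) \<partial>M)"
proof -
  interpret mu: prob_space "\<mu> n" by (rule mu_prob[OF n])
  interpret P: pair_prob_space "\<mu> n" M ..
  note [measurable_cong] = mu_sets[OF n]
  have [measurable]: "fst \<in> borel_measurable (\<mu> n \<Otimes>\<^sub>M M)"
    using measurable_fst[of "\<mu> n" M] by (simp cong: measurable_cong_sets add: mu_sets[OF n])
  have mT [measurable]: "(\<lambda>q. nxt n (fst q) (snd q)) \<in> borel_measurable (\<mu> n \<Otimes>\<^sub>M M)"
    by (rule nxt_meas[OF n]) measurable
  have inv: "distr (\<mu> n \<Otimes>\<^sub>M M) borel (\<lambda>q. nxt n (fst q) (snd q)) = \<mu> n"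
    using mu_invariant[OF n] unfolding nxt_def D_def .
  have [measurable]: "f \<in> borel_measurable borel"
    using borel_measurable_integrable[OF int] by (simp cong: measurable_cong_sets add: mu_sets[OF n])
  have i: "integrable (\<mu> n \<Otimes>\<^sub>M M) (\<lambda>q. f (nxt n (fst q) (snd q)))"
  proof -
    have "integrable (distr (\<mu> n \<Otimes>\<^sub>M M) borel (\<lambda>q. nxt n (fst q) (snd q))) f" unfolding inv by (rule int)
    from integrable_distr[OF mT this] show ?thesis .
  qed
  have "(\<integral>x. f x \<partial>\<mu> n) = (\<integral>q. f (nxt n (fst q) (snd q)) \<partial>(\<mu> n \<Otimes>\<^sub>M M))"
    by (subst inv[symmetric], subst integral_distr) auto
  also have "\<dots> = (\<integral>x. (\<integral>\<omega>. f (nxt n x \<omega>) \<partial>M) \<partial>\<mu> n)"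
    using P.integral_fst'[OF i] by simp
  finally show "(\<integral>x. f x \<partial>\<mu> n) = (\<integral>x. (\<integral>\<omega>. f (nxt n x \<omega>) \<partial>M) \<partial>\<mu> n)" .
  show "AE x in \<mu> n. integrable M (\<lambda>\<omega>. f (nxt n x \<omega>))" using P.AE_integrable_fst'[OF i] by simp
  show "integrable (\<mu> n) (\<lambda>x. \<integral>\<omega>. f (nxt n x \<omega>) \<partial>M)" using P.integrable_fst'[OF i] by simp
qed

end

section \<open>Uniform moment bounds\<close>

context heavy_traffic
begin

definition P0 :: real where "P0 = (\<integral>\<omega>. of_bool (u \<omega> \<le> 0) \<partial>M)"

lemma P0: "0 \<le> P0" "P0 < 1"
proof -
  have i: "integrable M (\<lambda>\<omega>. of_bool (u \<omega> \<le> 0) :: real)"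
    by (rule integrable_const_bound[where B = 1]) auto
  show "0 \<le> P0" unfolding P0_def by (rule Bochner_Integration.integral_nonneg) simp
  have le: "P0 \<le> (\<integral>\<omega>. 1 \<partial>M)" unfolding P0_def by (intro integral_mono i) auto
  show "P0 < 1"
  proof (rule ccontr)
    assume "\<not> P0 < 1"
    then have "P0 = 1" using le by (simp add: prob_space)
    then have "(\<integral>\<omega>. 1 - of_bool (u \<omega> \<le> 0) \<partial>M) = (0::real)"
      using i by (simp add: P0_def prob_space)
    then have "AE \<omega> in M. 1 - of_bool (u \<omega> \<le> 0) = (0::real)"
      using i by (subst (asm) integral_nonneg_eq_0_iff_AE) auto
    then have "AE \<omega> in M. u \<omega> = 0" using uv_nonneg by eventually_elim (auto split: if_splits)
    then have "(\<integral>\<omega>. u \<omega> \<partial>M) = (\<integral>\<omega>. 0 \<partial>M)" by (intro integral_cong_AE) auto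
    then show False using u_mean by simp
  qed
qed

lemma mu_integrable_bounded:
  fixes f :: "real \<times> real \<Rightarrow> real"
  assumes n: "n0 \<le> n" and [measurable]: "f \<in> borel_measurable borel" and "\<And>x. \<bar>f x\<bar> \<le> B"
  shows "integrable (\<mu> n) f"
proof -
  interpret mu: prob_space "\<mu> n" by (rule mu_prob[OF n])
  show ?thesis
    by (rule mu.integrable_const_bound[where B = B]) (use assms in \<open>auto simp: mu_sets[OF n] cong: measurable_cong_sets\<close>)
qed

lemma mu_meas:
  assumes "n0 \<le> n" "f \<in> borel_measurable borel"
  shows "f \<in> borel_measurable (\<mu> n)"
  using assms(2) by (simp add: mu_sets[OF assms(1)] cong: measurable_cong_sets)

text \<open>
  The gap between workload and left limit is work admitted since the present batch began. It is reset to
  zero unless the next interarrival time vanishes, which has probability below 1, and it grows by at most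
  one service time otherwise. Invariance therefore gives a contraction inequality for its moment, with an
  additive term of the order of one scaled service time.
\<close>

lemma batch_moment:
  obtains KB where "0 \<le> KB" "\<And>n. n0 \<le> n \<Longrightarrow> integrable (\<mu> n) (\<lambda>x. (max 0 (fst x - snd x)) powr (p - 1))"
    "\<And>n. n0 \<le> n \<Longrightarrow> (\<integral>x. (max 0 (fst x - snd x)) powr (p - 1) \<partial>\<mu> n) \<le> KB * (1 / sqrt (real n)) powr (p - 1)"
proof -
  define s where "s = p - 1"
  have s: "1 < s" "s \<le> p" using p2 by (auto simp: s_def)
  have "((\<lambda>\<eta>. P0 * (1 + \<eta>) powr s) \<longlongrightarrow> P0 * (1 + 0) powr s) (at_right 0)"
    by (intro tendsto_intros tendsto_powr) auto
  then have "\<forall>\<^sub>F \<eta> in at_right 0. P0 * (1 + \<eta>) powr s < 1"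
    by (rule order_tendstoD) (use P0 in simp)
  then have "\<forall>\<^sub>F \<eta> in at_right 0. P0 * (1 + \<eta>) powr s < 1 \<and> 0 < \<eta>"
    using eventually_at_right_less[of "0::real"] by eventually_elim simp
  then obtain \<eta> where \<eta>: "P0 * (1 + \<eta>) powr s < 1" "0 < \<eta>"
    using eventually_happens by fastforce
  define q where "q = P0 * (1 + \<eta>) powr s"
  define A where "A = (1 + 1 / \<eta>) powr s * c0 powr s * (\<integral>\<omega>. X \<omega> powr s \<partial>M)"
  have A: "0 \<le> A" unfolding A_def by (intro mult_nonneg_nonneg) auto
  define f where "f K x = (min (max 0 (fst x - snd x)) (real K)) powr s" for K and x :: "real \<times> real"
  have [measurable]: "f K \<in> borel_measurable borel" for K unfolding f_def[abs_def] by measurable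
  have f_bd: "\<bar>f K x\<bar> \<le> real K powr s" for K x unfolding f_def using s by (simp add: powr_mono2)
  have iX: "integrable M (\<lambda>\<omega>. X \<omega> powr s)" using s by (intro X_moment) auto
  have bound: "(\<integral>x. f K x \<partial>\<mu> n) \<le> A / (1 - q) * (1 / sqrt (real n)) powr s" if n: "n0 \<le> n" for n K
  proof -
    interpret mu: prob_space "\<mu> n" by (rule mu_prob[OF n])
    have i: "integrable (\<mu> n) (f K)" by (rule mu_integrable_bounded[OF n _ f_bd]) measurable
    define cn where "cn = c0 / sqrt (real n)"
    have cn: "0 \<le> cn" using c0 by (simp add: cn_def)
    have step: "f K (nxt n x \<omega>) \<le> of_bool (u \<omega> \<le> 0) * ((1 + \<eta>) powr s * f K x) + (1 + 1 / \<eta>) powr s * cn powr s * X \<omega> powr s"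
      if x: "0 \<le> snd x" "snd x \<le> fst x" and uv: "0 \<le> u \<omega>" "0 \<le> v \<omega>" for x \<omega>
    proof (cases "0 < u \<omega>")
      case True
      then have "f K (nxt n x \<omega>) = 0" using s by (simp add: f_def nxt_def Let_def)
      then show ?thesis using True by simp
    next
      case False
      have Xv: "cn * v \<omega> \<le> cn * X \<omega>" using uv cn by (intro mult_left_mono) (auto simp: X_def)
      have "D n (snd x) \<omega> \<le> cn * X \<omega>" using D_bound(3)[OF n uv, of "snd x"] Xv by (simp add: cn_def)
      moreover have "0 \<le> cn * X \<omega>" using uv cn by (intro mult_nonneg_nonneg) (auto simp: X_def)
      ultimately have "min (max 0 (fst (nxt n x \<omega>) - snd (nxt n x \<omega>))) (real K) \<le> min (max 0 (fst x - snd x)) (real K) + cn * X \<omega>"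
        using False x by (auto simp: nxt_def Let_def)
      then have "f K (nxt n x \<omega>) \<le> (min (max 0 (fst x - snd x)) (real K) + cn * X \<omega>) powr s"
        unfolding f_def using s by (intro powr_mono2) auto
      also have "\<dots> \<le> (1 + \<eta>) powr s * f K x + (1 + 1 / \<eta>) powr s * (cn * X \<omega>) powr s"
        unfolding f_def using \<open>0 \<le> cn * X \<omega>\<close> s \<eta> by (intro powr_add_le_split) auto
      also have "(cn * X \<omega>) powr s = cn powr s * X \<omega> powr s" by (rule powr_mult)
      finally show ?thesis using False uv by simp
    qed
    have inner: "(\<integral>\<omega>. f K (nxt n x \<omega>) \<partial>M) \<le> q * f K x + A * (1 / sqrt (real n)) powr s"
      if x: "0 \<le> snd x" "snd x \<le> fst x" for x
    proof -
      have "integrable M (\<lambda>\<omega>. f K (nxt n x \<omega>))"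
      proof (rule integrable_const_bound)
        show "AE \<omega> in M. norm (f K (nxt n x \<omega>)) \<le> real K powr s" using f_bd by simp
        have [measurable]: "nxt n x \<in> borel_measurable M" by (rule nxt_meas[OF n]) measurable
        show "(\<lambda>\<omega>. f K (nxt n x \<omega>)) \<in> borel_measurable M" by measurable
      qed
      moreover have iP: "integrable M (\<lambda>\<omega>. of_bool (u \<omega> \<le> 0) :: real)"
        by (rule integrable_const_bound[where B = 1]) auto
      ultimately have "(\<integral>\<omega>. f K (nxt n x \<omega>) \<partial>M) \<le>
          (\<integral>\<omega>. of_bool (u \<omega> \<le> 0) * ((1 + \<eta>) powr s * f K x) + (1 + 1 / \<eta>) powr s * cn powr s * X \<omega> powr s \<partial>M)"
      proof (intro integral_mono_AE Bochner_Integration.integrable_add integrable_mult_left integrable_mult_right iX)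
        show "AE \<omega> in M. f K (nxt n x \<omega>) \<le> of_bool (u \<omega> \<le> 0) * ((1 + \<eta>) powr s * f K x) + (1 + 1 / \<eta>) powr s * cn powr s * X \<omega> powr s"
          using uv_nonneg by eventually_elim (rule step[OF x], auto)
      qed
      also have "\<dots> = P0 * ((1 + \<eta>) powr s * f K x) + (1 + 1 / \<eta>) powr s * cn powr s * (\<integral>\<omega>. X \<omega> powr s \<partial>M)"
        using iX iP by (subst Bochner_Integration.integral_add) (auto simp: P0_def)
      also have "cn powr s = c0 powr s * (1 / sqrt (real n)) powr s"
        unfolding cn_def using c0 by (subst powr_mult[symmetric]) auto
      finally show ?thesis by (simp add: q_def A_def mult_ac)
    qed
    have "(\<integral>x. f K x \<partial>\<mu> n) = (\<integral>x. (\<integral>\<omega>. f K (nxt n x \<omega>) \<partial>M) \<partial>\<mu> n)" by (rule stationarity(1)[OF n i])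
    also have "\<dots> \<le> (\<integral>x. q * f K x + A * (1 / sqrt (real n)) powr s \<partial>\<mu> n)"
    proof (rule integral_mono_AE)
      show "AE x in \<mu> n. (\<integral>\<omega>. f K (nxt n x \<omega>) \<partial>M) \<le> q * f K x + A * (1 / sqrt (real n)) powr s"
        using mu_states[OF n] by eventually_elim (rule inner, auto)
    qed (use i stationarity(3)[OF n i] in auto)
    also have "\<dots> = q * (\<integral>x. f K x \<partial>\<mu> n) + A * (1 / sqrt (real n)) powr s"
      using i by (simp add: mu.prob_space)
    finally have "(1 - q) * (\<integral>x. f K x \<partial>\<mu> n) \<le> A * (1 / sqrt (real n)) powr s" by (simp add: algebra_simps)
    then show ?thesis using \<eta>(1) by (simp add: q_def[symmetric] field_simps)
  qed
  have mono: "mono (\<lambda>K. f K x)" for x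
    unfolding f_def mono_def using s by (auto intro!: powr_mono2)
  have lim: "(\<lambda>K. f K x) \<longlonglongrightarrow> (max 0 (fst x - snd x)) powr s" for x
  proof (rule tendsto_eventually)
    obtain N :: nat where "max 0 (fst x - snd x) \<le> real N" using real_arch_simple by blast
    then show "\<forall>\<^sub>F K in sequentially. f K x = (max 0 (fst x - snd x)) powr s"
      unfolding f_def by (intro eventually_sequentiallyI[of N]) (auto simp: min_def)
  qed
  show ?thesis
  proof (rule that[of "A / (1 - q)"])
    show "0 \<le> A / (1 - q)" using A \<eta>(1) by (simp add: q_def)
    fix n assume n: "n0 \<le> n"
    have meas: "(\<lambda>x. (max 0 (fst x - snd x)) powr s) \<in> borel_measurable (\<mu> n)"
      by (rule mu_meas[OF n]) measurable
    have i: "integrable (\<mu> n) (f K)" for K by (rule mu_integrable_bounded[OF n _ f_bd]) measurable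
    show "integrable (\<mu> n) (\<lambda>x. (max 0 (fst x - snd x)) powr (p - 1))"
      "(\<integral>x. (max 0 (fst x - snd x)) powr (p - 1) \<partial>\<mu> n) \<le> A / (1 - q) * (1 / sqrt (real n)) powr (p - 1)"
      using integrable_by_truncation[where f = f and M = "\<mu> n" and g = "\<lambda>x. (max 0 (fst x - snd x)) powr s",
          OF i mono lim meas bound[OF n]]
      unfolding s_def by blast+
  qed
qed

lemma Fh_nonneg: "n0 \<le> n \<Longrightarrow> 0 \<le> Fh n x"
  using F_nonneg by (simp add: Fh_def)

lemma Fh_mono: "n0 \<le> n \<Longrightarrow> x \<le> y \<Longrightarrow> Fh n x \<le> Fh n y"
  unfolding Fh_def by (intro mult_left_mono monoD[OF F_mono] divide_right_mono) auto

lemma Fh_lim: "0 \<le> x \<Longrightarrow> (\<lambda>n. Fh n x) \<longlonglongrightarrow> H x"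
  using tendsto_uniform_limitI[OF unif[of "x + 1"], of x] by (simp add: Fh_def)

lemma r_nonneg: "n0 \<le> n \<Longrightarrow> 0 \<le> r n"
  using srv lam by (simp add: r_def less_imp_le)

text \<open>
  Monotonicity in the level makes the bounds uniform: the convergence at the single level \<open>x0\<close> suffices.
\<close>

lemma drift_bounds:
  obtains \<Theta> n1 where "0 \<le> \<Theta>" "n0 \<le> n1" "\<And>n l. n1 \<le> n \<Longrightarrow> excess n - r n * Fh n l \<le> \<Theta>"
    "\<And>n l. n1 \<le> n \<Longrightarrow> x0 \<le> l \<Longrightarrow> excess n - r n * Fh n l \<le> - \<delta> / 2"
proof -
  have "(\<lambda>n. excess n - r n * Fh n x0) \<longlonglongrightarrow> \<theta> / lam - 1 * H x0"
    by (intro tendsto_intros excess_lim r_lim Fh_lim x0)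
  then have "\<forall>\<^sub>F n in sequentially. excess n - r n * Fh n x0 < - \<delta> / 2"
    by (rule order_tendstoD) (use x0 in auto)
  moreover have "\<forall>\<^sub>F n in sequentially. excess n < max 0 (\<theta> / lam) + 1"
    by (rule order_tendstoD[OF excess_lim]) auto
  ultimately have "\<forall>\<^sub>F n in sequentially. n0 \<le> n \<and> excess n - r n * Fh n x0 < - \<delta> / 2 \<and> excess n < max 0 (\<theta> / lam) + 1"
    using eventually_ge_at_top[of n0] by eventually_elim auto
  then obtain n1 where n1: "\<And>n. n1 \<le> n \<Longrightarrow> n0 \<le> n \<and> excess n - r n * Fh n x0 < - \<delta> / 2 \<and> excess n < max 0 (\<theta> / lam) + 1"
    by (auto simp: eventually_sequentially)
  show ?thesis
  proof (rule that[of "max 0 (\<theta> / lam) + 1" n1])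
    fix n l assume n: "n1 \<le> n"
    have "0 \<le> r n * Fh n l" using n1[OF n] by (intro mult_nonneg_nonneg r_nonneg Fh_nonneg) auto
    then show "excess n - r n * Fh n l \<le> max 0 (\<theta> / lam) + 1" using n1[OF n] by auto
    assume "x0 \<le> l"
    then have "r n * Fh n x0 \<le> r n * Fh n l" using n1[OF n] by (intro mult_left_mono Fh_mono r_nonneg) auto
    then show "excess n - r n * Fh n l \<le> - \<delta> / 2" using n1[OF n] by auto
  qed (use n1 in auto)
qed

text \<open>
  The power \<open>w powr p\<close> is a Lyapunov function: its drift, multiplied by \<open>n\<close>, is at most
  \<open>- c1 * w powr (p - 1)\<close> plus a term in the batch gap and a constant, and invariance makes the mean drift
  vanish. The function is cut off at \<open>K\<close> in order to be integrable beforehand; above the cutoff it can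
  only decrease.
\<close>

lemma workload_moment:
  obtains KW n1 where "0 \<le> KW" "n0 \<le> n1" "\<And>n. n1 \<le> n \<Longrightarrow> integrable (\<mu> n) (\<lambda>x. (max 0 (fst x)) powr (p - 1))"
    "\<And>n. n1 \<le> n \<Longrightarrow> (\<integral>x. (max 0 (fst x)) powr (p - 1) \<partial>\<mu> n) \<le> KW"
proof -
  obtain KB where KB: "0 \<le> KB" "\<And>n. n0 \<le> n \<Longrightarrow> integrable (\<mu> n) (\<lambda>x. (max 0 (fst x - snd x)) powr (p - 1))"
    "\<And>n. n0 \<le> n \<Longrightarrow> (\<integral>x. (max 0 (fst x - snd x)) powr (p - 1) \<partial>\<mu> n) \<le> KB * (1 / sqrt (real n)) powr (p - 1)"
    using batch_moment by blast
  obtain \<Theta> n1 where dr: "0 \<le> \<Theta>" "n0 \<le> n1" "\<And>n l. n1 \<le> n \<Longrightarrow> excess n - r n * Fh n l \<le> \<Theta>"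
    "\<And>n l. n1 \<le> n \<Longrightarrow> x0 \<le> l \<Longrightarrow> excess n - r n * Fh n l \<le> - \<delta> / 2"
    using drift_bounds by blast
  define s where "s = p - 1"
  have s: "1 < s" "s \<le> p" using p2 by (auto simp: s_def)
  define cp where "cp = p * p * 2 powr p"
  have cp: "0 \<le> cp" using p2 by (simp add: cp_def)
  define E2 where "E2 = c0\<^sup>2 * (\<integral>\<omega>. (X \<omega>)\<^sup>2 \<partial>M)"
  define Ep where "Ep = c0 powr p * (\<integral>\<omega>. X \<omega> powr p \<partial>M)"
  have E: "0 \<le> E2" "0 \<le> Ep" unfolding E2_def Ep_def by (auto intro!: mult_nonneg_nonneg)
  \<comment> \<open>The negative drift contributes \<open>- 2 c1\<close> times \<open>w powr (p - 1)\<close>; half of it is kept, and \<open>\<epsilon>\<close> below is such that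
    the other half absorbs the second-order term.\<close>
  define c1 where "c1 = p * \<delta> / (4 * lam)"
  have c1: "0 < c1" using p2 x0 lam by (simp add: c1_def)
  define \<epsilon> where "\<epsilon> = c1 / (cp * E2 + 1)"
  have \<epsilon>: "0 < \<epsilon>" "cp * E2 * \<epsilon> \<le> c1"
  proof -
    have "0 \<le> cp * E2" using cp E by simp
    then show "0 < \<epsilon>" using c1 by (auto simp: \<epsilon>_def intro!: divide_pos_pos)
    show "cp * E2 * \<epsilon> \<le> c1" using c1 \<open>0 \<le> cp * E2\<close> by (simp add: \<epsilon>_def field_simps)
  qed
  define A1 where "A1 = p / lam * ((\<Theta> + \<delta> / 2) * 2 powr s)"
  define A2 where "A2 = A1 * x0 powr s + cp * E2 * (1 / \<epsilon>) powr (p - 2) + cp * Ep"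
  have A: "0 \<le> A1" "0 \<le> A2"
  proof -
    show "0 \<le> A1" using p2 lam dr x0 by (simp add: A1_def)
    then show "0 \<le> A2" using cp E by (simp add: A2_def)
  qed
  define G where "G n x = p * fst x powr s * (\<integral>\<omega>. D n (snd x) \<omega> \<partial>M) +
      cp * (fst x powr (p - 2) * (\<integral>\<omega>. (D n (snd x) \<omega>)\<^sup>2 \<partial>M) + (\<integral>\<omega>. \<bar>D n (snd x) \<omega>\<bar> powr p \<partial>M))" for n and x :: "real \<times> real"
  have G_bound: "real n * G n x \<le> - c1 * fst x powr s + A1 * (max 0 (fst x - snd x)) powr s + A2"
    if n: "n1 \<le> n" and x: "0 \<le> snd x" "snd x \<le> fst x" for n x
  proof -
    have n0n: "n0 \<le> n" using n dr by simp
    define w b y where "w = fst x" and "b = max 0 (fst x - snd x)" and "y = excess n - r n * Fh n (snd x)"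
    have w: "0 \<le> w" "0 \<le> b" "w = b + snd x" using x by (auto simp: w_def b_def)
    have wy: "w powr s * y \<le> - (\<delta> / 2) * w powr s + (\<Theta> + \<delta> / 2) * (2 powr s * (b powr s + x0 powr s))"
    proof (cases "x0 \<le> snd x")
      case True
      have "w powr s * y \<le> w powr s * (- \<delta> / 2)"
        using dr(4)[OF n True] by (intro mult_left_mono) (auto simp: y_def)
      moreover have "0 \<le> (\<Theta> + \<delta> / 2) * (2 powr s * (b powr s + x0 powr s))" using dr x0 by simp
      ultimately show ?thesis by (simp add: algebra_simps)
    next
      case False
      have "w powr s \<le> (b + x0) powr s" using w False x s by (intro powr_mono2) auto
      also have "\<dots> \<le> (1 + 1) powr s * b powr s + (1 + 1 / 1) powr s * x0 powr s"
        using w x0 s by (intro powr_add_le_split) auto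
      finally have "w powr s \<le> 2 powr s * (b powr s + x0 powr s)" by (simp add: algebra_simps)
      then have 1: "(\<Theta> + \<delta> / 2) * w powr s \<le> (\<Theta> + \<delta> / 2) * (2 powr s * (b powr s + x0 powr s))"
        using dr x0 by (intro mult_left_mono) auto
      have "w powr s * y \<le> w powr s * \<Theta>" using dr(3)[OF n] by (intro mult_left_mono) (auto simp: y_def)
      also have "\<dots> = - (\<delta> / 2) * w powr s + (\<Theta> + \<delta> / 2) * w powr s" by (simp add: algebra_simps)
      finally show ?thesis using 1 by linarith
    qed
    have w2: "w powr (p - 2) \<le> \<epsilon> * w powr s + (1 / \<epsilon>) powr (p - 2)"
    proof (cases "1 / \<epsilon> \<le> w")
      case True
      then have wp: "0 < w" using \<epsilon> by (auto intro: less_le_trans[of 0 "1 / \<epsilon>"])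
      have "w powr (p - 2) * 1 \<le> w powr (p - 2) * (\<epsilon> * w)"
        using True \<epsilon> by (intro mult_left_mono) (auto simp: field_simps)
      also have "\<dots> = \<epsilon> * (w powr (p - 2) * w powr 1)" using wp by simp
      also have "w powr (p - 2) * w powr 1 = w powr s" unfolding powr_add[symmetric] by (simp add: s_def)
      finally show ?thesis by (simp add: add_increasing2)
    next
      case False
      then have "w powr (p - 2) \<le> (1 / \<epsilon>) powr (p - 2)" using w p2 by (intro powr_mono2) auto
      moreover have "0 \<le> \<epsilon> * w powr s" using \<epsilon> by simp
      ultimately show ?thesis by linarith
    qed
    have Dp: "real n * (\<integral>\<omega>. \<bar>D n (snd x) \<omega>\<bar> powr p \<partial>M) \<le> Ep"
    proof -
      have "sqrt (real n) powr (2 - p) \<le> 1"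
        using sqrt_n[OF n0n] p2 powr_mono[of "2 - p" 0 "sqrt (real n)"] by simp
      then have "Ep * sqrt (real n) powr (2 - p) \<le> Ep * 1" using E by (intro mult_left_mono) auto
      then show ?thesis using integrable_D_powr(2)[OF n0n, of "snd x"] by (simp add: Ep_def)
    qed
    have D2: "real n * (\<integral>\<omega>. (D n (snd x) \<omega>)\<^sup>2 \<partial>M) \<le> E2" using integrable_D_square(2)[OF n0n] by (simp add: E2_def)
    have "real n * G n x = p * w powr s * (real n * (\<integral>\<omega>. D n (snd x) \<omega> \<partial>M)) +
       cp * (w powr (p - 2) * (real n * (\<integral>\<omega>. (D n (snd x) \<omega>)\<^sup>2 \<partial>M)) + real n * (\<integral>\<omega>. \<bar>D n (snd x) \<omega>\<bar> powr p \<partial>M))"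
      by (simp add: G_def w_def algebra_simps)
    also have "p * w powr s * (real n * (\<integral>\<omega>. D n (snd x) \<omega> \<partial>M)) = p / lam * (w powr s * y)"
      unfolding D_mean[OF n0n] by (simp add: y_def)
    also have "\<dots> + cp * (w powr (p - 2) * (real n * (\<integral>\<omega>. (D n (snd x) \<omega>)\<^sup>2 \<partial>M)) + real n * (\<integral>\<omega>. \<bar>D n (snd x) \<omega>\<bar> powr p \<partial>M)) \<le>
        p / lam * (- (\<delta> / 2) * w powr s + (\<Theta> + \<delta> / 2) * (2 powr s * (b powr s + x0 powr s))) +
        cp * ((\<epsilon> * w powr s + (1 / \<epsilon>) powr (p - 2)) * E2 + Ep)"
    proof (intro add_mono mult_left_mono wy mult_mono D2 w2 Dp)
      show "0 \<le> real n * (\<integral>\<omega>. (D n (snd x) \<omega>)\<^sup>2 \<partial>M)" by simp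
      show "0 \<le> \<epsilon> * w powr s + (1 / \<epsilon>) powr (p - 2)" using \<epsilon> by simp
    qed (use p2 lam cp in auto)
    also have "\<dots> = - 2 * c1 * w powr s + A1 * b powr s + A1 * x0 powr s + (cp * E2 * \<epsilon>) * w powr s + cp * E2 * (1 / \<epsilon>) powr (p - 2) + cp * Ep"
      using lam by (simp add: c1_def A1_def field_simps)
    also have "\<dots> \<le> - 2 * c1 * w powr s + A1 * b powr s + A1 * x0 powr s + c1 * w powr s + cp * E2 * (1 / \<epsilon>) powr (p - 2) + cp * Ep"
      using \<epsilon>(2) by (intro add_mono mult_right_mono order_refl) auto
    finally show ?thesis by (simp add: A2_def w_def b_def)
  qed
  define h where "h K x = of_bool (fst x powr p < real K) * (max 0 (fst x)) powr s" for K :: nat and x :: "real \<times> real"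
  have h_meas [measurable]: "h K \<in> borel_measurable borel" for K unfolding h_def[abs_def] by measurable
  have h_bd: "\<bar>h K x\<bar> \<le> 1 + real K" for K x
  proof (cases "0 \<le> fst x \<and> fst x powr p < real K")
    case True
    then have "fst x powr s \<le> 1 + fst x powr p" using s by (intro powr_le_one_add) auto
    then show ?thesis using True by (simp add: h_def max_def)
  qed (auto simp: h_def max_def s)
  have h_int: "(\<integral>x. h K x \<partial>\<mu> n) \<le> (A1 * KB + A2) / c1" if n: "n1 \<le> n" for n K
  proof -
    have n0n: "n0 \<le> n" using n dr by simp
    interpret mu: prob_space "\<mu> n" by (rule mu_prob[OF n0n])
    define f where "f x = min ((max 0 (fst x)) powr p) (real K)" for x :: "real \<times> real"
    have f_meas [measurable]: "f \<in> borel_measurable borel" unfolding f_def[abs_def] by measurable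
    have f_bd: "\<bar>f x\<bar> \<le> real K" for x unfolding f_def by auto
    have i: "integrable (\<mu> n) f" by (rule mu_integrable_bounded[OF n0n _ f_bd]) measurable
    have ih: "integrable (\<mu> n) (h K)" by (rule mu_integrable_bounded[OF n0n _ h_bd]) measurable
    have step: "real n * ((\<integral>\<omega>. f (nxt n x \<omega>) \<partial>M) - f x) \<le> - c1 * h K x + A1 * (max 0 (fst x - snd x)) powr s + A2"
      if x: "0 \<le> snd x" "snd x \<le> fst x" for x
    proof -
      have [measurable]: "nxt n x \<in> borel_measurable M" by (rule nxt_meas[OF n0n]) measurable
      have inx: "integrable M (\<lambda>\<omega>. f (nxt n x \<omega>))"
        by (rule integrable_const_bound[where B = "real K"]) (use f_bd in auto)
      show ?thesis
      proof (cases "fst x powr p < real K")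
        case True
        have fx: "f x = fst x powr p" using True x by (simp add: f_def)
        have "(\<integral>\<omega>. f (nxt n x \<omega>) \<partial>M) \<le> (\<integral>\<omega>. fst x powr p + p * fst x powr s * D n (snd x) \<omega> +
            cp * (fst x powr (p - 2) * (D n (snd x) \<omega>)\<^sup>2 + \<bar>D n (snd x) \<omega>\<bar> powr p) \<partial>M)"
        proof (rule integral_mono[OF inx])
          show "integrable M (\<lambda>\<omega>. fst x powr p + p * fst x powr s * D n (snd x) \<omega> +
            cp * (fst x powr (p - 2) * (D n (snd x) \<omega>)\<^sup>2 + \<bar>D n (snd x) \<omega>\<bar> powr p))"
            by (intro Bochner_Integration.integrable_add integrable_mult_right integrable_const
                integrable_D[OF n0n] integrable_D_square[OF n0n] integrable_D_powr[OF n0n])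
          fix \<omega>
          have "f (nxt n x \<omega>) \<le> (max 0 (fst x + D n (snd x) \<omega>)) powr p"
            by (simp add: f_def nxt_def Let_def)
          also have "\<dots> \<le> fst x powr p + p * fst x powr s * D n (snd x) \<omega> +
              cp * (fst x powr (p - 2) * (D n (snd x) \<omega>)\<^sup>2 + \<bar>D n (snd x) \<omega>\<bar> powr p)"
            unfolding s_def cp_def using p2 x by (intro positive_part_powr_expansion) auto
          finally show "f (nxt n x \<omega>) \<le> fst x powr p + p * fst x powr s * D n (snd x) \<omega> +
              cp * (fst x powr (p - 2) * (D n (snd x) \<omega>)\<^sup>2 + \<bar>D n (snd x) \<omega>\<bar> powr p)" .
        qed
        also have "\<dots> = fst x powr p + G n x"
          unfolding G_def using integrable_D[OF n0n, of "snd x"] integrable_D_square(1)[OF n0n, of "snd x"] integrable_D_powr(1)[OF n0n, of "snd x"]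
          by (simp add: prob_space)
        finally have "(\<integral>\<omega>. f (nxt n x \<omega>) \<partial>M) - f x \<le> G n x" using fx by simp
        then have "real n * ((\<integral>\<omega>. f (nxt n x \<omega>) \<partial>M) - f x) \<le> real n * G n x" by (intro mult_left_mono) auto
        also have "\<dots> \<le> - c1 * fst x powr s + A1 * (max 0 (fst x - snd x)) powr s + A2" by (rule G_bound[OF n x])
        finally show ?thesis using True x by (simp add: h_def)
      next
        case False
        have "(\<integral>\<omega>. f (nxt n x \<omega>) \<partial>M) \<le> (\<integral>\<omega>. real K \<partial>M)"
          by (intro integral_mono inx) (auto simp: f_def)
        also have "\<dots> = f x" using False x by (simp add: f_def prob_space)
        finally have "real n * ((\<integral>\<omega>. f (nxt n x \<omega>) \<partial>M) - f x) \<le> 0" by (simp add: mult_nonneg_nonpos)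
        also have "\<dots> \<le> A1 * (max 0 (fst x - snd x)) powr s + A2" using A by simp
        finally show ?thesis using False by (simp add: h_def)
      qed
    qed
    have ib: "integrable (\<mu> n) (\<lambda>x. (max 0 (fst x - snd x)) powr s)" using KB(2)[OF n0n] by (simp add: s_def)
    have "0 = real n * (\<integral>x. (\<integral>\<omega>. f (nxt n x \<omega>) \<partial>M) - f x \<partial>\<mu> n)"
      using stationarity(1)[OF n0n i] stationarity(3)[OF n0n i] i by simp
    also have "\<dots> = (\<integral>x. real n * ((\<integral>\<omega>. f (nxt n x \<omega>) \<partial>M) - f x) \<partial>\<mu> n)" by simp
    also have "\<dots> \<le> (\<integral>x. - c1 * h K x + A1 * (max 0 (fst x - snd x)) powr s + A2 \<partial>\<mu> n)"
    proof (rule integral_mono_AE)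
      show "AE x in \<mu> n. real n * ((\<integral>\<omega>. f (nxt n x \<omega>) \<partial>M) - f x) \<le> - c1 * h K x + A1 * (max 0 (fst x - snd x)) powr s + A2"
        using mu_states[OF n0n] by eventually_elim (rule step, auto)
    qed (use ih ib i stationarity(3)[OF n0n i] in auto)
    also have "\<dots> = - c1 * (\<integral>x. h K x \<partial>\<mu> n) + A1 * (\<integral>x. (max 0 (fst x - snd x)) powr s \<partial>\<mu> n) + A2"
      using ih ib by (simp add: mu.prob_space)
    finally have "c1 * (\<integral>x. h K x \<partial>\<mu> n) \<le> A1 * (\<integral>x. (max 0 (fst x - snd x)) powr s \<partial>\<mu> n) + A2" by simp
    also have "\<dots> \<le> A1 * KB + A2"
    proof -
      have "(1 / sqrt (real n)) powr s \<le> 1" using sqrt_n[OF n0n] s by (intro powr_le1) auto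
      then have "KB * (1 / sqrt (real n)) powr s \<le> KB * 1" using KB(1) by (intro mult_left_mono)
      then have "(\<integral>x. (max 0 (fst x - snd x)) powr s \<partial>\<mu> n) \<le> KB" using KB(3)[OF n0n] by (simp add: s_def)
      then show ?thesis using A by (intro add_mono mult_left_mono) auto
    qed
    finally show ?thesis using c1 by (simp add: field_simps)
  qed
  have mono: "mono (\<lambda>K. h K x)" for x
    unfolding h_def mono_def by (auto simp: of_bool_def)
  have lim: "(\<lambda>K. h K x) \<longlonglongrightarrow> (max 0 (fst x)) powr s" for x
  proof (rule tendsto_eventually)
    obtain N :: nat where "fst x powr p < real N" using reals_Archimedean2 by blast
    then show "\<forall>\<^sub>F K in sequentially. h K x = (max 0 (fst x)) powr s"
      unfolding h_def by (intro eventually_sequentiallyI[of N]) auto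
  qed
  show ?thesis
  proof (rule that[of "(A1 * KB + A2) / c1" n1])
    show "0 \<le> (A1 * KB + A2) / c1" using A KB(1) c1 by simp
    fix n assume n: "n1 \<le> n"
    then have n0n: "n0 \<le> n" using dr by simp
    have meas: "(\<lambda>x. (max 0 (fst x)) powr s) \<in> borel_measurable (\<mu> n)"
      by (rule mu_meas[OF n0n]) measurable
    have i: "integrable (\<mu> n) (h K)" for K by (rule mu_integrable_bounded[OF n0n _ h_bd]) measurable
    show "integrable (\<mu> n) (\<lambda>x. (max 0 (fst x)) powr (p - 1))"
      "(\<integral>x. (max 0 (fst x)) powr (p - 1) \<partial>\<mu> n) \<le> (A1 * KB + A2) / c1"
      using integrable_by_truncation[where f = h and M = "\<mu> n" and g = "\<lambda>x. (max 0 (fst x)) powr s",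
          OF i mono lim meas h_int[OF n]]
      unfolding s_def by blast+
  qed (rule dr)
qed

end

section \<open>Convergence of the drift\<close>

context heavy_traffic
begin

lemma H_max_cont: "continuous_on UNIV (\<lambda>x. H (max 0 x))"
  by (rule continuous_on_compose2[OF H_cont]) (auto intro!: continuous_intros)

lemma H_meas [measurable]: "(\<lambda>x. H (max 0 x)) \<in> borel_measurable borel"
  by (rule borel_measurable_continuous_onI[OF H_max_cont])

lemma Fh_meas: "n0 \<le> n \<Longrightarrow> Fh n \<in> borel_measurable borel"
  by (rule borel_measurable_mono) (auto simp: mono_def intro: Fh_mono)

lemma H_nonneg: "0 \<le> x \<Longrightarrow> 0 \<le> H x"
  by (rule LIMSEQ_le_const[OF Fh_lim]) (use Fh_nonneg in \<open>auto intro!: exI[of _ n0]\<close>)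

lemma H_growth: "0 \<le> x \<Longrightarrow> H x \<le> C * (1 + x powr m)"
  by (rule LIMSEQ_le_const2[OF Fh_lim]) (use growth in \<open>auto intro!: exI[of _ n0] simp: Fh_def\<close>)

lemma Fh_growth: "n0 \<le> n \<Longrightarrow> 0 \<le> x \<Longrightarrow> Fh n x \<le> C * (1 + x powr m)"
  using growth by (simp add: Fh_def)

lemma sqrt_powr_lim: "a < 0 \<Longrightarrow> (\<lambda>n. sqrt (real n) powr a) \<longlonglongrightarrow> 0"
  by (rule tendsto_neg_powr[OF _ filterlim_compose[OF sqrt_at_top filterlim_real_sequentially]])

text \<open>
  As \<open>m\<close> and 1 lie below \<open>p - 1\<close>, the bounded moment of order \<open>p - 1\<close> makes lower powers uniformly integrable.
\<close>

lemma tail_moments: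
  obtains N Km where "n0 \<le> N" "0 \<le> Km"
    "\<And>n. N \<le> n \<Longrightarrow> integrable (\<mu> n) (\<lambda>x. max 0 (fst x))"
    "\<And>n. N \<le> n \<Longrightarrow> integrable (\<mu> n) (\<lambda>x. (max 0 (fst x)) powr m)"
    "\<And>n. N \<le> n \<Longrightarrow> (\<integral>x. 1 + (max 0 (fst x)) powr m \<partial>\<mu> n) \<le> Km"
    "\<And>\<epsilon>. 0 < \<epsilon> \<Longrightarrow> \<exists>R\<ge>1. \<forall>n\<ge>N. (\<integral>x. (1 + (max 0 (fst x)) powr m) * of_bool (R < fst x) \<partial>\<mu> n) \<le> \<epsilon>"
proof -
  obtain KW N where KW: "0 \<le> KW" "n0 \<le> N" "\<And>n. N \<le> n \<Longrightarrow> integrable (\<mu> n) (\<lambda>x. (max 0 (fst x)) powr (p - 1))"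
    "\<And>n. N \<le> n \<Longrightarrow> (\<integral>x. (max 0 (fst x)) powr (p - 1) \<partial>\<mu> n) \<le> KW"
    using workload_moment by blast
  have i: "integrable (\<mu> n) (\<lambda>x. (max 0 (fst x)) powr q)" if n: "N \<le> n" and q: "0 \<le> q" "q \<le> p - 1" for n q
  proof (rule Bochner_Integration.integrable_bound)
    interpret mu: prob_space "\<mu> n" using KW(2) n by (intro mu_prob) simp
    show "integrable (\<mu> n) (\<lambda>x. 1 + (max 0 (fst x)) powr (p - 1))" using KW(3)[OF n] by simp
    show "(\<lambda>x. (max 0 (fst x)) powr q) \<in> borel_measurable (\<mu> n)" using KW(2) n by (intro mu_meas) auto
    show "AE x in \<mu> n. norm ((max 0 (fst x)) powr q) \<le> norm (1 + (max 0 (fst x)) powr (p - 1))"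
    proof (rule AE_I2)
      fix x :: "real \<times> real"
      have "(max 0 (fst x)) powr q \<le> 1 + (max 0 (fst x)) powr (p - 1)" using q by (intro powr_le_one_add) auto
      then show "norm ((max 0 (fst x)) powr q) \<le> norm (1 + (max 0 (fst x)) powr (p - 1))" by simp
    qed
  qed
  have bound: "(\<integral>x. (1 + (max 0 (fst x)) powr m) * of_bool (R < fst x) \<partial>\<mu> n) \<le> 2 * KW * R powr (m - (p - 1))"
    if n: "N \<le> n" and R: "1 \<le> R" for n R
  proof -
    interpret mu: prob_space "\<mu> n" using KW(2) n by (intro mu_prob) simp
    have "(\<integral>x. (1 + (max 0 (fst x)) powr m) * of_bool (R < fst x) \<partial>\<mu> n) \<le>
        (\<integral>x. 2 * R powr (m - (p - 1)) * (max 0 (fst x)) powr (p - 1) \<partial>\<mu> n)"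
    proof (rule integral_mono)
      show "integrable (\<mu> n) (\<lambda>x. (1 + (max 0 (fst x)) powr m) * of_bool (R < fst x))"
        by (rule Bochner_Integration.integrable_bound[of _ "\<lambda>x. 1 + (max 0 (fst x)) powr m"])
          (use i[OF n, of m] m KW(2) n in \<open>auto intro!: mu_meas\<close>)
      show "integrable (\<mu> n) (\<lambda>x. 2 * R powr (m - (p - 1)) * (max 0 (fst x)) powr (p - 1))"
        using KW(3)[OF n] by simp
      fix x :: "real \<times> real"
      show "(1 + (max 0 (fst x)) powr m) * of_bool (R < fst x) \<le> 2 * R powr (m - (p - 1)) * (max 0 (fst x)) powr (p - 1)"
      proof (cases "R < fst x")
        case True
        then have x: "1 \<le> fst x" using R by simp
        have "1 + fst x powr m \<le> 2 * fst x powr m" using ge_one_powr_ge_zero[OF x, of m] m by simp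
        moreover have "fst x powr m = fst x powr (m - (p - 1)) * fst x powr (p - 1)" by (simp flip: powr_add)
        moreover have "fst x powr (m - (p - 1)) * fst x powr (p - 1) \<le> R powr (m - (p - 1)) * fst x powr (p - 1)"
          using True R m by (intro mult_right_mono powr_mono2') auto
        moreover have "max 0 (fst x) = fst x" using x by simp
        ultimately show ?thesis using True by (simp only: of_bool_eq mult_1_right mult.assoc)
      qed simp
    qed
    also have "\<dots> = 2 * R powr (m - (p - 1)) * (\<integral>x. (max 0 (fst x)) powr (p - 1) \<partial>\<mu> n)" by simp
    also have "\<dots> \<le> 2 * R powr (m - (p - 1)) * KW" using KW(4)[OF n] by (intro mult_left_mono) auto
    finally show ?thesis by (simp add: mult_ac)
  qed
  show ?thesis
  proof (rule that[of N "2 + KW"])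
    fix n assume n: "N \<le> n"
    interpret mu: prob_space "\<mu> n" using KW(2) n by (intro mu_prob) simp
    show "integrable (\<mu> n) (\<lambda>x. (max 0 (fst x)) powr m)" using i[OF n, of m] m by simp
    have eq: "(max 0 y) powr 1 = max 0 y" for y :: real by (rule powr_one) simp
    show "integrable (\<mu> n) (\<lambda>x. max 0 (fst x))" using i[OF n, of 1] p2 unfolding eq by simp
    have "(\<integral>x. 1 + (max 0 (fst x)) powr m \<partial>\<mu> n) \<le> (\<integral>x. 1 + (1 + (max 0 (fst x)) powr (p - 1)) \<partial>\<mu> n)"
      using i[OF n, of m] KW(3)[OF n] m by (intro integral_mono add_left_mono powr_le_one_add) auto
    also have "\<dots> \<le> 2 + KW" using KW(3,4)[OF n] by (simp add: mu.prob_space)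
    finally show "(\<integral>x. 1 + (max 0 (fst x)) powr m \<partial>\<mu> n) \<le> 2 + KW" .
  next
    fix \<epsilon> :: real assume e: "0 < \<epsilon>"
    have "((\<lambda>R. 2 * KW * R powr (m - (p - 1))) \<longlongrightarrow> 2 * KW * 0) at_top"
      using m by (intro tendsto_intros tendsto_neg_powr filterlim_ident) auto
    then have "\<forall>\<^sub>F R in at_top. 2 * KW * R powr (m - (p - 1)) < \<epsilon>"
      by (rule order_tendstoD) (use e in simp)
    then have "\<forall>\<^sub>F R in at_top. 2 * KW * R powr (m - (p - 1)) < \<epsilon> \<and> 1 \<le> R"
      using eventually_ge_at_top[of 1] by eventually_elim simp
    then obtain R where R: "2 * KW * R powr (m - (p - 1)) < \<epsilon>" "1 \<le> R"
      using eventually_happens[of _ at_top] by force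
    have "\<forall>n\<ge>N. (\<integral>x. (1 + (max 0 (fst x)) powr m) * of_bool (R < fst x) \<partial>\<mu> n) \<le> \<epsilon>"
      using bound[OF _ R(2)] R(1) by force
    then show "\<exists>R\<ge>1. \<forall>n\<ge>N. (\<integral>x. (1 + (max 0 (fst x)) powr m) * of_bool (R < fst x) \<partial>\<mu> n) \<le> \<epsilon>"
      using R(2) by blast
  qed (use KW in auto)
qed

lemma Fh_close_to_H:
  assumes e: "0 < \<epsilon>" and R: "0 \<le> R"
  obtains \<eta> N where "0 < \<eta>" "n0 \<le> N"
    "\<And>n w y. N \<le> n \<Longrightarrow> 0 \<le> w \<Longrightarrow> w \<le> R \<Longrightarrow> 0 \<le> y \<Longrightarrow> \<bar>y - w\<bar> \<le> \<eta> \<Longrightarrow> \<bar>Fh n y - H w\<bar> \<le> \<epsilon>"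
proof -
  have "uniformly_continuous_on {0..R + 1} H"
    by (intro compact_uniformly_continuous continuous_on_subset[OF H_cont]) auto
  then obtain \<eta> where \<eta>: "0 < \<eta>" "\<And>w y. w \<in> {0..R + 1} \<Longrightarrow> y \<in> {0..R + 1} \<Longrightarrow> dist y w < \<eta> \<Longrightarrow> dist (H y) (H w) < \<epsilon> / 2"
    using e unfolding uniformly_continuous_on_def by (metis half_gt_zero)
  have "\<forall>\<^sub>F n in sequentially. \<forall>y\<in>{0..R + 1}. dist (Fh n y) (H y) < \<epsilon> / 2"
    using uniform_limitD[OF unif[of "R + 1"], of "\<epsilon> / 2"] R e unfolding Fh_def by simp
  then obtain N where N: "\<And>n y. N \<le> n \<Longrightarrow> y \<in> {0..R + 1} \<Longrightarrow> dist (Fh n y) (H y) < \<epsilon> / 2"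
    unfolding eventually_sequentially by blast
  show ?thesis
  proof (rule that[of "min 1 (\<eta> / 2)" "max N n0"])
    fix n w y assume a: "max N n0 \<le> n" "0 \<le> w" "w \<le> R" "0 \<le> y" "\<bar>y - w\<bar> \<le> min 1 (\<eta> / 2)"
    then have in': "y \<in> {0..R + 1}" "w \<in> {0..R + 1}" by auto
    have "dist (Fh n y) (H y) < \<epsilon> / 2" using N a in' by simp
    moreover have "dist (H y) (H w) < \<epsilon> / 2" using in' a \<eta> by (intro \<eta>(2)) (auto simp: dist_real_def)
    ultimately show "\<bar>Fh n y - H w\<bar> \<le> \<epsilon>" unfolding dist_real_def by linarith
  qed (use \<eta> in auto)
qed

lemma Fh_H_crude:
  assumes n: "n0 \<le> n" and "0 \<le> y" "0 \<le> w" "y \<le> z" "w \<le> z"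
  shows "\<bar>Fh n y - H w\<bar> \<le> C * (1 + z powr m)"
proof -
  have "y powr m \<le> z powr m" "w powr m \<le> z powr m" using assms m by (auto intro!: powr_mono2)
  then have "C * (1 + y powr m) \<le> C * (1 + z powr m)" "C * (1 + w powr m) \<le> C * (1 + z powr m)"
    using C by (auto intro!: mult_left_mono)
  then show ?thesis
    using Fh_growth[OF n assms(2)] H_growth[OF assms(3)] Fh_nonneg[OF n, of y] H_nonneg[OF assms(3)] by linarith
qed

lemma integrable_Fh_H:
  assumes n: "n0 \<le> n" and i: "integrable (\<mu> n) (\<lambda>x. (max 0 (fst x)) powr m)"
  shows "integrable (\<mu> n) (\<lambda>x. Fh n (snd x))" "integrable (\<mu> n) (\<lambda>x. H (max 0 (fst x)))"
    "integrable (\<mu> n) (\<lambda>x. \<bar>Fh n (snd x) - H (max 0 (fst x))\<bar>)"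
    "AE x in \<mu> n. 0 \<le> Fh n (snd x) \<and> Fh n (snd x) \<le> C * (1 + (max 0 (fst x)) powr m)"
proof -
  interpret mu: prob_space "\<mu> n" by (rule mu_prob[OF n])
  note [measurable] = Fh_meas[OF n]
  have b: "integrable (\<mu> n) (\<lambda>x. C * (1 + (max 0 (fst x)) powr m))" using i by simp
  show ae: "AE x in \<mu> n. 0 \<le> Fh n (snd x) \<and> Fh n (snd x) \<le> C * (1 + (max 0 (fst x)) powr m)"
    using mu_states[OF n]
  proof eventually_elim
    case (elim x)
    have "C * (1 + snd x powr m) \<le> C * (1 + (max 0 (fst x)) powr m)"
      using elim C m by (intro mult_left_mono add_left_mono powr_mono2) auto
    then show ?case using Fh_growth[OF n, of "snd x"] Fh_nonneg[OF n] elim by (meson order_trans)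
  qed
  have mF: "(\<lambda>x. Fh n (snd x)) \<in> borel_measurable (\<mu> n)" "(\<lambda>x. H (max 0 (fst x))) \<in> borel_measurable (\<mu> n)"
    by (rule mu_meas[OF n], measurable)+
  show 1: "integrable (\<mu> n) (\<lambda>x. Fh n (snd x))"
    by (rule Bochner_Integration.integrable_bound[OF b mF(1)]) (use ae in eventually_elim, use C in \<open>simp add: abs_of_nonneg\<close>)
  show 2: "integrable (\<mu> n) (\<lambda>x. H (max 0 (fst x)))"
  proof (rule Bochner_Integration.integrable_bound[OF b mF(2)], rule AE_I2)
    fix x :: "real \<times> real"
    show "norm (H (max 0 (fst x))) \<le> norm (C * (1 + (max 0 (fst x)) powr m))"
      using H_growth[of "max 0 (fst x)"] H_nonneg[of "max 0 (fst x)"] by simp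
  qed
  show "integrable (\<mu> n) (\<lambda>x. \<bar>Fh n (snd x) - H (max 0 (fst x))\<bar>)"
    using 1 2 by (intro integrable_abs Bochner_Integration.integrable_diff)
qed

text \<open>
  Abandonment is decided by the left limit, whereas the limit equation involves the workload. Three cases
  are separated: a large workload is controlled by the tails, a large gap between both values by the batch
  moment, and otherwise the convergence to \<open>H\<close> is locally uniform.
\<close>

lemma drift_error_lim:
  assumes e: "0 < \<epsilon>"
  shows "\<forall>\<^sub>F n in sequentially. (\<integral>x. \<bar>Fh n (snd x) - H (max 0 (fst x))\<bar> \<partial>\<mu> n) \<le> \<epsilon>"
proof -
  obtain N Km where T: "n0 \<le> N" "0 \<le> Km"
    "\<And>n. N \<le> n \<Longrightarrow> integrable (\<mu> n) (\<lambda>x. max 0 (fst x))"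
    "\<And>n. N \<le> n \<Longrightarrow> integrable (\<mu> n) (\<lambda>x. (max 0 (fst x)) powr m)"
    "\<And>n. N \<le> n \<Longrightarrow> (\<integral>x. 1 + (max 0 (fst x)) powr m \<partial>\<mu> n) \<le> Km"
    "\<And>\<epsilon>. 0 < \<epsilon> \<Longrightarrow> \<exists>R\<ge>1. \<forall>n\<ge>N. (\<integral>x. (1 + (max 0 (fst x)) powr m) * of_bool (R < fst x) \<partial>\<mu> n) \<le> \<epsilon>"
    using tail_moments by blast
  obtain KB where KB: "0 \<le> KB" "\<And>n. n0 \<le> n \<Longrightarrow> integrable (\<mu> n) (\<lambda>x. (max 0 (fst x - snd x)) powr (p - 1))"
    "\<And>n. n0 \<le> n \<Longrightarrow> (\<integral>x. (max 0 (fst x - snd x)) powr (p - 1) \<partial>\<mu> n) \<le> KB * (1 / sqrt (real n)) powr (p - 1)"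
    using batch_moment by blast
  obtain R where R: "1 \<le> R" "\<And>n. N \<le> n \<Longrightarrow> (\<integral>x. (1 + (max 0 (fst x)) powr m) * of_bool (R < fst x) \<partial>\<mu> n) \<le> \<epsilon> / 3 / C"
    using T(6)[of "\<epsilon> / 3 / C"] e C by auto
  have pre: "0 < \<epsilon> / 3" "0 \<le> R" using e R(1) by auto
  obtain \<eta> N2 where \<eta>: "0 < \<eta>" "n0 \<le> N2"
    "\<And>n w y. N2 \<le> n \<Longrightarrow> 0 \<le> w \<Longrightarrow> w \<le> R \<Longrightarrow> 0 \<le> y \<Longrightarrow> \<bar>y - w\<bar> \<le> \<eta> \<Longrightarrow> \<bar>Fh n y - H w\<bar> \<le> \<epsilon> / 3"
    using Fh_close_to_H[OF pre] by blast
  define A where "A = C * (1 + R powr m) * (1 / \<eta>) powr (p - 1)"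
  have A: "0 \<le> A" using C by (simp add: A_def)
  have "(\<lambda>n. A * (KB * sqrt (real n) powr (- (p - 1)))) \<longlonglongrightarrow> A * (KB * 0)"
    using p2 by (intro tendsto_intros sqrt_powr_lim) auto
  then have "\<forall>\<^sub>F n in sequentially. A * (KB * sqrt (real n) powr (- (p - 1))) < \<epsilon> / 3"
    by (rule order_tendstoD) (use e in simp)
  then show ?thesis using eventually_ge_at_top[of N] eventually_ge_at_top[of N2]
  proof eventually_elim
    case (elim n)
    have n: "n0 \<le> n" "N \<le> n" "N2 \<le> n" using elim T(1) by auto
    interpret mu: prob_space "\<mu> n" by (rule mu_prob[OF n(1)])
    have pw: "\<bar>Fh n (snd x) - H (max 0 (fst x))\<bar> \<le> \<epsilon> / 3 + C * ((1 + (max 0 (fst x)) powr m) * of_bool (R < fst x)) +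
        A * (max 0 (fst x - snd x)) powr (p - 1)" if x: "0 \<le> snd x" "snd x \<le> fst x" for x
    proof -
      have nn: "0 \<le> C * ((1 + (max 0 (fst x)) powr m) * of_bool (R < fst x))" "0 \<le> A * (max 0 (fst x - snd x)) powr (p - 1)"
        using C A by simp_all
      have crude: "\<bar>Fh n (snd x) - H (max 0 (fst x))\<bar> \<le> C * (1 + (max 0 (fst x)) powr m)"
        using x by (intro Fh_H_crude[OF n(1)]) auto
      consider "R < fst x" | "fst x \<le> R" "fst x - snd x \<le> \<eta>" | "fst x \<le> R" "\<eta> < fst x - snd x" by linarith
      then show ?thesis
      proof cases
        case 1
        then show ?thesis using crude nn e by simp
      next
        case 2
        then have "\<bar>Fh n (snd x) - H (max 0 (fst x))\<bar> \<le> \<epsilon> / 3" using x by (intro \<eta>(3)[OF n(3)]) auto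
        then show ?thesis using nn by linarith
      next
        case 3
        have "1 \<le> ((fst x - snd x) / \<eta>) powr (p - 1)"
          using 3 \<eta>(1) p2 by (intro ge_one_powr_ge_zero) (auto simp: field_simps)
        also have "\<dots> = (1 / \<eta>) powr (p - 1) * (max 0 (fst x - snd x)) powr (p - 1)"
          using x by (simp flip: powr_mult)
        finally have one: "1 \<le> (1 / \<eta>) powr (p - 1) * (max 0 (fst x - snd x)) powr (p - 1)" .
        have "C * (1 + (max 0 (fst x)) powr m) \<le> C * (1 + R powr m) * 1"
          using 3 x C m by (simp add: powr_mono2)
        also have "\<dots> \<le> C * (1 + R powr m) * ((1 / \<eta>) powr (p - 1) * (max 0 (fst x - snd x)) powr (p - 1))"
          using one C by (intro mult_left_mono) auto
        finally show ?thesis using crude nn e by (simp add: A_def mult.assoc)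
      qed
    qed
    have it: "integrable (\<mu> n) (\<lambda>x. (1 + (max 0 (fst x)) powr m) * of_bool (R < fst x))"
      by (rule Bochner_Integration.integrable_bound[of _ "\<lambda>x. 1 + (max 0 (fst x)) powr m"])
        (use T(4)[OF n(2)] n(1) in \<open>auto intro!: mu_meas\<close>)
    have "(\<integral>x. \<bar>Fh n (snd x) - H (max 0 (fst x))\<bar> \<partial>\<mu> n) \<le>
        (\<integral>x. \<epsilon> / 3 + C * ((1 + (max 0 (fst x)) powr m) * of_bool (R < fst x)) + A * (max 0 (fst x - snd x)) powr (p - 1) \<partial>\<mu> n)"
    proof (rule integral_mono_AE)
      show "AE x in \<mu> n. \<bar>Fh n (snd x) - H (max 0 (fst x))\<bar> \<le> \<epsilon> / 3 + C * ((1 + (max 0 (fst x)) powr m) * of_bool (R < fst x)) +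
        A * (max 0 (fst x - snd x)) powr (p - 1)"
        using mu_states[OF n(1)] by eventually_elim (rule pw, auto)
      show "integrable (\<mu> n) (\<lambda>x. \<epsilon> / 3 + C * ((1 + (max 0 (fst x)) powr m) * of_bool (R < fst x)) + A * (max 0 (fst x - snd x)) powr (p - 1))"
        using it KB(2)[OF n(1)] by (intro Bochner_Integration.integrable_add integrable_mult_right) auto
    qed (rule integrable_Fh_H(3)[OF n(1) T(4)[OF n(2)]])
    also have "\<dots> = \<epsilon> / 3 + C * (\<integral>x. (1 + (max 0 (fst x)) powr m) * of_bool (R < fst x) \<partial>\<mu> n) + A * (\<integral>x. (max 0 (fst x - snd x)) powr (p - 1) \<partial>\<mu> n)"
      using it KB(2)[OF n(1)] by (simp add: mu.prob_space)
    also have "\<dots> \<le> \<epsilon> / 3 + C * (\<epsilon> / 3 / C) + A * (KB * (1 / sqrt (real n)) powr (p - 1))"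
      using C A by (intro add_mono mult_left_mono R(2)[OF n(2)] KB(3)[OF n(1)] order_refl) auto
    also have "(1 / sqrt (real n)) powr (p - 1) = sqrt (real n) powr (- (p - 1))"
      unfolding powr_minus_divide by (simp add: powr_divide)
    finally show ?case using elim(1) C by simp
  qed
qed

end

section \<open>The mean over arriving customers\<close>

text \<open>
  For \<open>I\<close> the idle part of an increment \<open>D\<close>, this trades the second moment of \<open>I\<close> for a small multiple of
  its first moment, up to a term of higher order in \<open>D\<close>.
\<close>

lemma square_le_cutoff:
  fixes I D \<eta> p :: real
  assumes "0 \<le> I" "I \<le> \<bar>D\<bar>" "0 < \<eta>" "2 < p"
  shows "I\<^sup>2 \<le> \<eta> * I + \<eta> powr (2 - p) * \<bar>D\<bar> powr p"
    and "\<eta> < \<bar>D\<bar> \<Longrightarrow> D\<^sup>2 \<le> \<eta> powr (2 - p) * \<bar>D\<bar> powr p"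
proof -
  show large: "D\<^sup>2 \<le> \<eta> powr (2 - p) * \<bar>D\<bar> powr p" if "\<eta> < \<bar>D\<bar>"
  proof -
    have "D\<^sup>2 = \<bar>D\<bar> powr (2 - p) * \<bar>D\<bar> powr p"
      using that assms by (simp add: powr_add[symmetric] powr_numeral)
    also have "\<dots> \<le> \<eta> powr (2 - p) * \<bar>D\<bar> powr p"
      using that assms by (intro mult_right_mono powr_mono2') auto
    finally show ?thesis .
  qed
  show "I\<^sup>2 \<le> \<eta> * I + \<eta> powr (2 - p) * \<bar>D\<bar> powr p"
  proof (cases "I \<le> \<eta>")
    case True
    then have "I * I \<le> \<eta> * I" using assms by (intro mult_right_mono)
    then show ?thesis by (simp add: power2_eq_square add_increasing2)
  next
    case False
    then have "I\<^sup>2 \<le> D\<^sup>2" using power_mono[OF assms(2,1), of 2] by simp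
    then show ?thesis using large False assms by (simp add: add_increasing)
  qed
qed

lemma abs_replace_terms:
  fixes a c1 c2 d1 d2 e1 e2 e3 :: real
  assumes "\<bar>a - c1 - d1\<bar> \<le> e1" "\<bar>c1 - c2\<bar> \<le> e2" "\<bar>d1 - d2\<bar> \<le> e3"
  shows "\<bar>a - (c2 + d2)\<bar> \<le> e1 + e2 + e3"
  using assms by linarith

lemma error_budget:
  fixes t :: real
  assumes "t1 \<le> t" "t2 \<le> t" "t3 \<le> t" "a1 + b * (c1 + c2) + a2 \<le> q" "q < t" "b * c3 \<le> t"
  shows "t1 + t2 + t3 + a1 + b * (c1 + c2 + c3) + a2 \<le> t + t + t + (t + t)"
proof -
  have "b * (c1 + c2 + c3) = b * (c1 + c2) + b * c3" by (simp add: distrib_left)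
  then show ?thesis using assms by linarith
qed

context heavy_traffic
begin

text \<open>
  Let \<open>f\<close> be the antiderivative of the Stein solution \<open>g\<close>. By invariance the mean one-step change of
  \<open>f\<close> is zero. Multiplied by \<open>n\<close> and expanded to second order, the change from workload \<open>w\<close> is close to
  \<open>g w * (\<theta> / lam - H w) / lam + \<gamma> w / 2 * s2 / lam\<close>, that is, to \<open>(H w - h) / lam\<close> by the Stein equation.
  So the mean of \<open>H\<close> is close to \<open>h\<close>. Reflection at zero is harmless: as \<open>g 0 = 0\<close>, an idle period \<open>I\<close>
  changes \<open>f\<close> only by a multiple of \<open>I\<^sup>2\<close>, and invariance of the mean workload bounds \<open>n\<close> times the mean
  of \<open>I\<close>, so that \<open>n\<close> times the mean of \<open>I\<^sup>2\<close> tends to zero.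
\<close>

lemma arrival_average_limit:
  fixes \<gamma> g :: "real \<Rightarrow> real"
  assumes s2: "s2 = (U2 + V2 - 2) / lam"
    and \<gamma>: "continuous_on UNIV \<gamma>" "\<And>x. \<bar>\<gamma> x\<bar> \<le> \<Gamma>" and g: "\<And>x. (g has_real_derivative \<gamma> x) (at x)" "g 0 = 0"
    and G: "\<And>x. 0 \<le> x \<Longrightarrow> \<bar>g x\<bar> \<le> G"
    and stein: "\<And>x. 0 \<le> x \<Longrightarrow> s2 / 2 * \<gamma> x + (\<theta> / lam - H x) * g x = H x - h"
  shows "(\<lambda>n. \<integral>x. H (max 0 (fst x)) \<partial>\<mu> n) \<longlonglongrightarrow> h"
proof -
  have cg: "continuous_on UNIV g"
    using g by (intro continuous_at_imp_continuous_on) (auto intro: DERIV_isCont)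
  obtain f where f: "f 0 = 0" "\<And>x. (f has_real_derivative g x) (at x)"
    using antiderivative_exists[OF cg] by blast
  have cf: "continuous_on UNIV f"
    using f by (intro continuous_at_imp_continuous_on) (auto intro: DERIV_isCont)
  have [measurable]: "f \<in> borel_measurable borel" "g \<in> borel_measurable borel" "\<gamma> \<in> borel_measurable borel"
    using cf cg \<gamma>(1) by (auto intro: borel_measurable_continuous_onI)
  have G0: "0 \<le> G" using G[of 0] by simp
  have \<Gamma>0: "0 \<le> \<Gamma>" using \<gamma>(2)[of 0] by linarith
  have f_lin: "\<bar>f y\<bar> \<le> G * y" if "0 \<le> y" for y
  proof -
    have "norm (f y - f 0) \<le> G * norm (y - 0)"
      by (rule field_differentiable_bound[where S = "{0..y}" and f' = g])
        (use that G in \<open>auto intro: has_field_derivative_at_within[OF f(2)]\<close>)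
    then show ?thesis using f(1) that by simp
  qed
  \<comment> \<open>Here \<open>f 0 = g 0 = 0\<close> enters: overshooting zero costs a quadratic term only.\<close>
  have f_neg: "\<bar>f z\<bar> \<le> 3 * \<Gamma> * z\<^sup>2" for z
  proof -
    have "\<bar>f (0 + z) - f 0 - g 0 * z - \<gamma> 0 * z\<^sup>2 / 2\<bar> \<le> (2 * \<Gamma>) * z\<^sup>2"
    proof (rule second_order_remainder[OF f(2) g(1)])
      fix y show "\<bar>\<gamma> y - \<gamma> 0\<bar> \<le> 2 * \<Gamma>" using \<gamma>(2)[of y] \<gamma>(2)[of 0] by linarith
    qed
    moreover have "\<bar>\<gamma> 0 * z\<^sup>2 / 2\<bar> \<le> \<Gamma> * z\<^sup>2"
      using mult_mono[OF \<gamma>(2)[of 0], of "z\<^sup>2 / 2" "z\<^sup>2"] \<Gamma>0 by (simp add: abs_mult)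
    ultimately show ?thesis using f(1) g(2) by (simp add: abs_le_iff algebra_simps)
  qed
  obtain N Km where T: "n0 \<le> N" "0 \<le> Km"
    "\<And>n. N \<le> n \<Longrightarrow> integrable (\<mu> n) (\<lambda>x. max 0 (fst x))"
    "\<And>n. N \<le> n \<Longrightarrow> integrable (\<mu> n) (\<lambda>x. (max 0 (fst x)) powr m)"
    "\<And>n. N \<le> n \<Longrightarrow> (\<integral>x. 1 + (max 0 (fst x)) powr m \<partial>\<mu> n) \<le> Km"
    "\<And>\<epsilon>. 0 < \<epsilon> \<Longrightarrow> \<exists>R\<ge>1. \<forall>n\<ge>N. (\<integral>x. (1 + (max 0 (fst x)) powr m) * of_bool (R < fst x) \<partial>\<mu> n) \<le> \<epsilon>"
    using tail_moments by blast
  define E2 where "E2 = c0\<^sup>2 * (\<integral>\<omega>. (X \<omega>)\<^sup>2 \<partial>M)"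
  define Ep where "Ep = c0 powr p * (\<integral>\<omega>. X \<omega> powr p \<partial>M)"
  define FM where "FM = C * Km"
  have E: "0 \<le> E2" "0 \<le> Ep" "0 \<le> FM" unfolding E2_def Ep_def FM_def using T(2) C by (auto intro!: mult_nonneg_nonneg)
  define a where "a n = Ep * sqrt (real n) powr (2 - p)" for n
  define \<kappa> where "\<kappa> n = ((r n)\<^sup>2 * V2 - 2 * r n + U2) / lam\<^sup>2" for n
  define e where "e n = ((r n)\<^sup>2 * V2 - 2 * r n) / lam\<^sup>2" for n
  define y where "y n x = (excess n - r n * Fh n (snd x)) / lam" for n and x :: "real \<times> real"
  define Q where "Q \<eta> n = 5 * \<Gamma> * \<eta> powr (2 - p) * a n + G / lam * (\<bar>excess n - \<theta> / lam\<bar> + \<bar>r n - 1\<bar> * FM) +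
      \<Gamma> * (\<bar>\<kappa> n - s2 / lam\<bar> + \<bar>e n\<bar> * (FM * sqrt (real n) powr (-1)))" for \<eta> n
  have Q_lim: "Q \<eta> \<longlonglongrightarrow> 0" for \<eta>
  proof -
    have k: "\<kappa> \<longlonglongrightarrow> (1\<^sup>2 * V2 - 2 * 1 + U2) / lam\<^sup>2" "e \<longlonglongrightarrow> (1\<^sup>2 * V2 - 2 * 1) / lam\<^sup>2"
      unfolding \<kappa>_def e_def by (intro tendsto_intros r_lim, use lam in simp)+
    have s: "(1\<^sup>2 * V2 - 2 * 1 + U2) / lam\<^sup>2 = s2 / lam" by (simp add: s2 power2_eq_square)
    have "Q \<eta> \<longlonglongrightarrow> 5 * \<Gamma> * \<eta> powr (2 - p) * (Ep * 0) + G / lam * (\<bar>\<theta> / lam - \<theta> / lam\<bar> + \<bar>1 - 1\<bar> * FM) +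
      \<Gamma> * (\<bar>s2 / lam - s2 / lam\<bar> + \<bar>(1\<^sup>2 * V2 - 2 * 1) / lam\<^sup>2\<bar> * (FM * 0))"
      unfolding Q_def a_def using p2
      by (intro tendsto_intros excess_lim r_lim k(2) k(1)[unfolded s] sqrt_powr_lim) auto
    then show ?thesis by simp
  qed
  have pointwise: "\<bar>real n * ((\<integral>\<omega>. f (fst (nxt n x \<omega>)) \<partial>M) - f (fst x)) - (H (fst x) - h) / lam\<bar> \<le>
      3 * \<Gamma> * \<eta> * (real n * ((\<integral>\<omega>. fst (nxt n x \<omega>) \<partial>M) - fst x) - y n x) + \<epsilon> * E2 + 2 * \<Gamma> * E2 * of_bool (R < fst x) +
      5 * \<Gamma> * \<eta> powr (2 - p) * a n + G / lam * (\<bar>excess n - \<theta> / lam\<bar> + \<bar>r n - 1\<bar> * Fh n (snd x) + \<bar>Fh n (snd x) - H (fst x)\<bar>) +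
      \<Gamma> * (\<bar>\<kappa> n - s2 / lam\<bar> + \<bar>e n\<bar> * (Fh n (snd x) * sqrt (real n) powr (-1)))"
    if n: "n0 \<le> n" and x: "0 \<le> snd x" "snd x \<le> fst x" and \<eta>: "0 < \<eta>" and \<epsilon>: "0 \<le> \<epsilon>"
      and uc: "\<And>w z. 0 \<le> w \<Longrightarrow> w \<le> R \<Longrightarrow> \<bar>z - w\<bar> \<le> \<eta> \<Longrightarrow> \<bar>\<gamma> z - \<gamma> w\<bar> \<le> \<epsilon>" for n x \<eta> \<epsilon> R
  proof -
    define w where "w = fst x"
    define D' where "D' = D n (snd x)"
    have w: "0 \<le> w" using x by (simp add: w_def)
    have [measurable]: "D' \<in> borel_measurable M" unfolding D'_def by (rule D_meas[OF n]) measurable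
    have iD: "integrable M D'" "integrable M (\<lambda>\<omega>. (D' \<omega>)\<^sup>2)" "integrable M (\<lambda>\<omega>. \<bar>D' \<omega>\<bar> powr p)"
      unfolding D'_def by (rule integrable_D[OF n] integrable_D_square(1)[OF n] integrable_D_powr(1)[OF n])+
    define w' where "w' \<omega> = max 0 (w + D' \<omega>)" for \<omega>
    have w'_nxt: "fst (nxt n x \<omega>) = w' \<omega>" for \<omega> by (simp add: nxt_def Let_def w'_def w_def D'_def)
    have [measurable]: "w' \<in> borel_measurable M" unfolding w'_def[abs_def] by measurable
    have iw': "integrable M w'" unfolding w'_def[abs_def] by (intro integrable_max integrable_const Bochner_Integration.integrable_add iD)
    have if': "integrable M (\<lambda>\<omega>. f (w' \<omega>))"
    proof (rule Bochner_Integration.integrable_bound[of _ "\<lambda>\<omega>. G * w' \<omega>"])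
      show "integrable M (\<lambda>\<omega>. G * w' \<omega>)" using iw' by simp
      have "0 \<le> w' \<omega>" for \<omega> by (simp add: w'_def)
      then show "AE \<omega> in M. norm (f (w' \<omega>)) \<le> norm (G * w' \<omega>)"
        using f_lin G0 by (intro AE_I2) (simp add: abs_mult)
    qed measurable
    \<comment> \<open>The idle part of the step, which reflection at zero adds to the net input.\<close>
    define I where "I \<omega> = w' \<omega> - w - D' \<omega>" for \<omega>
    have I: "0 \<le> I \<omega>" "I \<omega> \<le> \<bar>D' \<omega>\<bar>" for \<omega> using w by (auto simp: I_def w'_def)
    have iI: "integrable M I" unfolding I_def[abs_def] by (intro Bochner_Integration.integrable_diff integrable_const iw' iD)
    have pt: "\<bar>f (w' \<omega>) - f w - g w * D' \<omega> - \<gamma> w / 2 * (D' \<omega>)\<^sup>2\<bar> \<le>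
      3 * \<Gamma> * \<eta> * I \<omega> + (\<epsilon> + 2 * \<Gamma> * of_bool (R < w)) * (D' \<omega>)\<^sup>2 + 5 * \<Gamma> * \<eta> powr (2 - p) * \<bar>D' \<omega>\<bar> powr p" for \<omega>
    proof -
      define D where "D = D' \<omega>"
      have idle: "\<bar>f (w' \<omega>) - f (w + D)\<bar> \<le> 3 * \<Gamma> * (I \<omega>)\<^sup>2"
      proof (cases "0 \<le> w + D")
        case True
        then show ?thesis using \<Gamma>0 by (simp add: w'_def D_def)
      next
        case False
        then have "w' \<omega> = 0" "I \<omega> = - (w + D)" by (auto simp: w'_def D_def I_def)
        then have "(I \<omega>)\<^sup>2 = (w + D)\<^sup>2" "f (w' \<omega>) = 0" using f(1) by (simp_all only: power2_minus)
        then show ?thesis using f_neg[of "w + D"] by simp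
      qed
      have sq: "3 * \<Gamma> * (I \<omega>)\<^sup>2 \<le> 3 * \<Gamma> * (\<eta> * I \<omega> + \<eta> powr (2 - p) * \<bar>D\<bar> powr p)"
        using square_le_cutoff(1)[OF I[of \<omega>] \<eta> p2] \<Gamma>0 by (intro mult_left_mono) (auto simp: D_def)
      have rem: "\<bar>f (w + D) - f w - g w * D - \<gamma> w * D\<^sup>2 / 2\<bar> \<le> (\<epsilon> + 2 * \<Gamma> * of_bool (R < w)) * D\<^sup>2 + 2 * \<Gamma> * (\<eta> powr (2 - p) * \<bar>D\<bar> powr p)"
      proof (cases "w \<le> R \<and> \<bar>D\<bar> \<le> \<eta>")
        case True
        have "\<bar>f (w + D) - f w - g w * D - \<gamma> w * D\<^sup>2 / 2\<bar> \<le> \<epsilon> * D\<^sup>2"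
          by (rule second_order_remainder[OF f(2) g(1)]) (use True w in \<open>auto intro!: uc\<close>)
        moreover have "0 \<le> 2 * \<Gamma> * (\<eta> powr (2 - p) * \<bar>D\<bar> powr p)" using \<Gamma>0 by simp
        moreover have "(\<epsilon> + 2 * \<Gamma> * of_bool (R < w)) * D\<^sup>2 = \<epsilon> * D\<^sup>2" using True by simp
        ultimately show ?thesis by linarith
      next
        case False
        have "\<bar>f (w + D) - f w - g w * D - \<gamma> w * D\<^sup>2 / 2\<bar> \<le> (2 * \<Gamma>) * D\<^sup>2"
        proof (rule second_order_remainder[OF f(2) g(1)])
          fix z show "\<bar>\<gamma> z - \<gamma> w\<bar> \<le> 2 * \<Gamma>" using \<gamma>(2)[of z] \<gamma>(2)[of w] by linarith
        qed
        also have "\<dots> \<le> (\<epsilon> + 2 * \<Gamma> * of_bool (R < w)) * D\<^sup>2 + 2 * \<Gamma> * (\<eta> powr (2 - p) * \<bar>D\<bar> powr p)"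
        proof (cases "R < w")
          case True
          then have "(\<epsilon> + 2 * \<Gamma> * of_bool (R < w)) * D\<^sup>2 = \<epsilon> * D\<^sup>2 + 2 * \<Gamma> * D\<^sup>2" by (simp add: distrib_right)
          moreover have "0 \<le> \<epsilon> * D\<^sup>2" "0 \<le> 2 * \<Gamma> * (\<eta> powr (2 - p) * \<bar>D\<bar> powr p)" using \<epsilon> \<Gamma>0 by simp_all
          ultimately show ?thesis by linarith
        next
          case w: False
          then have "\<eta> < \<bar>D\<bar>" using False by auto
          then have "2 * \<Gamma> * D\<^sup>2 \<le> 2 * \<Gamma> * (\<eta> powr (2 - p) * \<bar>D\<bar> powr p)"
            using square_le_cutoff(2)[OF _ _ \<eta> p2, of 0 D] \<Gamma>0 by (intro mult_left_mono) auto
          moreover have "0 \<le> (\<epsilon> + 2 * \<Gamma> * of_bool (R < w)) * D\<^sup>2" using \<epsilon> \<Gamma>0 by simp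
          ultimately show ?thesis by linarith
        qed
        finally show ?thesis .
      qed
      have "\<gamma> w / 2 * D\<^sup>2 = \<gamma> w * D\<^sup>2 / 2" by simp
      then have "\<bar>f (w' \<omega>) - f w - g w * D - \<gamma> w / 2 * D\<^sup>2\<bar> \<le> \<bar>f (w' \<omega>) - f (w + D)\<bar> + \<bar>f (w + D) - f w - g w * D - \<gamma> w * D\<^sup>2 / 2\<bar>"
        by linarith
      also have "\<dots> \<le> 3 * \<Gamma> * (\<eta> * I \<omega> + \<eta> powr (2 - p) * \<bar>D\<bar> powr p) +
          ((\<epsilon> + 2 * \<Gamma> * of_bool (R < w)) * D\<^sup>2 + 2 * \<Gamma> * (\<eta> powr (2 - p) * \<bar>D\<bar> powr p))"
        using idle sq rem by linarith
      also have "\<dots> = 3 * \<Gamma> * \<eta> * I \<omega> + (\<epsilon> + 2 * \<Gamma> * of_bool (R < w)) * D\<^sup>2 + 5 * \<Gamma> * \<eta> powr (2 - p) * \<bar>D\<bar> powr p"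
        by (simp add: algebra_simps)
      finally show ?thesis unfolding D_def .
    qed
    have "\<bar>(\<integral>\<omega>. f (w' \<omega>) \<partial>M) - f w - g w * (\<integral>\<omega>. D' \<omega> \<partial>M) - \<gamma> w / 2 * (\<integral>\<omega>. (D' \<omega>)\<^sup>2 \<partial>M)\<bar> =
        \<bar>\<integral>\<omega>. f (w' \<omega>) - f w - g w * D' \<omega> - \<gamma> w / 2 * (D' \<omega>)\<^sup>2 \<partial>M\<bar>"
      using if' iD by (simp add: prob_space)
    also have "\<dots> \<le> (\<integral>\<omega>. \<bar>f (w' \<omega>) - f w - g w * D' \<omega> - \<gamma> w / 2 * (D' \<omega>)\<^sup>2\<bar> \<partial>M)" by (rule integral_abs_bound)
    also have "\<dots> \<le> (\<integral>\<omega>. 3 * \<Gamma> * \<eta> * I \<omega> + (\<epsilon> + 2 * \<Gamma> * of_bool (R < w)) * (D' \<omega>)\<^sup>2 + 5 * \<Gamma> * \<eta> powr (2 - p) * \<bar>D' \<omega>\<bar> powr p \<partial>M)"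
      by (intro integral_mono pt integrable_abs Bochner_Integration.integrable_diff Bochner_Integration.integrable_add
          integrable_mult_right integrable_const if' iD iI)
    also have "\<dots> = 3 * \<Gamma> * \<eta> * (\<integral>\<omega>. I \<omega> \<partial>M) + (\<epsilon> + 2 * \<Gamma> * of_bool (R < w)) * (\<integral>\<omega>. (D' \<omega>)\<^sup>2 \<partial>M) + 5 * \<Gamma> * \<eta> powr (2 - p) * (\<integral>\<omega>. \<bar>D' \<omega>\<bar> powr p \<partial>M)"
      using iI iD by simp
    finally have "real n * \<bar>(\<integral>\<omega>. f (w' \<omega>) \<partial>M) - f w - g w * (\<integral>\<omega>. D' \<omega> \<partial>M) - \<gamma> w / 2 * (\<integral>\<omega>. (D' \<omega>)\<^sup>2 \<partial>M)\<bar> \<le>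
       real n * (3 * \<Gamma> * \<eta> * (\<integral>\<omega>. I \<omega> \<partial>M) + (\<epsilon> + 2 * \<Gamma> * of_bool (R < w)) * (\<integral>\<omega>. (D' \<omega>)\<^sup>2 \<partial>M) + 5 * \<Gamma> * \<eta> powr (2 - p) * (\<integral>\<omega>. \<bar>D' \<omega>\<bar> powr p \<partial>M))"
      by (intro mult_left_mono) auto
    also have "\<dots> = 3 * \<Gamma> * \<eta> * (real n * (\<integral>\<omega>. I \<omega> \<partial>M)) + (\<epsilon> + 2 * \<Gamma> * of_bool (R < w)) * (real n * (\<integral>\<omega>. (D' \<omega>)\<^sup>2 \<partial>M)) +
        5 * \<Gamma> * \<eta> powr (2 - p) * (real n * (\<integral>\<omega>. \<bar>D' \<omega>\<bar> powr p \<partial>M))"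
      by (simp add: algebra_simps)
    also have "\<dots> \<le> 3 * \<Gamma> * \<eta> * (real n * (\<integral>\<omega>. I \<omega> \<partial>M)) + (\<epsilon> + 2 * \<Gamma> * of_bool (R < w)) * E2 + 5 * \<Gamma> * \<eta> powr (2 - p) * a n"
      unfolding D'_def E2_def a_def Ep_def using \<epsilon> \<Gamma>0
      by (intro add_mono mult_left_mono order_refl integrable_D_square(2)[OF n] integrable_D_powr(2)[OF n]) auto
    finally have main: "real n * \<bar>(\<integral>\<omega>. f (w' \<omega>) \<partial>M) - f w - g w * (\<integral>\<omega>. D' \<omega> \<partial>M) - \<gamma> w / 2 * (\<integral>\<omega>. (D' \<omega>)\<^sup>2 \<partial>M)\<bar> \<le>
        3 * \<Gamma> * \<eta> * (real n * (\<integral>\<omega>. I \<omega> \<partial>M)) + (\<epsilon> + 2 * \<Gamma> * of_bool (R < w)) * E2 + 5 * \<Gamma> * \<eta> powr (2 - p) * a n" .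
    have nI: "real n * (\<integral>\<omega>. I \<omega> \<partial>M) = real n * ((\<integral>\<omega>. w' \<omega> \<partial>M) - w) - y n x"
    proof -
      have I_mean: "(\<integral>\<omega>. I \<omega> \<partial>M) = (\<integral>\<omega>. w' \<omega> \<partial>M) - w - (\<integral>\<omega>. D' \<omega> \<partial>M)"
        unfolding I_def using iw' iD by (simp add: prob_space)
      have "real n * (\<integral>\<omega>. I \<omega> \<partial>M) = real n * ((\<integral>\<omega>. w' \<omega> \<partial>M) - w) - real n * (\<integral>\<omega>. D' \<omega> \<partial>M)"
        unfolding I_mean by (simp only: right_diff_distrib)
      then show ?thesis unfolding D'_def D_mean[OF n] y_def .
    qed
    define k where "k = real n * (\<integral>\<omega>. (D' \<omega>)\<^sup>2 \<partial>M)"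
    have k_eq: "k = \<kappa> n - F n (snd x / sqrt (real n)) * e n"
      unfolding k_def D'_def D_square_mean[OF n] by (simp add: \<kappa>_def e_def)
    have F_eq: "F n (snd x / sqrt (real n)) = Fh n (snd x) * sqrt (real n) powr (-1)"
      using sqrt_n[OF n] by (simp add: Fh_def powr_minus_divide)
    have kb: "\<bar>\<gamma> w / 2 * k - \<gamma> w / 2 * (s2 / lam)\<bar> \<le> \<Gamma> * (\<bar>\<kappa> n - s2 / lam\<bar> + \<bar>e n\<bar> * (Fh n (snd x) * sqrt (real n) powr (-1)))"
    proof -
      have "\<bar>\<gamma> w / 2 * k - \<gamma> w / 2 * (s2 / lam)\<bar> = \<bar>\<gamma> w / 2\<bar> * \<bar>k - s2 / lam\<bar>"
        by (simp only: abs_mult[symmetric] right_diff_distrib)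
      also have "\<dots> \<le> \<Gamma> * \<bar>k - s2 / lam\<bar>" using \<gamma>(2)[of w] by (intro mult_right_mono) auto
      also have "\<dots> \<le> \<Gamma> * (\<bar>\<kappa> n - s2 / lam\<bar> + \<bar>e n\<bar> * (Fh n (snd x) * sqrt (real n) powr (-1)))"
      proof (rule mult_left_mono[OF _ \<Gamma>0])
        have "\<bar>F n (snd x / sqrt (real n)) * e n\<bar> = \<bar>e n\<bar> * (Fh n (snd x) * sqrt (real n) powr (-1))"
          unfolding F_eq using Fh_nonneg[OF n] by (simp add: abs_mult)
        then show "\<bar>k - s2 / lam\<bar> \<le> \<bar>\<kappa> n - s2 / lam\<bar> + \<bar>e n\<bar> * (Fh n (snd x) * sqrt (real n) powr (-1))"
          unfolding k_eq by linarith
      qed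
      finally show ?thesis .
    qed
    have db: "\<bar>g w * y n x - g w * ((\<theta> / lam - H w) / lam)\<bar> \<le> G / lam * (\<bar>excess n - \<theta> / lam\<bar> + \<bar>r n - 1\<bar> * Fh n (snd x) + \<bar>Fh n (snd x) - H w\<bar>)"
    proof -
      define S where "S = (excess n - r n * Fh n (snd x)) - (\<theta> / lam - H w)"
      have "g w * y n x - g w * ((\<theta> / lam - H w) / lam) = g w * S / lam"
        unfolding y_def S_def by (simp add: right_diff_distrib diff_divide_distrib)
      then have "\<bar>g w * y n x - g w * ((\<theta> / lam - H w) / lam)\<bar> = \<bar>g w\<bar> / lam * \<bar>S\<bar>"
        using lam by (simp add: abs_mult)
      also have "\<dots> \<le> G / lam * \<bar>S\<bar>"
        using G[OF w] lam by (intro mult_right_mono divide_right_mono) auto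
      also have "\<dots> \<le> G / lam * (\<bar>excess n - \<theta> / lam\<bar> + \<bar>r n - 1\<bar> * Fh n (snd x) + \<bar>Fh n (snd x) - H w\<bar>)"
      proof (rule mult_left_mono)
        have "S = (excess n - \<theta> / lam) - (r n - 1) * Fh n (snd x) - (Fh n (snd x) - H w)"
          by (simp add: S_def algebra_simps)
        moreover have "\<bar>(r n - 1) * Fh n (snd x)\<bar> = \<bar>r n - 1\<bar> * Fh n (snd x)" using Fh_nonneg[OF n] by (simp add: abs_mult)
        ultimately show "\<bar>S\<bar> \<le> \<bar>excess n - \<theta> / lam\<bar> + \<bar>r n - 1\<bar> * Fh n (snd x) + \<bar>Fh n (snd x) - H w\<bar>" by linarith
      qed (use G0 lam in simp)
      finally show ?thesis .
    qed
    have target: "(H w - h) / lam = g w * ((\<theta> / lam - H w) / lam) + \<gamma> w / 2 * (s2 / lam)"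
    proof -
      have "(H w - h) / lam = (s2 / 2 * \<gamma> w + (\<theta> / lam - H w) * g w) / lam" unfolding stein[OF w] ..
      then show ?thesis by (simp add: add_divide_distrib mult_ac)
    qed
    define A where "A = (\<integral>\<omega>. f (w' \<omega>) \<partial>M) - f w"
    have "real n * \<bar>A - g w * (\<integral>\<omega>. D' \<omega> \<partial>M) - \<gamma> w / 2 * (\<integral>\<omega>. (D' \<omega>)\<^sup>2 \<partial>M)\<bar> =
        \<bar>real n * (A - g w * (\<integral>\<omega>. D' \<omega> \<partial>M) - \<gamma> w / 2 * (\<integral>\<omega>. (D' \<omega>)\<^sup>2 \<partial>M))\<bar>" by (simp add: abs_mult)
    also have "real n * (A - g w * (\<integral>\<omega>. D' \<omega> \<partial>M) - \<gamma> w / 2 * (\<integral>\<omega>. (D' \<omega>)\<^sup>2 \<partial>M)) =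
        real n * A - g w * (real n * (\<integral>\<omega>. D' \<omega> \<partial>M)) - \<gamma> w / 2 * k"
      by (simp add: k_def algebra_simps)
    also have "real n * (\<integral>\<omega>. D' \<omega> \<partial>M) = y n x" unfolding D'_def D_mean[OF n] y_def ..
    finally have "\<bar>real n * A - g w * y n x - \<gamma> w / 2 * k\<bar> \<le>
        3 * \<Gamma> * \<eta> * (real n * ((\<integral>\<omega>. w' \<omega> \<partial>M) - w) - y n x) + (\<epsilon> + 2 * \<Gamma> * of_bool (R < w)) * E2 + 5 * \<Gamma> * \<eta> powr (2 - p) * a n"
      using main unfolding nI A_def by simp
    then have "\<bar>real n * A - (g w * ((\<theta> / lam - H w) / lam) + \<gamma> w / 2 * (s2 / lam))\<bar> \<le>
        3 * \<Gamma> * \<eta> * (real n * ((\<integral>\<omega>. w' \<omega> \<partial>M) - w) - y n x) + (\<epsilon> + 2 * \<Gamma> * of_bool (R < w)) * E2 + 5 * \<Gamma> * \<eta> powr (2 - p) * a n +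
        G / lam * (\<bar>excess n - \<theta> / lam\<bar> + \<bar>r n - 1\<bar> * Fh n (snd x) + \<bar>Fh n (snd x) - H w\<bar>) +
        \<Gamma> * (\<bar>\<kappa> n - s2 / lam\<bar> + \<bar>e n\<bar> * (Fh n (snd x) * sqrt (real n) powr (-1)))"
      by (rule abs_replace_terms[OF _ db kb])
    moreover have "(\<epsilon> + 2 * \<Gamma> * of_bool (R < w)) * E2 = \<epsilon> * E2 + 2 * \<Gamma> * E2 * of_bool (R < w)"
      by (simp add: algebra_simps)
    ultimately show ?thesis unfolding w'_nxt A_def w_def target[unfolded w_def] by (simp only: add.assoc)
  qed
  show ?thesis
  proof (rule tendstoI)
    fix \<epsilon>0 :: real assume e0: "0 < \<epsilon>0"
    define t where "t = \<epsilon>0 / lam / 6"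
    have t: "0 < t" using e0 lam by (simp add: t_def)
    \<comment> \<open>A bound for \<open>n\<close> times the mean idle part: since the mean workload is stationary, it equals minus the mean drift.\<close>
    define K1 where "K1 = (2 * FM + (\<bar>\<theta> / lam\<bar> + 1)) / lam"
    have K1: "0 \<le> K1" using E lam by (simp add: K1_def)
    have small: "b * (t / (b + 1)) \<le> t" "0 < t / (b + 1)" if "0 \<le> b" for b
      using that t by (simp_all add: field_simps)
    define \<epsilon> where "\<epsilon> = t / (E2 + 1)"
    have \<epsilon>: "0 < \<epsilon>" "\<epsilon> * E2 \<le> t" using small[OF E(1)] by (simp_all add: \<epsilon>_def mult.commute)
    have nn: "0 \<le> 2 * \<Gamma> * E2" "0 \<le> 3 * \<Gamma> * K1" "0 \<le> G / lam" using E \<Gamma>0 K1 G0 lam by simp_all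
    obtain R where R: "1 \<le> R" "\<And>n. N \<le> n \<Longrightarrow> (\<integral>x. (1 + (max 0 (fst x)) powr m) * of_bool (R < fst x) \<partial>\<mu> n) \<le> t / (2 * \<Gamma> * E2 + 1)"
      using T(6)[OF small(2)[OF nn(1)]] by blast
    have "uniformly_continuous_on {-1..R + 1} \<gamma>"
      by (intro compact_uniformly_continuous continuous_on_subset[OF \<gamma>(1)]) auto
    then obtain \<eta>0 where \<eta>0: "0 < \<eta>0" "\<And>w z. w \<in> {-1..R + 1} \<Longrightarrow> z \<in> {-1..R + 1} \<Longrightarrow> dist z w < \<eta>0 \<Longrightarrow> dist (\<gamma> z) (\<gamma> w) < \<epsilon>"
      using \<epsilon>(1) unfolding uniformly_continuous_on_def by metis
    define \<eta> where "\<eta> = min (t / (3 * \<Gamma> * K1 + 1)) (min 1 (\<eta>0 / 2))"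
    have \<eta>: "0 < \<eta>" "3 * \<Gamma> * \<eta> * K1 \<le> t"
    proof -
      show "0 < \<eta>" using small(2)[OF nn(2)] \<eta>0 by (simp add: \<eta>_def)
      have "3 * \<Gamma> * K1 * \<eta> \<le> 3 * \<Gamma> * K1 * (t / (3 * \<Gamma> * K1 + 1))" using nn(2) by (intro mult_left_mono) (auto simp: \<eta>_def)
      then show "3 * \<Gamma> * \<eta> * K1 \<le> t" using small(1)[OF nn(2)] by (simp add: mult_ac)
    qed
    have uc: "\<bar>\<gamma> z - \<gamma> w\<bar> \<le> \<epsilon>" if "0 \<le> w" "w \<le> R" "\<bar>z - w\<bar> \<le> \<eta>" for w z
    proof -
      have "\<eta> \<le> 1" unfolding \<eta>_def by (rule min.coboundedI2, rule min.cobounded1)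
      moreover have "\<eta> \<le> \<eta>0 / 2" unfolding \<eta>_def by (rule min.coboundedI2, rule min.cobounded2)
      ultimately have "dist (\<gamma> z) (\<gamma> w) < \<epsilon>" using that \<eta>0(1) by (intro \<eta>0(2)) (auto simp: dist_real_def)
      then show ?thesis by (simp add: dist_real_def)
    qed
    have "\<forall>\<^sub>F n in sequentially. Q \<eta> n < t" by (rule order_tendstoD[OF Q_lim]) (rule t)
    moreover have "\<forall>\<^sub>F n in sequentially. r n < 2" by (rule order_tendstoD[OF r_lim]) simp
    moreover have "\<forall>\<^sub>F n in sequentially. \<bar>excess n\<bar> < \<bar>\<theta> / lam\<bar> + 1"
      by (rule order_tendstoD[OF tendsto_rabs[OF excess_lim]]) simp
    moreover have "\<forall>\<^sub>F n in sequentially. (\<integral>x. \<bar>Fh n (snd x) - H (max 0 (fst x))\<bar> \<partial>\<mu> n) \<le> t / (G / lam + 1)"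
      by (rule drift_error_lim) (rule small(2)[OF nn(3)])
    ultimately show "\<forall>\<^sub>F n in sequentially. dist (\<integral>x. H (max 0 (fst x)) \<partial>\<mu> n) h < \<epsilon>0"
      using eventually_ge_at_top[of N]
    proof eventually_elim
      case (elim n)
      have n: "n0 \<le> n" "N \<le> n" using elim T(1) by auto
      interpret mu: prob_space "\<mu> n" by (rule mu_prob[OF n(1)])
      have iw: "integrable (\<mu> n) (\<lambda>x. max 0 (fst x))" by (rule T(3)[OF n(2)])
      note iF = integrable_Fh_H[OF n(1) T(4)[OF n(2)]]
      have if': "integrable (\<mu> n) (\<lambda>x. f (max 0 (fst x)))"
      proof (rule Bochner_Integration.integrable_bound[of _ "\<lambda>x. G * max 0 (fst x)"])
        show "(\<lambda>x. f (max 0 (fst x))) \<in> borel_measurable (\<mu> n)" by (rule mu_meas[OF n(1)]) measurable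
        show "AE x in \<mu> n. norm (f (max 0 (fst x))) \<le> norm (G * max 0 (fst x))"
          using f_lin G0 by (intro AE_I2) simp
      qed (use iw in simp)
      have nxt0: "max 0 (fst (nxt n x \<omega>)) = fst (nxt n x \<omega>)" for x \<omega> by (simp add: nxt_def Let_def)
      have st: "(\<integral>x. (\<integral>\<omega>. fst (nxt n x \<omega>) \<partial>M) \<partial>\<mu> n) = (\<integral>x. max 0 (fst x) \<partial>\<mu> n)"
        "integrable (\<mu> n) (\<lambda>x. \<integral>\<omega>. fst (nxt n x \<omega>) \<partial>M)"
        "(\<integral>x. (\<integral>\<omega>. f (fst (nxt n x \<omega>)) \<partial>M) \<partial>\<mu> n) = (\<integral>x. f (max 0 (fst x)) \<partial>\<mu> n)"
        "integrable (\<mu> n) (\<lambda>x. \<integral>\<omega>. f (fst (nxt n x \<omega>)) \<partial>M)"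
        using stationarity[OF n(1) iw] stationarity[OF n(1) if'] by (simp_all add: nxt0)
      have io: "integrable (\<mu> n) (\<lambda>x. of_bool (R < fst x) :: real)"
        by (rule mu_integrable_bounded[OF n(1), where B = 1]) auto
      have iy: "integrable (\<mu> n) (y n)" unfolding y_def[abs_def] using iF(1) by simp
      define W where "W x = \<bar>real n * ((\<integral>\<omega>. f (fst (nxt n x \<omega>)) \<partial>M) - f (max 0 (fst x))) - (H (max 0 (fst x)) - h) / lam\<bar>" for x
      define B where "B x = 3 * \<Gamma> * \<eta> * (real n * ((\<integral>\<omega>. fst (nxt n x \<omega>) \<partial>M) - max 0 (fst x)) - y n x) + \<epsilon> * E2 + 2 * \<Gamma> * E2 * of_bool (R < fst x) +
        5 * \<Gamma> * \<eta> powr (2 - p) * a n + G / lam * (\<bar>excess n - \<theta> / lam\<bar> + \<bar>r n - 1\<bar> * Fh n (snd x) + \<bar>Fh n (snd x) - H (max 0 (fst x))\<bar>) +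
        \<Gamma> * (\<bar>\<kappa> n - s2 / lam\<bar> + \<bar>e n\<bar> * (Fh n (snd x) * sqrt (real n) powr (-1)))" for x
      have iW: "integrable (\<mu> n) W"
        unfolding W_def[abs_def] using st if' iF(2)
        by (intro integrable_abs Bochner_Integration.integrable_diff integrable_mult_right Bochner_Integration.integrable_divide) auto
      have iB: "integrable (\<mu> n) B"
        unfolding B_def[abs_def]
        by (intro Bochner_Integration.integrable_add integrable_mult_right integrable_mult_left Bochner_Integration.integrable_diff mu.integrable_const st iw iy io iF)
      have WB: "AE x in \<mu> n. W x \<le> B x"
        using mu_states[OF n(1)]
      proof eventually_elim
        case (elim x)
        then have m0: "max 0 (fst x) = fst x" by simp
        show ?case unfolding W_def B_def m0
          by (rule pointwise[OF n(1) _ _ \<eta>(1) _ uc]) (use elim \<epsilon> in auto)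
      qed
      have "\<bar>((\<integral>x. H (max 0 (fst x)) \<partial>\<mu> n) - h) / lam\<bar> =
          \<bar>\<integral>x. real n * ((\<integral>\<omega>. f (fst (nxt n x \<omega>)) \<partial>M) - f (max 0 (fst x))) - (H (max 0 (fst x)) - h) / lam \<partial>\<mu> n\<bar>"
        using st if' iF(2) by (simp add: mu.prob_space)
      also have "\<dots> \<le> (\<integral>x. W x \<partial>\<mu> n)" unfolding W_def by (rule integral_abs_bound)
      also have "\<dots> \<le> (\<integral>x. B x \<partial>\<mu> n)" by (rule integral_mono_AE[OF iW iB WB])
      also have "\<dots> = 3 * \<Gamma> * \<eta> * (real n * ((\<integral>x. (\<integral>\<omega>. fst (nxt n x \<omega>) \<partial>M) \<partial>\<mu> n) - (\<integral>x. max 0 (fst x) \<partial>\<mu> n)) - (\<integral>x. y n x \<partial>\<mu> n)) + \<epsilon> * E2 +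
        2 * \<Gamma> * E2 * (\<integral>x. of_bool (R < fst x) \<partial>\<mu> n) +
        5 * \<Gamma> * \<eta> powr (2 - p) * a n + G / lam * (\<bar>excess n - \<theta> / lam\<bar> + \<bar>r n - 1\<bar> * (\<integral>x. Fh n (snd x) \<partial>\<mu> n) + (\<integral>x. \<bar>Fh n (snd x) - H (max 0 (fst x))\<bar> \<partial>\<mu> n)) +
        \<Gamma> * (\<bar>\<kappa> n - s2 / lam\<bar> + \<bar>e n\<bar> * ((\<integral>x. Fh n (snd x) \<partial>\<mu> n) * sqrt (real n) powr (-1)))"
        unfolding B_def using st iw iy io iF by (simp add: mu.prob_space)
      also have "\<dots> \<le> t + t + t + (t + t)"
      proof -
        have FM1: "0 \<le> (\<integral>x. Fh n (snd x) \<partial>\<mu> n)" "(\<integral>x. Fh n (snd x) \<partial>\<mu> n) \<le> FM"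
        proof -
          show "0 \<le> (\<integral>x. Fh n (snd x) \<partial>\<mu> n)" using Fh_nonneg[OF n(1)] by (intro Bochner_Integration.integral_nonneg) auto
          have "(\<integral>x. Fh n (snd x) \<partial>\<mu> n) \<le> (\<integral>x. C * (1 + (max 0 (fst x)) powr m) \<partial>\<mu> n)"
            using iF(4) T(4)[OF n(2)] by (intro integral_mono_AE iF(1)) (auto elim!: eventually_mono)
          also have "\<dots> \<le> FM" unfolding FM_def using T(5)[OF n(2)] C by simp
          finally show "(\<integral>x. Fh n (snd x) \<partial>\<mu> n) \<le> FM" .
        qed
        have "r n * (\<integral>x. Fh n (snd x) \<partial>\<mu> n) \<le> 2 * FM"
          using FM1 elim(2) r_nonneg[OF n(1)] by (intro mult_mono) auto
        then have "- (excess n - r n * (\<integral>x. Fh n (snd x) \<partial>\<mu> n)) \<le> 2 * FM + (\<bar>\<theta> / lam\<bar> + 1)"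
          using elim(3) by linarith
        then have "- (excess n - r n * (\<integral>x. Fh n (snd x) \<partial>\<mu> n)) / lam \<le> K1"
          unfolding K1_def using lam by (intro divide_right_mono) auto
        moreover have "(\<integral>x. y n x \<partial>\<mu> n) = (excess n - r n * (\<integral>x. Fh n (snd x) \<partial>\<mu> n)) / lam"
          unfolding y_def using iF(1) by (simp add: mu.prob_space)
        ultimately have "- (\<integral>x. y n x \<partial>\<mu> n) \<le> K1" by (simp only: minus_divide_left)
        then have "3 * \<Gamma> * \<eta> * (- (\<integral>x. y n x \<partial>\<mu> n)) \<le> 3 * \<Gamma> * \<eta> * K1"
          using \<Gamma>0 \<eta> by (intro mult_left_mono) auto
        then have 1: "3 * \<Gamma> * \<eta> * (real n * ((\<integral>x. (\<integral>\<omega>. fst (nxt n x \<omega>) \<partial>M) \<partial>\<mu> n) - (\<integral>x. max 0 (fst x) \<partial>\<mu> n)) - (\<integral>x. y n x \<partial>\<mu> n)) \<le> t"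
          unfolding st(1) diff_self mult_zero_right diff_0 by (rule order_trans[OF _ \<eta>(2)])
        have "(\<integral>x. of_bool (R < fst x) \<partial>\<mu> n) \<le> (\<integral>x. (1 + (max 0 (fst x)) powr m) * of_bool (R < fst x) \<partial>\<mu> n)"
        proof (rule integral_mono[OF io])
          show "integrable (\<mu> n) (\<lambda>x. (1 + (max 0 (fst x)) powr m) * of_bool (R < fst x))"
          proof (rule Bochner_Integration.integrable_bound[of _ "\<lambda>x. 1 + (max 0 (fst x)) powr m"])
            show "integrable (\<mu> n) (\<lambda>x. 1 + (max 0 (fst x)) powr m)" using T(4)[OF n(2)] by simp
            show "(\<lambda>x. (1 + (max 0 (fst x)) powr m) * of_bool (R < fst x)) \<in> borel_measurable (\<mu> n)"
              by (rule mu_meas[OF n(1)]) measurable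
            show "AE x in \<mu> n. norm ((1 + (max 0 (fst x)) powr m) * of_bool (R < fst x)) \<le> norm (1 + (max 0 (fst x)) powr m)"
              by (rule AE_I2) simp
          qed
          show "of_bool (R < fst x) \<le> (1 + (max 0 (fst x)) powr m) * of_bool (R < fst x)" for x :: "real \<times> real"
            by (cases "R < fst x") simp_all
        qed
        then have "2 * \<Gamma> * E2 * (\<integral>x. of_bool (R < fst x) \<partial>\<mu> n) \<le> 2 * \<Gamma> * E2 * (t / (2 * \<Gamma> * E2 + 1))"
          using R(2)[OF n(2)] nn(1) by (intro mult_left_mono) auto
        then have 3: "2 * \<Gamma> * E2 * (\<integral>x. of_bool (R < fst x) \<partial>\<mu> n) \<le> t" using small(1)[OF nn(1)] by simp
        have "G / lam * (\<integral>x. \<bar>Fh n (snd x) - H (max 0 (fst x))\<bar> \<partial>\<mu> n) \<le> G / lam * (t / (G / lam + 1))"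
          using elim(4) nn(3) by (intro mult_left_mono)
        then have 5: "G / lam * (\<integral>x. \<bar>Fh n (snd x) - H (max 0 (fst x))\<bar> \<partial>\<mu> n) \<le> t" using small(1)[OF nn(3)] by simp
        have 4: "5 * \<Gamma> * \<eta> powr (2 - p) * a n + G / lam * (\<bar>excess n - \<theta> / lam\<bar> + \<bar>r n - 1\<bar> * (\<integral>x. Fh n (snd x) \<partial>\<mu> n)) +
            \<Gamma> * (\<bar>\<kappa> n - s2 / lam\<bar> + \<bar>e n\<bar> * ((\<integral>x. Fh n (snd x) \<partial>\<mu> n) * sqrt (real n) powr (-1))) \<le> Q \<eta> n"
          unfolding Q_def
          by (rule add_mono[OF add_left_mono[OF mult_left_mono[OF add_left_mono[OF mult_left_mono[OF FM1(2) abs_ge_zero]] nn(3)]]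
                mult_left_mono[OF add_left_mono[OF mult_left_mono[OF mult_right_mono[OF FM1(2) powr_ge_zero] abs_ge_zero]] \<Gamma>0]])
        show ?thesis by (rule error_budget[OF 1 \<epsilon>(2) 3 4 elim(1) 5])
      qed
      also have "\<dots> < \<epsilon>0 / lam" using e0 lam by (simp add: t_def field_simps)
      finally have "\<bar>(\<integral>x. H (max 0 (fst x)) \<partial>\<mu> n) - h\<bar> / lam < \<epsilon>0 / lam" using lam by simp
      then show ?case using lam by (simp add: dist_real_def divide_less_cancel)
    qed
  qed
qed

end

section \<open>From arrivals to time averages\<close>

lemma ennreal_integral_le_nn_integral:
  fixes f :: "'a \<Rightarrow> real"
  assumes "integrable M f"
  shows "ennreal (\<integral>x. f x \<partial>M) \<le> (\<integral>\<^sup>+x. ennreal (f x) \<partial>M)"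
proof -
  have i: "integrable M (\<lambda>x. max 0 (f x))" using assms by (intro integrable_max) auto
  have "(\<integral>x. f x \<partial>M) \<le> (\<integral>x. max 0 (f x) \<partial>M)" using assms i by (intro integral_mono) auto
  then have "ennreal (\<integral>x. f x \<partial>M) \<le> ennreal (\<integral>x. max 0 (f x) \<partial>M)" by (rule ennreal_leI)
  also have "\<dots> = (\<integral>\<^sup>+x. ennreal (max 0 (f x)) \<partial>M)" using i by (subst nn_integral_eq_integral) auto
  also have "\<dots> = (\<integral>\<^sup>+x. ennreal (f x) \<partial>M)"
    by (intro nn_integral_cong) (simp add: max_def ennreal_neg)
  finally show ?thesis .
qed

context heavy_traffic
begin

lemma X_tail_lim:
  assumes q: "0 \<le> q" "q < p" and c: "0 < c"
  shows "(\<lambda>n. \<integral>\<omega>. X \<omega> powr q * of_bool (c * sqrt (real n) < X \<omega>) \<partial>M) \<longlonglongrightarrow> 0"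
proof (rule tendsto_sandwich)
  show "\<forall>\<^sub>F n in sequentially. 0 \<le> (\<integral>\<omega>. X \<omega> powr q * of_bool (c * sqrt (real n) < X \<omega>) \<partial>M)"
    by (intro always_eventually allI Bochner_Integration.integral_nonneg) simp
  have iX: "integrable M (\<lambda>\<omega>. X \<omega> powr p)" using p2 by (intro X_moment) auto
  show "\<forall>\<^sub>F n in sequentially. (\<integral>\<omega>. X \<omega> powr q * of_bool (c * sqrt (real n) < X \<omega>) \<partial>M) \<le>
      (\<integral>\<omega>. X \<omega> powr p \<partial>M) * (c powr (q - p) * sqrt (real n) powr (q - p))"
    using eventually_ge_at_top[of n0]
  proof eventually_elim
    case (elim n)
    have "(\<integral>\<omega>. X \<omega> powr q * of_bool (c * sqrt (real n) < X \<omega>) \<partial>M) \<le> (\<integral>\<omega>. X \<omega> powr p * (c * sqrt (real n)) powr (q - p) \<partial>M)"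
    proof (rule integral_mono)
      show "integrable M (\<lambda>\<omega>. X \<omega> powr q * of_bool (c * sqrt (real n) < X \<omega>))"
      proof (rule Bochner_Integration.integrable_bound[of _ "\<lambda>\<omega>. X \<omega> powr q"])
        show "integrable M (\<lambda>\<omega>. X \<omega> powr q)" using q by (intro X_moment) auto
        show "AE \<omega> in M. norm (X \<omega> powr q * of_bool (c * sqrt (real n) < X \<omega>)) \<le> norm (X \<omega> powr q)"
          by (rule AE_I2) simp
      qed measurable
      show "integrable M (\<lambda>\<omega>. X \<omega> powr p * (c * sqrt (real n)) powr (q - p))" using iX by simp
      fix \<omega>
      have pos: "0 < c * sqrt (real n)" using c sqrt_n[OF elim] by simp
      show "X \<omega> powr q * of_bool (c * sqrt (real n) < X \<omega>) \<le> X \<omega> powr p * (c * sqrt (real n)) powr (q - p)"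
      proof (cases "c * sqrt (real n) < X \<omega>")
        case True
        have "X \<omega> powr q = X \<omega> powr p * X \<omega> powr (q - p)" by (simp flip: powr_add)
        also have "\<dots> \<le> X \<omega> powr p * (c * sqrt (real n)) powr (q - p)"
          using True pos q by (intro mult_left_mono powr_mono2') auto
        finally show ?thesis using True by simp
      qed simp
    qed
    also have "\<dots> = (\<integral>\<omega>. X \<omega> powr p \<partial>M) * (c powr (q - p) * sqrt (real n) powr (q - p))"
      by (simp add: powr_mult)
    finally show ?case .
  qed
  have "(\<lambda>n. (\<integral>\<omega>. X \<omega> powr p \<partial>M) * (c powr (q - p) * sqrt (real n) powr (q - p))) \<longlonglongrightarrow>
      (\<integral>\<omega>. X \<omega> powr p \<partial>M) * (c powr (q - p) * 0)"
    using q by (intro tendsto_intros sqrt_powr_lim) auto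
  then show "(\<lambda>n. (\<integral>\<omega>. X \<omega> powr p \<partial>M) * (c powr (q - p) * sqrt (real n) powr (q - p))) \<longlonglongrightarrow> 0" by simp
qed simp

text \<open>
  Here \<open>J n x \<omega>\<close> stands for the suitably scaled integral of the abandonment probability over the
  interarrival time \<open>u \<omega>\<close> that follows an arrival in state \<open>x\<close>. The workload moves there by at most a multiple of \<open>X \<omega> / sqrt n\<close>, so the integral
  is close to \<open>u \<omega> * H (fst x)\<close>, and \<open>u\<close> has mean 1. When the workload or \<open>X \<omega>\<close> is large, the growth bound
  gives an error of order \<open>X powr (m + 1)\<close>, which is integrable since \<open>m + 1 < p\<close>.
\<close>

lemma time_average_limit:
  fixes Pa :: "nat \<Rightarrow> real" and J :: "nat \<Rightarrow> real \<times> real \<Rightarrow> 'a \<Rightarrow> ennreal"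
  assumes Pa: "\<And>n. n0 \<le> n \<Longrightarrow> ennreal (Pa n) = (\<integral>\<^sup>+x. (\<integral>\<^sup>+\<omega>. J n x \<omega> \<partial>M) \<partial>\<mu> n)" "\<And>n. n0 \<le> n \<Longrightarrow> 0 \<le> Pa n"
    and J: "\<And>n x \<omega> a b. n0 \<le> n \<Longrightarrow> 0 \<le> snd x \<Longrightarrow> snd x \<le> fst x \<Longrightarrow> 0 \<le> u \<omega> \<Longrightarrow> 0 \<le> v \<omega> \<Longrightarrow>
      (\<And>y. 0 \<le> y \<Longrightarrow> \<bar>y - fst x\<bar> \<le> c0 / sqrt (real n) * X \<omega> \<Longrightarrow> a \<le> Fh n y \<and> Fh n y \<le> b) \<Longrightarrow> 0 \<le> b \<Longrightarrow>
      ennreal (u \<omega> * a) \<le> J n x \<omega> \<and> J n x \<omega> \<le> ennreal (u \<omega> * b)"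
    and h: "(\<lambda>n. \<integral>x. H (max 0 (fst x)) \<partial>\<mu> n) \<longlonglongrightarrow> h"
  shows "Pa \<longlonglongrightarrow> h"
proof -
  obtain N Km where T: "n0 \<le> N" "0 \<le> Km"
    "\<And>n. N \<le> n \<Longrightarrow> integrable (\<mu> n) (\<lambda>x. max 0 (fst x))"
    "\<And>n. N \<le> n \<Longrightarrow> integrable (\<mu> n) (\<lambda>x. (max 0 (fst x)) powr m)"
    "\<And>n. N \<le> n \<Longrightarrow> (\<integral>x. 1 + (max 0 (fst x)) powr m \<partial>\<mu> n) \<le> Km"
    "\<And>\<epsilon>. 0 < \<epsilon> \<Longrightarrow> \<exists>R\<ge>1. \<forall>n\<ge>N. (\<integral>x. (1 + (max 0 (fst x)) powr m) * of_bool (R < fst x) \<partial>\<mu> n) \<le> \<epsilon>"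
    using tail_moments by blast
  define A where "A = 2 powr m * max 1 (c0 powr m)"
  define C' where "C' = C * (1 + A)"
  have A: "2 powr m \<le> A" "2 powr m * c0 powr m \<le> A" "1 \<le> A"
  proof -
    show 1: "2 powr m \<le> A" unfolding A_def using mult_left_mono[of 1 "max 1 (c0 powr m)" "2 powr m"] by simp
    show "2 powr m * c0 powr m \<le> A" unfolding A_def by (intro mult_left_mono) auto
    show "1 \<le> A" using ge_one_powr_ge_zero[of 2 m] m 1 by simp
  qed
  have C': "0 < C'" using C A by (simp add: C'_def)
  define e1X where "e1X = (\<integral>\<omega>. X \<omega> \<partial>M)"
  define e2X where "e2X = (\<integral>\<omega>. X \<omega> powr (m + 1) \<partial>M)"
  have iXm: "integrable M (\<lambda>\<omega>. X \<omega> powr (m + 1))" using m by (intro X_moment) auto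
  have E: "0 \<le> e1X" "0 \<le> e2X"
    unfolding e1X_def e2X_def using X_nonneg by (auto intro: integral_nonneg_AE)
  have diff: "(\<lambda>n. Pa n - (\<integral>x. H (max 0 (fst x)) \<partial>\<mu> n)) \<longlonglongrightarrow> 0"
  proof (rule tendstoI)
    fix \<epsilon>0 :: real assume e0: "0 < \<epsilon>0"
    define t where "t = \<epsilon>0 / 4"
    have t: "0 < t" using e0 by (simp add: t_def)
    have q: "0 \<le> C' * (e1X + e2X)" using C' E by simp
    have tq: "0 < t / (C' * (e1X + e2X) + 1)" using q t by (intro divide_pos_pos) auto
    obtain R where R: "1 \<le> R" "\<And>n. N \<le> n \<Longrightarrow> (\<integral>x. (1 + (max 0 (fst x)) powr m) * of_bool (R < fst x) \<partial>\<mu> n) \<le> t / (C' * (e1X + e2X) + 1)"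
      using T(6)[OF tq] by blast
    have pre: "0 < t" "0 \<le> R" using t R(1) by auto
    obtain \<eta> N2 where \<eta>: "0 < \<eta>" "n0 \<le> N2"
      "\<And>n w y. N2 \<le> n \<Longrightarrow> 0 \<le> w \<Longrightarrow> w \<le> R \<Longrightarrow> 0 \<le> y \<Longrightarrow> \<bar>y - w\<bar> \<le> \<eta> \<Longrightarrow> \<bar>Fh n y - H w\<bar> \<le> t"
      using Fh_close_to_H[OF pre] by blast
    define big where "big n \<omega> = (of_bool (\<eta> / c0 * sqrt (real n) < X \<omega>) :: real)" for n \<omega>
    have [measurable]: "big n \<in> borel_measurable M" for n unfolding big_def[abs_def] by measurable
    define a1 where "a1 n = (\<integral>\<omega>. X \<omega> powr 1 * big n \<omega> \<partial>M)" for n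
    define a2 where "a2 n = (\<integral>\<omega>. X \<omega> powr (m + 1) * big n \<omega> \<partial>M)" for n
    have a_lim: "a1 \<longlonglongrightarrow> 0" "a2 \<longlonglongrightarrow> 0"
      unfolding a1_def a2_def big_def using p2 m \<eta>(1) c0(1) by (intro X_tail_lim; simp)+
    have "(\<lambda>n. C' * (Km * a1 n + a2 n)) \<longlonglongrightarrow> C' * (Km * 0 + 0)" by (intro tendsto_intros a_lim)
    then have "\<forall>\<^sub>F n in sequentially. C' * (Km * a1 n + a2 n) < t" by (rule order_tendstoD) (use t in simp)
    then show "\<forall>\<^sub>F n in sequentially. dist (Pa n - (\<integral>x. H (max 0 (fst x)) \<partial>\<mu> n)) 0 < \<epsilon>0"
      using eventually_ge_at_top[of N] eventually_ge_at_top[of N2]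
    proof eventually_elim
      case (elim n)
      have n: "n0 \<le> n" "N \<le> n" "N2 \<le> n" using elim T(1) by auto
      interpret mu: prob_space "\<mu> n" by (rule mu_prob[OF n(1)])
      define cn where "cn = c0 / sqrt (real n)"
      have cn: "0 < cn" "cn \<le> c0" using c0(1) sqrt_n[OF n(1)] n0 n(1) by (auto simp: cn_def divide_le_eq)
      define far where "far x = (of_bool (R < fst x) :: real)" for x :: "real \<times> real"
      define W where "W x = 1 + (max 0 (fst x)) powr m" for x :: "real \<times> real"
      define B where "B x \<omega> = t * u \<omega> + C' * (W x * far x * X \<omega> + W x * (X \<omega> powr 1 * big n \<omega>) + far x * X \<omega> powr (m + 1) + X \<omega> powr (m + 1) * big n \<omega>)" for x \<omega>
      define \<beta> where "\<beta> x = t + C' * (W x * far x * e1X + W x * a1 n + far x * e2X + a2 n)" for x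
      have ib: "integrable M (\<lambda>\<omega>. X \<omega> powr 1 * big n \<omega>)" "integrable M (\<lambda>\<omega>. X \<omega> powr (m + 1) * big n \<omega>)"
      proof -
        have i: "integrable M (\<lambda>\<omega>. X \<omega> powr q * big n \<omega>)" if "0 \<le> q" "q \<le> p" for q
        proof (rule Bochner_Integration.integrable_bound[of _ "\<lambda>\<omega>. X \<omega> powr q"])
          show "integrable M (\<lambda>\<omega>. X \<omega> powr q)" using that by (rule X_moment)
          show "AE \<omega> in M. norm (X \<omega> powr q * big n \<omega>) \<le> norm (X \<omega> powr q)"
            by (rule AE_I2) (simp add: big_def)
        qed measurable
        show "integrable M (\<lambda>\<omega>. X \<omega> powr 1 * big n \<omega>)" by (rule i) (use p2 in auto)
        show "integrable M (\<lambda>\<omega>. X \<omega> powr (m + 1) * big n \<omega>)" by (rule i) (use m in auto)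
      qed
      have iB: "integrable M (B x)" for x
        unfolding B_def by (intro Bochner_Integration.integrable_add integrable_mult_right ib iXm integrable_X integrable_uv)
      have B_int: "(\<integral>\<omega>. B x \<omega> \<partial>M) = \<beta> x" for x
        unfolding B_def \<beta>_def using ib iXm integrable_X integrable_uv
        by (simp add: u_mean e1X_def e2X_def a1_def a2_def)
      have sandwich: "ennreal (u \<omega> * H (fst x) - B x \<omega>) \<le> J n x \<omega> \<and> J n x \<omega> \<le> ennreal (u \<omega> * H (fst x) + B x \<omega>)"
        if x: "0 \<le> snd x" "snd x \<le> fst x" and uv: "0 \<le> u \<omega>" "0 \<le> v \<omega>" for x \<omega>
      proof -
        have x0: "0 \<le> fst x" using x by simp
        have X0: "0 \<le> X \<omega>" "u \<omega> \<le> X \<omega>" using uv by (auto simp: X_def)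
        \<comment> \<open>Small unless the workload exceeds \<open>R\<close> or the inputs exceed their natural scale by far; then the growth bound is used.\<close>
        define \<psi> where "\<psi> = t + C' * (W x + X \<omega> powr m) * (far x + big n \<omega>)"
        have psi0: "0 \<le> \<psi>" unfolding \<psi>_def W_def far_def big_def using t C' by (intro add_nonneg_nonneg mult_nonneg_nonneg) auto
        have close: "\<bar>Fh n y - H (fst x)\<bar> \<le> \<psi>" if y: "0 \<le> y" "\<bar>y - fst x\<bar> \<le> cn * X \<omega>" for y
        proof (cases "R < fst x \<or> \<eta> / c0 * sqrt (real n) < X \<omega>")
          case False
          have "cn * X \<omega> \<le> cn * (\<eta> / c0 * sqrt (real n))" using False cn by (intro mult_left_mono) auto
          also have "\<dots> = \<eta>" using c0(1) sqrt_n[OF n(1)] by (simp add: cn_def)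
          finally have "\<bar>Fh n y - H (fst x)\<bar> \<le> t" using False x0 y by (intro \<eta>(3)[OF n(3)]) auto
          then show ?thesis using False by (simp add: \<psi>_def far_def big_def)
        next
          case True
          define z where "z = fst x + c0 * X \<omega>"
          have cX: "cn * X \<omega> \<le> c0 * X \<omega>" "0 \<le> c0 * X \<omega>" using cn X0 c0(1) by (auto intro: mult_right_mono)
          then have "\<bar>Fh n y - H (fst x)\<bar> \<le> C * (1 + z powr m)"
            using y x0 by (intro Fh_H_crude[OF n(1)]) (auto simp: z_def)
          also have "z powr m \<le> (1 + 1) powr m * fst x powr m + (1 + 1 / 1) powr m * (c0 * X \<omega>) powr m"
            unfolding z_def using x0 cX m by (intro powr_add_le_split) auto
          also have "\<dots> = 2 powr m * fst x powr m + (2 powr m * c0 powr m) * X \<omega> powr m" by (simp add: powr_mult)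
          also have "\<dots> \<le> A * fst x powr m + A * X \<omega> powr m" using A by (intro add_mono mult_right_mono) auto
          finally have "\<bar>Fh n y - H (fst x)\<bar> \<le> C * (1 + (A * fst x powr m + A * X \<omega> powr m))" using C by simp
          also have "\<dots> \<le> C * ((1 + A) * (W x + X \<omega> powr m))"
          proof (intro mult_left_mono)
            have "(1 + A) * (W x + X \<omega> powr m) = 1 + (A * fst x powr m + A * X \<omega> powr m) + (A + fst x powr m + X \<omega> powr m)"
              using x0 by (simp add: W_def algebra_simps)
            moreover have "0 \<le> A + fst x powr m + X \<omega> powr m" using A by simp
            ultimately show "1 + (A * fst x powr m + A * X \<omega> powr m) \<le> (1 + A) * (W x + X \<omega> powr m)" by linarith
          qed (use C in simp)
          also have "\<dots> = C' * (W x + X \<omega> powr m) * 1" by (simp add: C'_def)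
          also have "\<dots> \<le> C' * (W x + X \<omega> powr m) * (far x + big n \<omega>)"
            using True C' by (intro mult_left_mono) (auto simp: far_def big_def W_def)
          finally show ?thesis using t by (simp add: \<psi>_def)
        qed
        have upsi: "u \<omega> * \<psi> \<le> B x \<omega>"
        proof -
          have XX: "X \<omega> * X \<omega> powr m = X \<omega> powr (m + 1)"
            using X0(1) by (cases "X \<omega> = 0") (simp_all add: powr_add mult.commute)
          have "u \<omega> * \<psi> = t * u \<omega> + u \<omega> * (C' * (W x + X \<omega> powr m) * (far x + big n \<omega>))" by (simp add: \<psi>_def algebra_simps)
          also have "\<dots> \<le> t * u \<omega> + X \<omega> * (C' * (W x + X \<omega> powr m) * (far x + big n \<omega>))"
          proof (intro add_left_mono mult_right_mono X0(2))
            show "0 \<le> C' * (W x + X \<omega> powr m) * (far x + big n \<omega>)"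
              using C' by (intro mult_nonneg_nonneg) (auto simp: W_def far_def big_def)
          qed
          also have "X \<omega> * (C' * (W x + X \<omega> powr m) * (far x + big n \<omega>)) =
              C' * (W x * far x * X \<omega> + W x * (X \<omega> * big n \<omega>) + far x * (X \<omega> * X \<omega> powr m) + (X \<omega> * X \<omega> powr m) * big n \<omega>)"
            by (simp add: algebra_simps)
          finally show ?thesis unfolding XX B_def using X0(1) by simp
        qed
        have "ennreal (u \<omega> * (H (fst x) - \<psi>)) \<le> J n x \<omega> \<and> J n x \<omega> \<le> ennreal (u \<omega> * (H (fst x) + \<psi>))"
        proof (rule J[OF n(1) x uv])
          show "H (fst x) - \<psi> \<le> Fh n y \<and> Fh n y \<le> H (fst x) + \<psi>"
            if "0 \<le> y" "\<bar>y - fst x\<bar> \<le> c0 / sqrt (real n) * X \<omega>" for y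
            using close[OF that(1)] that(2) by (auto simp: cn_def abs_le_iff)
          show "0 \<le> H (fst x) + \<psi>" using H_nonneg[OF x0] psi0 by simp
        qed
        moreover have "u \<omega> * H (fst x) - B x \<omega> \<le> u \<omega> * (H (fst x) - \<psi>)" "u \<omega> * (H (fst x) + \<psi>) \<le> u \<omega> * H (fst x) + B x \<omega>"
          using upsi by (simp_all add: algebra_simps)
        ultimately show ?thesis by (meson ennreal_leI order_trans)
      qed
      have ih: "integrable (\<mu> n) (\<lambda>x. H (max 0 (fst x)))" by (rule integrable_Fh_H(2)[OF n(1) T(4)[OF n(2)]])
      have iW: "integrable (\<mu> n) W" unfolding W_def[abs_def] using T(4)[OF n(2)] by simp
      have iWf: "integrable (\<mu> n) (\<lambda>x. W x * far x)"
      proof (rule Bochner_Integration.integrable_bound[OF iW])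
        show "(\<lambda>x. W x * far x) \<in> borel_measurable (\<mu> n)" unfolding W_def far_def by (rule mu_meas[OF n(1)]) measurable
        show "AE x in \<mu> n. norm (W x * far x) \<le> norm (W x)" by (rule AE_I2) (simp add: far_def)
      qed
      have if': "integrable (\<mu> n) far"
        by (rule mu_integrable_bounded[OF n(1), where B = 1]) (auto simp: far_def[abs_def])
      have i\<beta>: "integrable (\<mu> n) \<beta>" unfolding \<beta>_def[abs_def] using iW iWf if' by simp
      have \<beta>_int: "(\<integral>x. \<beta> x \<partial>\<mu> n) \<le> 3 * t"
      proof -
        have far_le: "(\<integral>x. far x \<partial>\<mu> n) \<le> (\<integral>x. W x * far x \<partial>\<mu> n)"
          by (rule integral_mono[OF if' iWf]) (simp add: far_def W_def)
        have Wf: "(\<integral>x. W x * far x \<partial>\<mu> n) \<le> t / (C' * (e1X + e2X) + 1)" using R(2)[OF n(2)] by (simp add: W_def far_def)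
        have expand: "t + C' * (z * e1X + Km * a1 n + z * e2X + a2 n) = t + C' * (e1X + e2X) * z + C' * (Km * a1 n + a2 n)" for z
          by (simp add: algebra_simps)
        have a0: "0 \<le> a1 n" unfolding a1_def by (intro Bochner_Integration.integral_nonneg) (simp add: big_def)
        have "(\<integral>x. \<beta> x \<partial>\<mu> n) = t + C' * ((\<integral>x. W x * far x \<partial>\<mu> n) * e1X + (\<integral>x. W x \<partial>\<mu> n) * a1 n + (\<integral>x. far x \<partial>\<mu> n) * e2X + a2 n)"
          unfolding \<beta>_def using iW iWf if' by (simp add: mu.prob_space)
        also have "\<dots> \<le> t + C' * (t / (C' * (e1X + e2X) + 1) * e1X + Km * a1 n + t / (C' * (e1X + e2X) + 1) * e2X + a2 n)"
          using C' E a0 Wf far_le T(5)[OF n(2)]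
          by (intro add_left_mono mult_left_mono add_mono mult_right_mono order_refl) (auto simp: W_def)
        also have "\<dots> = t + C' * (e1X + e2X) * (t / (C' * (e1X + e2X) + 1)) + C' * (Km * a1 n + a2 n)"
          by (rule expand)
        also have "\<dots> \<le> t + t + t"
        proof (intro add_mono order_refl)
          have "z * (t / (z + 1)) \<le> t" if "0 \<le> z" for z using that t by (simp add: field_simps)
          then show "C' * (e1X + e2X) * (t / (C' * (e1X + e2X) + 1)) \<le> t" using q by blast
        qed (use elim(1) in simp)
        finally show ?thesis by simp
      qed
      have iu: "integrable M u" by (rule integrable_uv)
      have lower: "ennreal ((\<integral>x. H (max 0 (fst x)) \<partial>\<mu> n) - (\<integral>x. \<beta> x \<partial>\<mu> n)) \<le> ennreal (Pa n)"
      proof -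
        have "ennreal ((\<integral>x. H (max 0 (fst x)) \<partial>\<mu> n) - (\<integral>x. \<beta> x \<partial>\<mu> n)) = ennreal (\<integral>x. H (max 0 (fst x)) - \<beta> x \<partial>\<mu> n)"
          using ih i\<beta> by simp
        also have "\<dots> \<le> (\<integral>\<^sup>+x. ennreal (H (max 0 (fst x)) - \<beta> x) \<partial>\<mu> n)"
          using ih i\<beta> by (intro ennreal_integral_le_nn_integral) simp
        also have "\<dots> \<le> (\<integral>\<^sup>+x. (\<integral>\<^sup>+\<omega>. J n x \<omega> \<partial>M) \<partial>\<mu> n)"
        proof (rule nn_integral_mono_AE, use mu_states[OF n(1)] in eventually_elim)
          case (elim x)
          have "ennreal (H (max 0 (fst x)) - \<beta> x) = ennreal (\<integral>\<omega>. u \<omega> * H (fst x) - B x \<omega> \<partial>M)"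
            using elim iu iB[of x] by (simp add: B_int u_mean)
          also have "\<dots> \<le> (\<integral>\<^sup>+\<omega>. ennreal (u \<omega> * H (fst x) - B x \<omega>) \<partial>M)"
            using iu iB[of x] by (intro ennreal_integral_le_nn_integral) simp
          also have "\<dots> \<le> (\<integral>\<^sup>+\<omega>. J n x \<omega> \<partial>M)"
          proof (rule nn_integral_mono_AE, use uv_nonneg in eventually_elim)
            case (elim \<omega>)
            then show ?case using sandwich[of x \<omega>] \<open>0 \<le> snd x \<and> snd x \<le> fst x\<close> by blast
          qed
          finally show ?case .
        qed
        finally show ?thesis unfolding Pa(1)[OF n(1)] .
      qed
      have B0: "0 \<le> B x \<omega>" if "0 \<le> u \<omega>" "0 \<le> v \<omega>" for x \<omega>
        unfolding B_def using that t C' by (auto intro!: add_nonneg_nonneg mult_nonneg_nonneg simp: W_def far_def big_def X_def)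
      have \<beta>0: "0 \<le> \<beta> x" for x
        unfolding B_int[symmetric] 
      proof (rule integral_nonneg_AE)
        show "AE \<omega> in M. 0 \<le> B x \<omega>" using uv_nonneg by eventually_elim (rule B0, auto)
      qed
      have upper: "ennreal (Pa n) \<le> ennreal ((\<integral>x. H (max 0 (fst x)) \<partial>\<mu> n) + (\<integral>x. \<beta> x \<partial>\<mu> n))"
      proof -
        have "ennreal (Pa n) \<le> (\<integral>\<^sup>+x. ennreal (H (max 0 (fst x)) + \<beta> x) \<partial>\<mu> n)"
          unfolding Pa(1)[OF n(1)]
        proof (rule nn_integral_mono_AE, use mu_states[OF n(1)] in eventually_elim)
          case (elim x)
          then have x0: "0 \<le> fst x" by simp
          have "(\<integral>\<^sup>+\<omega>. J n x \<omega> \<partial>M) \<le> (\<integral>\<^sup>+\<omega>. ennreal (u \<omega> * H (fst x) + B x \<omega>) \<partial>M)"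
          proof (rule nn_integral_mono_AE, use uv_nonneg in eventually_elim)
            case (elim \<omega>)
            then show ?case using sandwich[of x \<omega>] \<open>0 \<le> snd x \<and> snd x \<le> fst x\<close> by blast
          qed
          also have "\<dots> = ennreal (\<integral>\<omega>. u \<omega> * H (fst x) + B x \<omega> \<partial>M)"
          proof (rule nn_integral_eq_integral)
            show "integrable M (\<lambda>\<omega>. u \<omega> * H (fst x) + B x \<omega>)" using iu iB[of x] by simp
            show "AE \<omega> in M. 0 \<le> u \<omega> * H (fst x) + B x \<omega>"
              using uv_nonneg by eventually_elim (use B0 H_nonneg[OF x0] in simp)
          qed
          also have "\<dots> = ennreal (H (max 0 (fst x)) + \<beta> x)" using x0 iu iB[of x] by (simp add: B_int u_mean)
          finally show ?case .
        qed
        also have "\<dots> = ennreal (\<integral>x. H (max 0 (fst x)) + \<beta> x \<partial>\<mu> n)"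
          using ih i\<beta> \<beta>0 H_nonneg by (intro nn_integral_eq_integral) auto
        also have "\<dots> = ennreal ((\<integral>x. H (max 0 (fst x)) \<partial>\<mu> n) + (\<integral>x. \<beta> x \<partial>\<mu> n))" using ih i\<beta> by simp
        finally show ?thesis .
      qed
      have H0: "0 \<le> (\<integral>x. H (max 0 (fst x)) \<partial>\<mu> n)" using H_nonneg by (intro Bochner_Integration.integral_nonneg) auto
      have "(\<integral>x. H (max 0 (fst x)) \<partial>\<mu> n) - (\<integral>x. \<beta> x \<partial>\<mu> n) \<le> Pa n" using lower Pa(2)[OF n(1)] by (simp add: ennreal_le_iff)
      moreover have "Pa n \<le> (\<integral>x. H (max 0 (fst x)) \<partial>\<mu> n) + (\<integral>x. \<beta> x \<partial>\<mu> n)"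
      proof -
        have "0 \<le> (\<integral>x. \<beta> x \<partial>\<mu> n)" using \<beta>0 by (intro Bochner_Integration.integral_nonneg) auto
        with H0 have "0 \<le> (\<integral>x. H (max 0 (fst x)) \<partial>\<mu> n) + (\<integral>x. \<beta> x \<partial>\<mu> n)" by simp
        from ennreal_le_iff[OF this] upper show ?thesis by blast
      qed
      ultimately show ?case using \<beta>_int e0 by (simp add: dist_real_def abs_less_iff t_def)
    qed
  qed
  have "(\<lambda>n. (Pa n - (\<integral>x. H (max 0 (fst x)) \<partial>\<mu> n)) + (\<integral>x. H (max 0 (fst x)) \<partial>\<mu> n)) \<longlonglongrightarrow> 0 + h"
    by (intro tendsto_add diff h)
  then show ?thesis by simp
qed

end

section \<open>The limit of the abandonment probabilities\<close>

lemma (in prob_space) variance_pos_if_unbounded: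
  fixes f :: "'a \<Rightarrow> real"
  assumes [measurable]: "f \<in> borel_measurable M" and int: "integrable M f" "integrable M (\<lambda>\<omega>. (f \<omega>)\<^sup>2)"
    and unb: "\<And>x. 0 < x \<Longrightarrow> 0 < prob {\<omega> \<in> space M. x \<le> f \<omega>}"
  shows "0 < variance f"
proof (rule ccontr)
  assume "\<not> 0 < variance f"
  moreover have "0 \<le> variance f" by (rule variance_positive)
  ultimately have "variance f = 0" by simp
  moreover have "integrable M (\<lambda>\<omega>. (f \<omega> - expectation f)\<^sup>2)"
    using int by (simp add: power2_diff)
  ultimately have "AE \<omega> in M. (f \<omega> - expectation f)\<^sup>2 = 0"
    by (subst (asm) integral_nonneg_eq_0_iff_AE) auto
  then have "AE \<omega> in M. \<omega> \<notin> {\<omega> \<in> space M. \<bar>expectation f\<bar> + 1 \<le> f \<omega>}"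
    by eventually_elim auto
  then have "prob {\<omega> \<in> space M. \<bar>expectation f\<bar> + 1 \<le> f \<omega>} = 0"
    by (subst prob_eq_0) auto
  moreover have "0 < \<bar>expectation f\<bar> + 1" by linarith
  ultimately show False using unb by (metis less_irrefl)
qed

text \<open>
  Patience is independent of the other inputs, and a customer who finds the value \<open>l\<close> is served with
  probability \<open>1 - F l\<close>.
\<close>

lemma patience_expectations:
  assumes prim: "queue_primitives M u v d" and F: "F = cdf (distr M borel (d 1))"
    and v2: "integrable M (\<lambda>\<omega>. (v 1 \<omega>)\<^sup>2)"
  shows "(\<integral>\<omega>. v 1 \<omega> * of_bool (l < d 1 \<omega>) \<partial>M) = 1 - F l"
    and "(\<integral>\<omega>. (v 1 \<omega>)\<^sup>2 * of_bool (l < d 1 \<omega>) \<partial>M) = (1 - F l) * (\<integral>\<omega>. (v 1 \<omega>)\<^sup>2 \<partial>M)"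
    and "(\<integral>\<omega>. u 2 \<omega> * (v 1 \<omega> * of_bool (l < d 1 \<omega>)) \<partial>M) = 1 - F l"
    and "mono F" and "0 \<le> F x" and "F x \<le> 1"
proof -
  interpret prob_space M using prim by (simp add: queue_primitives_def)
  have ind: "indep_var borel (v 1) borel (d 1)" "indep_var borel (\<lambda>\<omega>. (u 2 \<omega>, 0::real)) borel (\<lambda>\<omega>. (v 1 \<omega>, d 1 \<omega>))"
    using primitives_indep[OF prim, of 2 1] by auto
  have vd_meas: "v 1 \<in> borel_measurable M" "d 1 \<in> borel_measurable M"
    using indep_var_rv1[OF ind(1)] indep_var_rv2[OF ind(1)] by auto
  note [measurable] = vd_meas vd_meas[unfolded One_nat_def]
  have uv: "\<forall>i\<ge>2. integrable M (u i) \<and> (\<integral>\<omega>. u i \<omega> \<partial>M) = 1" "\<forall>i\<ge>1. integrable M (v i) \<and> (\<integral>\<omega>. v i \<omega> \<partial>M) = 1"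
    using prim unfolding queue_primitives_def by blast+
  then have u: "integrable M (u 2)" "(\<integral>\<omega>. u 2 \<omega> \<partial>M) = 1" and v: "integrable M (v 1)" "(\<integral>\<omega>. v 1 \<omega> \<partial>M) = 1" by auto
  have F_eq: "F x = prob {\<omega> \<in> space M. d 1 \<omega> \<le> x}" for x
    unfolding F cdf_def by (subst measure_distr) (auto intro!: arg_cong[where f = prob])
  show "0 \<le> F x" "F x \<le> 1" by (simp_all add: F_eq)
  show "mono F" unfolding F_eq[abs_def] mono_def by (auto intro!: finite_measure_mono)
  have iI: "integrable M (\<lambda>\<omega>. of_bool (l < d 1 \<omega>) :: real)"
    by (rule integrable_const_bound[where B = 1]) auto
  have tail: "(\<integral>\<omega>. of_bool (l < d 1 \<omega>) \<partial>M) = 1 - F l"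
  proof -
    have "(\<integral>\<omega>. of_bool (l < d 1 \<omega>) \<partial>M) = (\<integral>\<omega>. 1 - indicator {\<omega> \<in> space M. d 1 \<omega> \<le> l} \<omega> \<partial>M)"
      by (intro Bochner_Integration.integral_cong) (auto simp: indicator_def)
    also have "\<dots> = 1 - F l"
    proof -
      have S: "{\<omega> \<in> space M. d 1 \<omega> \<le> l} \<in> events" by measurable
      then have "integrable M (indicator {\<omega> \<in> space M. d 1 \<omega> \<le> l} :: 'a \<Rightarrow> real)"
        by (rule integrable_real_indicator) (simp add: emeasure_eq_measure)
      then show ?thesis unfolding F_eq
        by (subst Bochner_Integration.integral_diff) (use S in \<open>simp_all add: prob_space del: One_nat_def\<close>)
    qed
    finally show ?thesis .
  qed
  have ind_f: "indep_var borel (\<lambda>\<omega>. f (v 1 \<omega>)) borel (\<lambda>\<omega>. of_bool (l < d 1 \<omega>) :: real)"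
    if "f \<in> borel_measurable borel" for f :: "real \<Rightarrow> real"
    using indep_var_compose[OF ind(1) that, of "\<lambda>x. of_bool (l < x) :: real" borel] by (simp add: comp_def)
  have e1: "(\<integral>\<omega>. v 1 \<omega> * of_bool (l < d 1 \<omega>) \<partial>M) = (\<integral>\<omega>. v 1 \<omega> \<partial>M) * (1 - F l)"
    using indep_var_lebesgue_integral[OF ind_f[of "\<lambda>x. x"] v(1) iI] tail by simp
  then show v1: "(\<integral>\<omega>. v 1 \<omega> * of_bool (l < d 1 \<omega>) \<partial>M) = 1 - F l" unfolding e1 v(2) by simp
  show "(\<integral>\<omega>. (v 1 \<omega>)\<^sup>2 * of_bool (l < d 1 \<omega>) \<partial>M) = (1 - F l) * (\<integral>\<omega>. (v 1 \<omega>)\<^sup>2 \<partial>M)"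
    using indep_var_lebesgue_integral[OF ind_f[of "\<lambda>x. x\<^sup>2"] v2 iI] tail by simp
  have iv: "integrable M (\<lambda>\<omega>. v 1 \<omega> * of_bool (l < d 1 \<omega>))"
    by (rule Bochner_Integration.integrable_bound[OF v(1)]) auto
  have "indep_var borel (fst \<circ> (\<lambda>\<omega>. (u 2 \<omega>, 0::real))) borel ((\<lambda>q. fst q * of_bool (l < snd q)) \<circ> (\<lambda>\<omega>. (v 1 \<omega>, d 1 \<omega>)))"
    by (rule indep_var_compose[OF ind(2)]) measurable
  then have "indep_var borel (u 2) borel (\<lambda>\<omega>. v 1 \<omega> * of_bool (l < d 1 \<omega>))" by (simp add: comp_def)
  from indep_var_lebesgue_integral[OF this u(1) iv]
  show "(\<integral>\<omega>. u 2 \<omega> * (v 1 \<omega> * of_bool (l < d 1 \<omega>)) \<partial>M) = 1 - F l" unfolding v1 u(2) by simp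
qed

context stationary_queue
begin

definition scaled_arrival_law :: "real \<Rightarrow> (real \<times> real) measure" where
  "scaled_arrival_law q = distr arrival_law borel (\<lambda>x. (q * fst x, q * snd x))"

lemma measurable_arrival_lawI: "f \<in> borel_measurable borel \<Longrightarrow> f \<in> borel_measurable arrival_law"
  by (simp cong: measurable_cong_sets)

lemma measurable_scaling: "(\<lambda>x :: real \<times> real. (q * fst x, q * snd x)) \<in> borel_measurable arrival_law" for q :: real
  by (rule measurable_arrival_lawI) measurable

lemma scaled_arrival_law_basic:
  "prob_space (scaled_arrival_law q)" "sets (scaled_arrival_law q) = sets borel"
  unfolding scaled_arrival_law_def
  by (rule prob_space.prob_space_distr[OF prob_arrival_law measurable_scaling]) simp

lemma AE_scaled_arrival_law:
  "0 \<le> q \<Longrightarrow> AE x in scaled_arrival_law q. 0 \<le> snd x \<and> snd x \<le> fst x"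
  unfolding scaled_arrival_law_def
proof (subst AE_distr_iff[OF measurable_scaling])
  assume q: "0 \<le> q"
  show "AE x in arrival_law. 0 \<le> snd (q * fst x, q * snd x) \<and> snd (q * fst x, q * snd x) \<le> fst (q * fst x, q * snd x)"
    using AE_arrival_law by eventually_elim (use q in \<open>simp add: mult_left_mono\<close>)
qed measurable

lemma distr_scaled_next_seen:
  assumes q: "0 < q" and N: "\<And>x \<omega>. N (q * fst x, q * snd x) \<omega> = (q * fst (next_seen x (E 0 \<omega>)), q * snd (next_seen x (E 0 \<omega>)))"
    and N_meas: "(\<lambda>z. N (fst z) (snd z)) \<in> borel_measurable (borel \<Otimes>\<^sub>M M)"
  shows "distr (scaled_arrival_law q \<Otimes>\<^sub>M M) borel (\<lambda>z. N (fst z) (snd z)) = scaled_arrival_law q"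
proof -
  let ?s = "\<lambda>x :: real \<times> real. (q * fst x, q * snd x)"
  interpret rho: prob_space arrival_law by (rule prob_arrival_law)
  have s [measurable]: "?s \<in> borel_measurable arrival_law" by (rule measurable_scaling)
  have ns [measurable]: "(\<lambda>p. next_seen (fst p) (E 0 (snd p))) \<in> borel_measurable (arrival_law \<Otimes>\<^sub>M M)"
  proof -
    have [measurable]: "fst \<in> borel_measurable (arrival_law \<Otimes>\<^sub>M M)"
      using measurable_fst[of arrival_law M] by (simp cong: measurable_cong_sets)
    show ?thesis by measurable
  qed
  have "scaled_arrival_law q \<Otimes>\<^sub>M M = distr arrival_law borel ?s \<Otimes>\<^sub>M distr M M (\<lambda>x. x)"
    unfolding scaled_arrival_law_def distr_id ..
  also have "\<dots> = distr (arrival_law \<Otimes>\<^sub>M M) (borel \<Otimes>\<^sub>M M) (\<lambda>(x, y). (?s x, y))"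
    by (rule pair_measure_distr) (auto simp: distr_id intro: sigma_finite_measure_axioms)
  finally have pair: "scaled_arrival_law q \<Otimes>\<^sub>M M = distr (arrival_law \<Otimes>\<^sub>M M) (borel \<Otimes>\<^sub>M M) (\<lambda>(x, y). (?s x, y))" .
  have m1: "(\<lambda>(x, y). (?s x, y)) \<in> measurable (arrival_law \<Otimes>\<^sub>M M) (borel \<Otimes>\<^sub>M M)"
    unfolding case_prod_beta' by (intro measurable_Pair measurable_compose[OF measurable_fst s] measurable_snd)
  have "distr (scaled_arrival_law q \<Otimes>\<^sub>M M) borel (\<lambda>z. N (fst z) (snd z)) =
      distr (arrival_law \<Otimes>\<^sub>M M) borel (\<lambda>z. ?s (next_seen (fst z) (E 0 (snd z))))"
    unfolding pair by (subst distr_distr[OF N_meas m1]) (simp add: comp_def case_prod_beta' N)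
  also have "\<dots> = distr (distr (arrival_law \<Otimes>\<^sub>M M) borel (\<lambda>z. next_seen (fst z) (E 0 (snd z)))) borel ?s"
    by (subst distr_distr[OF _ ns]) (auto simp: comp_def)
  also have "\<dots> = scaled_arrival_law q" unfolding distr_next_seen scaled_arrival_law_def ..
  finally show ?thesis .
qed

end

text \<open>
  A cost rate between \<open>a\<close> and \<open>b\<close> until the next arrival, expressed in the extended reals, where a negative
  \<open>a\<close> counts as zero.
\<close>

lemma residual_cost_sandwich:
  assumes k: "\<And>s. 0 \<le> s \<Longrightarrow> s < \<tau> \<Longrightarrow> ennreal a \<le> k (\<tau> - s, max 0 (y - s)) \<and> k (\<tau> - s, max 0 (y - s)) \<le> ennreal b"
    and \<tau>: "0 \<le> \<tau>"
  shows "ennreal a * ennreal \<tau> \<le> residual_cost k (\<tau>, y)" "residual_cost k (\<tau>, y) \<le> ennreal b * ennreal \<tau>"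
proof -
  have const: "ennreal z * ennreal \<tau> = (\<integral>\<^sup>+s. (if 0 \<le> s \<and> s < \<tau> then ennreal z else 0) \<partial>lborel)" for z
  proof -
    have "(\<integral>\<^sup>+s. (if 0 \<le> s \<and> s < \<tau> then ennreal z else 0) \<partial>lborel) = (\<integral>\<^sup>+s. ennreal z * indicator {0..<\<tau>} s \<partial>lborel)"
      by (intro nn_integral_cong) (simp add: indicator_def)
    also have "\<dots> = ennreal z * ennreal \<tau>" using \<tau> by (subst nn_integral_cmult_indicator) auto
    finally show ?thesis by simp
  qed
  show "ennreal a * ennreal \<tau> \<le> residual_cost k (\<tau>, y)" "residual_cost k (\<tau>, y) \<le> ennreal b * ennreal \<tau>"
    unfolding const residual_cost_def using k by (auto intro!: nn_integral_mono)
qed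

text \<open>
  The inversion formula for the cost rate \<open>F\<close>, carried over to the scaled arrival law.
\<close>

lemma (in stationary_queue) time_average_of_workload:
  fixes F :: "real \<Rightarrow> real"
  assumes F [measurable]: "F \<in> borel_measurable borel" and F01: "\<And>x. 0 \<le> F x" "\<And>x. F x \<le> 1" and q: "0 < q"
  shows "ennreal (q * (\<integral>x. F (snd x) \<partial>\<pi>)) = (\<integral>\<^sup>+x. (\<integral>\<^sup>+\<omega>. ennreal (q * r) *
     residual_cost (\<lambda>c. ennreal (F (snd c))) (fst (admit (fst x / q, snd x / q) (E 0 \<omega>)), fst (snd (admit (fst x / q, snd x / q) (E 0 \<omega>))))
      \<partial>M) \<partial>scaled_arrival_law q)"
proof -
  define R where "R x \<omega> = residual_cost (\<lambda>c. ennreal (F (snd c))) (fst (admit x (E 0 \<omega>)), fst (snd (admit x (E 0 \<omega>))))" for x \<omega>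
  have R_meas: "(\<lambda>p. R (f p) (g p)) \<in> borel_measurable N"
    if [measurable]: "f \<in> borel_measurable N" "g \<in> measurable N M" for f g and N :: "'z measure"
    unfolding R_def by measurable
  have R1: "R x \<in> borel_measurable M" for x using R_meas[of "\<lambda>_. x" M "\<lambda>\<omega>. \<omega>"] by simp
  have R2: "(\<lambda>x. \<integral>\<^sup>+\<omega>. R (h x) \<omega> \<partial>M) \<in> borel_measurable borel" if [measurable]: "h \<in> borel_measurable borel" for h :: "real \<times> real \<Rightarrow> real \<times> real"
    by (rule borel_measurable_nn_integral) (simp add: case_prod_beta' R_meas)
  have [measurable]: "(\<lambda>x. F (snd x)) \<in> borel_measurable \<pi>" by (simp cong: measurable_cong_sets add: sets_pi)
  have "(\<integral>\<^sup>+x. (\<integral>\<^sup>+\<omega>. ennreal (q * r) * R (fst x / q, snd x / q) \<omega> \<partial>M) \<partial>scaled_arrival_law q) =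
      (\<integral>\<^sup>+x. ennreal (q * r) * (\<integral>\<^sup>+\<omega>. R (fst x / q, snd x / q) \<omega> \<partial>M) \<partial>scaled_arrival_law q)"
    by (intro nn_integral_cong nn_integral_cmult R1)
  also have "\<dots> = (\<integral>\<^sup>+x. ennreal (q * r) * (\<integral>\<^sup>+\<omega>. R (fst (q * fst x, q * snd x) / q, snd (q * fst x, q * snd x) / q) \<omega> \<partial>M) \<partial>arrival_law)"
    unfolding scaled_arrival_law_def
  proof (subst nn_integral_distr[OF measurable_scaling])
    have [measurable]: "(\<lambda>x. \<integral>\<^sup>+\<omega>. R (fst x / q, snd x / q) \<omega> \<partial>M) \<in> borel_measurable borel" by (rule R2) measurable
    show "(\<lambda>x. ennreal (q * r) * (\<integral>\<^sup>+\<omega>. R (fst x / q, snd x / q) \<omega> \<partial>M))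
        \<in> borel_measurable (distr arrival_law borel (\<lambda>x. (q * fst x, q * snd x)))"
      by (simp, measurable)
  qed (rule refl)
  also have "\<dots> = (\<integral>\<^sup>+x. ennreal (q * r) * (\<integral>\<^sup>+\<omega>. R x \<omega> \<partial>M) \<partial>arrival_law)"
    using q by simp
  also have "\<dots> = ennreal (q * r) * (\<integral>\<^sup>+x. (\<integral>\<^sup>+\<omega>. R x \<omega> \<partial>M) \<partial>arrival_law)"
    by (rule nn_integral_cmult, rule measurable_arrival_lawI, rule R2) measurable
  also have "\<dots> = ennreal q * (ennreal r * (\<integral>\<^sup>+x. (\<integral>\<^sup>+\<omega>. R x \<omega> \<partial>M) \<partial>arrival_law))"
    using q rate_pos by (simp add: ennreal_mult mult.assoc)
  also have "ennreal r * (\<integral>\<^sup>+x. (\<integral>\<^sup>+\<omega>. R x \<omega> \<partial>M) \<partial>arrival_law) = (\<integral>\<^sup>+x. ennreal (F (snd x)) \<partial>\<pi>)"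
    unfolding R_def by (rule inversion[symmetric]) (auto simp: F01 ennreal_le_1)
  also have "\<dots> = ennreal (\<integral>x. F (snd x) \<partial>\<pi>)"
    by (rule nn_integral_eq_integral) (auto simp: F01 intro!: pi.integrable_const_bound[where B = 1])
  also have "ennreal q * \<dots> = ennreal (q * (\<integral>x. F (snd x) \<partial>\<pi>))"
    using q F01 by (intro ennreal_mult[symmetric]) (auto intro!: Bochner_Integration.integral_nonneg)
  finally show ?thesis by (simp add: R_def)
qed

theorem corollary1:
  fixes M :: "'a measure"
    and u v :: "nat \<Rightarrow> 'a \<Rightarrow> real"
    and d :: "nat \<Rightarrow> nat \<Rightarrow> 'a \<Rightarrow> real"
    and arr_rate srv_rate :: "nat \<Rightarrow> real"
    and F :: "nat \<Rightarrow> real \<Rightarrow> real"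
    and V :: "nat \<Rightarrow> real \<times> real \<Rightarrow> real \<Rightarrow> 'a \<Rightarrow> real"
    and \<pi> :: "nat \<Rightarrow> (real \<times> real) measure"
    and H :: "real \<Rightarrow> real"
    and p lam \<theta> m C \<sigma>2 c :: real
    and N :: "'b measure"
    and Vinf :: "'b \<Rightarrow> real"
  assumes primitives: "\<And>n. n \<ge> 1 \<Longrightarrow> queue_primitives M u v (d n)"
    and rates_pos: "\<And>n. n \<ge> 1 \<Longrightarrow> arr_rate n > 0 \<and> srv_rate n > 0"
    and F_def: "\<And>n. n \<ge> 1 \<Longrightarrow> F n = cdf (distr M borel (d n 1))"
    and offered_waiting: "\<And>n x. n \<ge> 1 \<Longrightarrow> x \<in> queue_states \<Longrightarrow>
          offered_waiting_process M (\<lambda>j \<omega>. u j \<omega> / arr_rate n) (\<lambda>j \<omega>. v j \<omega> / srv_rate n) (d n) x (V n x)"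
    and A1: "p > 2" "integrable M (\<lambda>\<omega>. u 2 \<omega> powr p + v 2 \<omega> powr p)"
    and A2: "lam > 0" "\<And>n. n \<ge> 1 \<Longrightarrow> arr_rate n = real n * lam"
          "(\<lambda>n. srv_rate n / real n) \<longlonglongrightarrow> lam"
          "(\<lambda>n. sqrt (real n) * (lam - srv_rate n / real n)) \<longlonglongrightarrow> \<theta>"
    and A3: "\<And>n. n \<ge> 1 \<Longrightarrow> F n 0 = 0"
          "\<And>x. x \<ge> 0 \<Longrightarrow> H x \<ge> 0"
          "\<exists>H'. (\<forall>x\<ge>0. (H has_real_derivative H' x) (at x within {0..})) \<and> continuous_on {0..} H'"
          "\<And>K. K > 0 \<Longrightarrow>
             uniform_limit {0..K} (\<lambda>n x. sqrt (real n) * F n (x / sqrt (real n))) H sequentially"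
    and A4: "\<exists>h::ereal. ((\<lambda>x. ereal (H x)) \<longlongrightarrow> h) at_top \<and> h > ereal (\<theta> / lam)"
    and A5: "\<And>x. x > 0 \<Longrightarrow> \<P>(\<omega> in M. u 2 \<omega> \<ge> x) > 0"
    and growth: "0 < m" "m < p - 1" "C > 0"
          "\<And>n x. n \<ge> 1 \<Longrightarrow> x \<ge> 0 \<Longrightarrow>
             sqrt (real n) * F n (x / sqrt (real n)) \<le> C * (1 + x powr m)"
    and stationary: "\<forall>\<^sub>F n in sequentially.
          stationary_distribution M (queue_process (\<lambda>j \<omega>. u j \<omega> / arr_rate n) (V n)) (\<pi> n)"
    and sigma: "\<sigma>2 = (prob_space.variance M (u 2) + prob_space.variance M (v 2)) / lam"
    and normalization: "c > 0" "(limit_density c \<sigma>2 \<theta> lam H has_integral 1) {0..}"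
    and limit_variable: "prob_space N"
          "distributed N lborel Vinf (\<lambda>x. ennreal (limit_density c \<sigma>2 \<theta> lam H x))"
          "\<And>\<omega>. \<omega> \<in> space N \<Longrightarrow> Vinf \<omega> \<ge> 0"
  shows "(\<lambda>n. sqrt (real n) * abandonment_probability (F n) (\<pi> n))
           \<longlonglongrightarrow> prob_space.expectation N (\<lambda>\<omega>. H (Vinf \<omega>))"
proof -
  have prim1: "queue_primitives M u v (d 1)" using primitives by simp
  interpret prob_space M using prim1 by (simp add: queue_primitives_def)
  have pr: "\<forall>i\<ge>2. integrable M (u i) \<and> (\<integral>\<omega>. u i \<omega> \<partial>M) = 1" "\<forall>i\<ge>1. integrable M (v i) \<and> (\<integral>\<omega>. v i \<omega> \<partial>M) = 1"
    "\<forall>i\<ge>2. AE \<omega> in M. 0 \<le> u i \<omega>" "\<forall>i\<ge>1. AE \<omega> in M. 0 \<le> v i \<omega>" "\<forall>i\<ge>1. distr M borel (v i) = distr M borel (v 1)"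
    using prim1 unfolding queue_primitives_def by blast+
  have u_int: "integrable M (u 2)" "(\<integral>\<omega>. u 2 \<omega> \<partial>M) = 1" and v_int: "integrable M (v 1)" "(\<integral>\<omega>. v 1 \<omega> \<partial>M) = 1" and v2_int: "integrable M (v 2)"
    using pr(1,2) by auto
  have u_meas [measurable]: "u 2 \<in> borel_measurable M" and v_meas [measurable]: "v 1 \<in> borel_measurable M" "v 2 \<in> borel_measurable M"
    using u_int v_int v2_int by auto
  note [measurable] = v_meas(1)[unfolded One_nat_def]
  have ae_u: "AE \<omega> in M. 0 \<le> u 2 \<omega>" and ae_v: "AE \<omega> in M. 0 \<le> v 1 \<omega>" using pr(3,4) by auto
  have ae_uv: "AE \<omega> in M. 0 \<le> u 2 \<omega> \<and> 0 \<le> v 1 \<omega>" using ae_u ae_v by eventually_elim simp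
  have up: "integrable M (\<lambda>\<omega>. u 2 \<omega> powr p)"
    by (rule Bochner_Integration.integrable_bound[OF A1(2)]) auto
  have vp2: "integrable M (\<lambda>\<omega>. v 2 \<omega> powr p)"
    by (rule Bochner_Integration.integrable_bound[OF A1(2)]) auto
  have vp: "integrable M (\<lambda>\<omega>. v 1 \<omega> powr p)"
  proof -
    have same: "distr M borel (v 2) = distr M borel (v 1)" using pr(5)[rule_format, of 2] by simp
    have "integrable (distr M borel (v 2)) (\<lambda>x. x powr p)" using vp2 by (subst integrable_distr_eq) auto
    then have "integrable (distr M borel (v 1)) (\<lambda>x. x powr p)" unfolding same .
    then show ?thesis by (subst (asm) integrable_distr_eq) auto
  qed
  have square: "integrable M (\<lambda>\<omega>. (f \<omega>)\<^sup>2)" if [measurable]: "f \<in> borel_measurable M" and nn: "AE \<omega> in M. 0 \<le> f \<omega>"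
    and ip: "integrable M (\<lambda>\<omega>. f \<omega> powr p)" for f :: "'a \<Rightarrow> real"
  proof (rule Bochner_Integration.integrable_bound[of _ "\<lambda>\<omega>. 1 + f \<omega> powr p"])
    show "integrable M (\<lambda>\<omega>. 1 + f \<omega> powr p)" using ip by simp
    show "AE \<omega> in M. norm ((f \<omega>)\<^sup>2) \<le> norm (1 + f \<omega> powr p)" using nn
    proof eventually_elim
      case (elim \<omega>)
      have "f \<omega> powr 2 \<le> 1 + f \<omega> powr p" using elim A1(1) by (intro powr_le_one_add) auto
      then show ?case using elim by (simp add: powr_numeral)
    qed
  qed measurable
  have u2: "integrable M (\<lambda>\<omega>. (u 2 \<omega>)\<^sup>2)" and v2: "integrable M (\<lambda>\<omega>. (v 1 \<omega>)\<^sup>2)"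
    using square[OF u_meas ae_u up] square[OF v_meas(1) ae_v vp] .
  obtain n1 where n1: "\<And>n. n1 \<le> n \<Longrightarrow> stationary_distribution M (queue_process (\<lambda>j \<omega>. u j \<omega> / arr_rate n) (V n)) (\<pi> n)"
    using stationary unfolding eventually_sequentially by blast
  define n0 where "n0 = max 1 n1"
  have n0: "1 \<le> n" "n1 \<le> n" if "n0 \<le> n" for n using that by (auto simp: n0_def)
  \<comment> \<open>Customer \<open>k + 1\<close> brings his own service time and patience; the interarrival time after him has index \<open>k + 2\<close>.\<close>
  define E where "E n k \<omega> = (u (k + 2) \<omega> / arr_rate n, v (k + 1) \<omega> / srv_rate n, d n (k + 1) \<omega>)" for n k \<omega>
  have sq: "stationary_queue M (E n) (arr_rate n) (\<pi> n)" if n: "n0 \<le> n" for n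
    unfolding E_def[abs_def]
    by (rule stationary_queueI[OF primitives[OF n0(1)[OF n]] _ _ offered_waiting[OF n0(1)[OF n]] n1[OF n0(2)[OF n]]])
      (use rates_pos[OF n0(1)[OF n]] in auto)
  define \<mu> where "\<mu> n = stationary_queue.scaled_arrival_law M (E n) (arr_rate n) (\<pi> n) (sqrt (real n))" for n
  have pat: "(\<integral>\<omega>. v 1 \<omega> * of_bool (l < d n 1 \<omega>) \<partial>M) = 1 - F n l"
      "(\<integral>\<omega>. (v 1 \<omega>)\<^sup>2 * of_bool (l < d n 1 \<omega>) \<partial>M) = (1 - F n l) * (\<integral>\<omega>. (v 1 \<omega>)\<^sup>2 \<partial>M)"
      "(\<integral>\<omega>. u 2 \<omega> * (v 1 \<omega> * of_bool (l < d n 1 \<omega>)) \<partial>M) = 1 - F n l"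
      "mono (F n)" "0 \<le> F n x" "F n x \<le> 1" if n: "n0 \<le> n" for n l x
    using patience_expectations[OF primitives[OF n0(1)[OF n]] F_def[OF n0(1)[OF n]] v2] by auto
  have d_meas: "d n 1 \<in> borel_measurable M" if n: "n0 \<le> n" for n
    using primitives_indep(1)[OF primitives[OF n0(1)[OF n]], of 2 1] indep_var_rv2 by auto
  obtain h where h: "((\<lambda>x. ereal (H x)) \<longlongrightarrow> h) at_top" "ereal (\<theta> / lam) < h" using A4 by auto
  \<comment> \<open>The limit \<open>h\<close> of \<open>H\<close> may be infinite, so the level \<open>x0\<close> is found from a finite \<open>z\<close> in between.\<close>
  obtain z where z: "ereal (\<theta> / lam) < ereal z" "ereal z < h" using ereal_dense2[OF h(2)] by blast
  have "\<forall>\<^sub>F x in at_top. ereal z < ereal (H x) \<and> 0 \<le> x"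
    using order_tendstoD(1)[OF h(1) z(2)] eventually_ge_at_top[of 0] by eventually_elim simp
  then obtain x0 where x0: "z < H x0" "0 \<le> x0" using eventually_happens[of _ at_top] by (force simp: less_ereal.simps)
  define \<delta> where "\<delta> = z - \<theta> / lam"
  have \<delta>: "0 < \<delta>" "\<theta> / lam + \<delta> \<le> H x0" using z(1) x0(1) by (simp_all add: \<delta>_def)
  have H_cont: "continuous_on {0..} H"
  proof -
    obtain H' where "\<And>x. 0 \<le> x \<Longrightarrow> (H has_real_derivative H' x) (at x within {0..})" using A3(3) by blast
    then show ?thesis by (intro DERIV_continuous_on) auto
  qed
  define Nx where "Nx n x \<omega> = (let w = max 0 (fst x + (sqrt (real n) / srv_rate n * v 1 \<omega> * of_bool (snd x / sqrt (real n) < d n 1 \<omega>)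
            - 1 / (lam * sqrt (real n)) * u 2 \<omega>)) in (w, if 0 < u 2 \<omega> then w else snd x))" for n and x :: "real \<times> real" and \<omega>
  interpret HT: heavy_traffic M "u 2" "v 1" "\<lambda>n. d n 1" F H srv_rate \<mu> lam \<theta> p m C x0 \<delta> n0
  proof (intro heavy_traffic.intro heavy_traffic_axioms.intro)
    show "prob_space M" by (rule prob_space_axioms)
    show "prob_space (\<mu> n)" "sets (\<mu> n) = sets borel" if n: "n0 \<le> n" for n
      unfolding \<mu>_def by (rule stationary_queue.scaled_arrival_law_basic[OF sq[OF n]])+
    show "AE x in \<mu> n. 0 \<le> snd x \<and> snd x \<le> fst x" if n: "n0 \<le> n" for n
      unfolding \<mu>_def by (rule stationary_queue.AE_scaled_arrival_law[OF sq[OF n]]) simp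
    show "distr (\<mu> n \<Otimes>\<^sub>M M) borel
       (\<lambda>q. let w = max 0 (fst (fst q) + (sqrt (real n) / srv_rate n * v 1 (snd q) * of_bool (snd (fst q) / sqrt (real n) < d n 1 (snd q))
            - 1 / (lam * sqrt (real n)) * u 2 (snd q)))
          in (w, if 0 < u 2 (snd q) then w else snd (fst q))) = \<mu> n" if n: "n0 \<le> n" for n
    proof -
      define q where "q = sqrt (real n)"
      have q: "0 < q" "real n = q * q" using n0(1)[OF n] by (auto simp: q_def)
      have mx: "q * max 0 y = max 0 (q * y)" for y using q(1) by (simp add: max_def zero_le_mult_iff)
      have rates: "0 < srv_rate n" "arr_rate n = q * q * lam" using rates_pos[OF n0(1)[OF n]] A2(2)[OF n0(1)[OF n]] q(2) by auto
      have "distr (stationary_queue.scaled_arrival_law M (E n) (arr_rate n) (\<pi> n) q \<Otimes>\<^sub>M M) borel (\<lambda>z. Nx n (fst z) (snd z)) =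
          stationary_queue.scaled_arrival_law M (E n) (arr_rate n) (\<pi> n) q"
      proof (rule stationary_queue.distr_scaled_next_seen[OF sq[OF n] q(1)])
        fix x :: "real \<times> real" and \<omega>
        have alg: "q * fst x + (q * v 1 \<omega> / srv_rate n - u 2 \<omega> / (lam * q)) = q * (fst x + v 1 \<omega> / srv_rate n - u 2 \<omega> / (q * q * lam))"
            "q * fst x - u 2 \<omega> / (lam * q) = q * (fst x - u 2 \<omega> / (q * q * lam))"
          using q(1) A2(1) rates(1) by (simp_all add: field_simps)
        have pos: "0 < u 2 \<omega> / (q * q * lam) \<longleftrightarrow> 0 < u 2 \<omega>" 
        proof -
          have "0 < q * q * lam" using q(1) A2(1) by (intro mult_pos_pos)
          then show ?thesis by (rule pos_less_divide_eq[THEN trans]) simp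
        qed
        show "Nx n (q * fst x, q * snd x) \<omega> = (q * fst (next_seen x (E n 0 \<omega>)), q * snd (next_seen x (E n 0 \<omega>)))"
          unfolding Nx_def Let_def q_def[symmetric] next_seen_def seen_state_def admit_def E_def rates(2)
          using q(1) by (simp add: alg[unfolded One_nat_def] mx pos numeral_2_eq_2[symmetric])
      next
        note [measurable] = d_meas[OF n]
        show "(\<lambda>z. Nx n (fst z) (snd z)) \<in> borel_measurable (borel \<Otimes>\<^sub>M M)"
          unfolding Nx_def Let_def by measurable
      qed
      then show ?thesis unfolding \<mu>_def q_def Nx_def .
    qed
    show "1 \<le> n0" by (simp add: n0_def)
    show "0 < srv_rate n" if "n0 \<le> n" for n using rates_pos n0(1)[OF that] by simp
    show "sqrt (real n) * F n (x / sqrt (real n)) \<le> C * (1 + x powr m)" if "n0 \<le> n" "0 \<le> x" for n x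
      using growth(4) n0(1)[OF that(1)] that(2) by simp
  qed (fact u_meas v_meas ae_uv A1(1) up vp u_int(2) v_int(2) A2 growth A3(4) H_cont x0(2) \<delta> | rule d_meas pat, assumption | (erule A3(4)))+
  have H_mono: "H x \<le> H y" if xy: "0 \<le> x" "x \<le> y" for x y
  proof (rule LIMSEQ_le)
    show "(\<lambda>n. HT.Fh n x) \<longlonglongrightarrow> H x" "(\<lambda>n. HT.Fh n y) \<longlonglongrightarrow> H y" using HT.Fh_lim xy by auto
    show "\<exists>k. \<forall>n\<ge>k. HT.Fh n x \<le> HT.Fh n y" using HT.Fh_mono xy by blast
  qed
  have var_v: "variance (v 2) = variance (v 1)"
  proof -
    have same: "distr M borel (v 2) = distr M borel (v 1)" using pr(5)[rule_format, of 2] by simp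
    have mean: "expectation (v 2) = 1" "expectation (v 1) = 1" using pr(2)[rule_format, of 2] v_int by simp_all
    have "(\<integral>x. (x - 1)\<^sup>2 \<partial>distr M borel (v i)) = (\<integral>\<omega>. (v i \<omega> - 1)\<^sup>2 \<partial>M)" if "v i \<in> borel_measurable M" for i
      using that by (subst integral_distr) auto
    from this[of 1] this[of 2] show ?thesis using v_meas unfolding mean same by simp
  qed
  \<comment> \<open>An unbounded interarrival time is not almost surely constant, which makes the limit diffusion nondegenerate.\<close>
  have "0 < variance (u 2)" by (rule variance_pos_if_unbounded[OF u_meas u_int(1) u2 A5])
  moreover have "0 \<le> variance (v 2)" by (rule variance_positive)
  ultimately have s_pos: "0 < \<sigma>2"
    unfolding sigma by (intro divide_pos_pos add_pos_nonneg A2(1))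
  have s_eq: "\<sigma>2 = (HT.U2 + HT.V2 - 2) / lam"
  proof -
    have "variance (u 2) = HT.U2 - 1" using variance_eq[OF u_int(1) u2] unfolding HT.U2_def u_int(2) by simp
    moreover have "variance (v 1) = HT.V2 - 1" using variance_eq[OF v_int(1) v2] unfolding HT.V2_def v_int(2) by simp
    ultimately show ?thesis unfolding sigma var_v by simp
  qed
  define \<phi> where "\<phi> = limit_density c \<sigma>2 \<theta> lam H"
  have \<phi>: "\<phi> x = (if x \<ge> 0 then c * exp (2 / \<sigma>2 * (\<theta> / lam * x - integral {0..x} H)) else 0)" for x
    by (simp add: \<phi>_def limit_density_def)
  define hbar where "hbar = (\<integral>x. \<phi> x * H (max 0 x) \<partial>lborel)"
  obtain \<gamma> g \<Gamma> G where stein: "continuous_on UNIV \<gamma>" "\<And>x. \<bar>\<gamma> x\<bar> \<le> \<Gamma>" "\<And>x. (g has_real_derivative \<gamma> x) (at x)" "g 0 = 0"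
    "\<And>x. 0 \<le> x \<Longrightarrow> \<bar>g x\<bar> \<le> G" "\<And>x. 0 \<le> x \<Longrightarrow> \<sigma>2 / 2 * \<gamma> x + (\<theta> / lam - H x) * g x = H x - hbar"
    unfolding hbar_def
    by (rule stein_solution[where H = H and \<phi> = \<phi> and a = "\<theta> / lam" and ?s2.0 = \<sigma>2 and c = c and ?x0.0 = x0 and \<delta> = \<delta>,
      OF H_cont H_mono A3(2) x0(2) \<delta> s_pos normalization(1) \<phi> normalization(2)[folded \<phi>_def]])
      (assumption+, rule that[unfolded hbar_def], assumption+)
  have seen_limit: "(\<lambda>n. \<integral>x. H (max 0 (fst x)) \<partial>\<mu> n) \<longlonglongrightarrow> hbar"
    by (rule HT.arrival_average_limit[OF s_eq stein])
  define J where "J n x \<omega> = ennreal (sqrt (real n) * arr_rate n) * residual_cost (\<lambda>z. ennreal (F n (snd z)))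
      (fst (admit (fst x / sqrt (real n), snd x / sqrt (real n)) (E n 0 \<omega>)),
       fst (snd (admit (fst x / sqrt (real n), snd x / sqrt (real n)) (E n 0 \<omega>))))" for n and x :: "real \<times> real" and \<omega>
  have "(\<lambda>n. sqrt (real n) * abandonment_probability (F n) (\<pi> n)) \<longlonglongrightarrow> hbar"
  proof (rule HT.time_average_limit[where J = J, OF _ _ _ seen_limit])
    fix n assume n: "n0 \<le> n"
    have q: "0 < sqrt (real n)" using n0(1)[OF n] by simp
    have F_borel: "F n \<in> borel_measurable borel" by (rule borel_measurable_mono) (rule pat(4)[OF n])
    have "snd \<in> borel_measurable (\<pi> n)"
      using stationary_queue.sets_pi[OF sq[OF n]] by (simp cong: measurable_cong_sets)
    then have Pa: "abandonment_probability (F n) (\<pi> n) = (\<integral>x. F n (snd x) \<partial>\<pi> n)"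
      unfolding abandonment_probability_def by (rule integral_distr) (rule F_borel)
    show "ennreal (sqrt (real n) * abandonment_probability (F n) (\<pi> n)) = (\<integral>\<^sup>+x. (\<integral>\<^sup>+\<omega>. J n x \<omega> \<partial>M) \<partial>\<mu> n)"
      unfolding Pa J_def \<mu>_def
      by (rule stationary_queue.time_average_of_workload[OF sq[OF n] F_borel pat(5)[OF n] pat(6)[OF n] q])
    show "0 \<le> sqrt (real n) * abandonment_probability (F n) (\<pi> n)"
      unfolding Pa using pat(5)[OF n] by (intro mult_nonneg_nonneg Bochner_Integration.integral_nonneg) auto
  next
    fix n and x :: "real \<times> real" and \<omega> a b
    assume n: "n0 \<le> n" and x: "0 \<le> snd x" "snd x \<le> fst x" and uv: "0 \<le> u 2 \<omega>" "0 \<le> v 1 \<omega>" and b: "0 \<le> b"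
      and ab: "\<And>y. 0 \<le> y \<Longrightarrow> \<bar>y - fst x\<bar> \<le> HT.c0 / sqrt (real n) * HT.X \<omega> \<Longrightarrow> a \<le> HT.Fh n y \<and> HT.Fh n y \<le> b"
    define q where "q = sqrt (real n)"
    have q: "0 < q" "real n = q * q" using n0(1)[OF n] by (auto simp: q_def)
    have rates: "0 < srv_rate n" "0 < arr_rate n" "arr_rate n = q * q * lam"
      using rates_pos[OF n0(1)[OF n]] A2(2)[OF n0(1)[OF n]] q(2) by auto
    define \<tau> where "\<tau> = u 2 \<omega> / arr_rate n"
    define y where "y = fst x / q + v 1 \<omega> / srv_rate n * of_bool (snd x / q < d n 1 \<omega>)"
    have \<tau>: "0 \<le> \<tau>" using uv rates by (simp add: \<tau>_def)
    have J_eq: "J n x \<omega> = ennreal (q * arr_rate n) * residual_cost (\<lambda>z. ennreal (F n (snd z))) (\<tau>, y)"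
      by (simp add: J_def q_def \<tau>_def y_def admit_def E_def numeral_2_eq_2)
    \<comment> \<open>Until the next arrival the workload differs from what the customer met by at most one service and one
      interarrival time.\<close>
    have near: "\<bar>q * max 0 (y - s) - fst x\<bar> \<le> HT.c0 / q * HT.X \<omega>" if s: "0 \<le> s" "s < \<tau>" for s
    proof -
      have "\<bar>max 0 (y - s) - fst x / q\<bar> \<le> \<bar>y - s - fst x / q\<bar>"
        using x q(1) by (auto simp: max_def)
      also have "\<dots> \<le> v 1 \<omega> / srv_rate n + \<tau>"
      proof -
        have "0 \<le> v 1 \<omega> / srv_rate n * of_bool (snd x / q < d n 1 \<omega>)"
          "v 1 \<omega> / srv_rate n * of_bool (snd x / q < d n 1 \<omega>) \<le> v 1 \<omega> / srv_rate n" "0 \<le> v 1 \<omega> / srv_rate n"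
          using uv rates by (auto simp del: One_nat_def)
        then show ?thesis using s unfolding y_def by linarith
      qed
      finally have "q * \<bar>max 0 (y - s) - fst x / q\<bar> \<le> q * (v 1 \<omega> / srv_rate n + \<tau>)"
        using q(1) by (intro mult_left_mono) auto
      moreover have "q * \<bar>max 0 (y - s) - fst x / q\<bar> = \<bar>q * max 0 (y - s) - fst x\<bar>"
      proof -
        have "q * max 0 (y - s) - fst x = q * (max 0 (y - s) - fst x / q)" using q(1) by (simp add: right_diff_distrib)
        then show ?thesis using q(1) by (simp add: abs_mult)
      qed
      moreover have "q * (v 1 \<omega> / srv_rate n + \<tau>) = q / srv_rate n * v 1 \<omega> + 1 / (lam * q) * u 2 \<omega>"
        using q(1) A2(1) rates unfolding \<tau>_def rates(3) by (simp add: field_simps)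
      moreover have "\<dots> \<le> HT.c0 / q * v 1 \<omega> + HT.c0 / q * u 2 \<omega>"
        using HT.coeff_bound[OF n] uv unfolding q_def by (intro add_mono mult_right_mono) auto
      moreover have "\<dots> = HT.c0 / q * HT.X \<omega>" unfolding HT.X_def by (simp add: algebra_simps)
      ultimately show ?thesis by linarith
    qed
    have between: "a / q \<le> F n (max 0 (y - s)) \<and> F n (max 0 (y - s)) \<le> b / q" if s: "0 \<le> s" "s < \<tau>" for s
    proof -
      have "a \<le> HT.Fh n (q * max 0 (y - s)) \<and> HT.Fh n (q * max 0 (y - s)) \<le> b"
        by (rule ab) (use near[OF s] q(1) in \<open>auto simp: q_def\<close>)
      moreover have "HT.Fh n (q * max 0 (y - s)) = q * F n (max 0 (y - s))"
        using q(1) by (simp add: HT.Fh_def q_def)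
      ultimately show ?thesis using q(1) by (simp add: field_simps)
    qed
    have sandwich: "ennreal (a / q) * ennreal \<tau> \<le> residual_cost (\<lambda>z. ennreal (F n (snd z))) (\<tau>, y)"
        "residual_cost (\<lambda>z. ennreal (F n (snd z))) (\<tau>, y) \<le> ennreal (b / q) * ennreal \<tau>"
      by (rule residual_cost_sandwich[OF _ \<tau>], use between in \<open>auto intro!: ennreal_leI\<close>)+
    have scale: "ennreal (q * arr_rate n) * (ennreal (z / q) * ennreal \<tau>) = ennreal (u 2 \<omega> * z)" if z: "0 \<le> z" for z
    proof -
      have "ennreal (q * arr_rate n) * (ennreal (z / q) * ennreal \<tau>) = ennreal (q * arr_rate n * (z / q * \<tau>))"
        
        using z q(1) \<tau> rates(2) by (subst ennreal_mult[symmetric], simp, simp)+ simp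
      also have "q * arr_rate n * (z / q * \<tau>) = u 2 \<omega> * z" using q(1) rates(2) by (simp add: \<tau>_def)
      finally show ?thesis .
    qed
    have "ennreal (u 2 \<omega> * a) \<le> J n x \<omega>"
    proof (cases "0 \<le> a")
      case True
      show ?thesis unfolding J_eq scale[OF True, symmetric] by (rule mult_left_mono[OF sandwich(1)]) simp
    next
      case False
      then have "u 2 \<omega> * a \<le> 0" using uv(1) by (simp add: mult_nonneg_nonpos)
      then show ?thesis by (simp add: ennreal_neg)
    qed
    moreover have "J n x \<omega> \<le> ennreal (u 2 \<omega> * b)"
      unfolding J_eq scale[OF b, symmetric] by (rule mult_left_mono[OF sandwich(2)]) simp
    ultimately show "ennreal (u 2 \<omega> * a) \<le> J n x \<omega> \<and> J n x \<omega> \<le> ennreal (u 2 \<omega> * b)" ..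
  qed
  moreover have "hbar = (\<integral>\<omega>. H (Vinf \<omega>) \<partial>N)"
  proof -
    have "(\<lambda>x. H (max 0 x)) \<in> borel_measurable lborel" using HT.H_meas by simp
    from distributed_integral[OF limit_variable(2) this]
    have "hbar = (\<integral>\<omega>. H (max 0 (Vinf \<omega>)) \<partial>N)"
      unfolding hbar_def \<phi>_def
      using normalization(1) by (simp add: limit_density_def)
    also have "\<dots> = (\<integral>\<omega>. H (Vinf \<omega>) \<partial>N)"
      by (intro Bochner_Integration.integral_cong) (auto simp: max_absorb2 limit_variable(3))
    finally show ?thesis .
  qed
  ultimately show ?thesis by simp
qed

end
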